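(* Fix $R\ge4\sqrt{\|A\|}$. Let $V=V_0+W\in\mathscr P_{c.s.}^{(R,\sigma)}$, where $V_0=\frac12\sum_{j,k=1}^N\left[\frac{1+A}2\right]_{jk}X_kX_j$. Then for sufficiently small $\|W\|_{R,\sigma}$, the Schwinger-Dyson equation with potential $V$ has a unique solution amongst states $\varphi$ on $\mathscr P$ that satisfy $$|\varphi(X_{\underline j})|\le3^{|\underline j|}$$ for any multi-index $\underline j$.
   Context: $N\ge1$; $A=\mathrm{diag}(A_1,\dots,A_L,1,\dots,1)\in M_N(\mathbb C)$ with $A_k=\frac12\begin{pmatrix}\lambda_k+\lambda_k^{-1}&-i(\lambda_k-\lambda_k^{-1})\\ i(\lambda_k-\lambda_k^{-1})&\lambda_k+\lambda_k^{-1}\end{pmatrix}$, $\lambda_k>0$ (so $A>0$, $A^{T}=A^{-1}$). $\alpha_{jk}=\left[\frac2{1+A}\right]_{jk}$. $\mathscr P=\mathbb C\langle X_1,\dots,X_N\rangle$ is the $*$-algebra of non-commutative polynomials, $X_j^*=X_j$; $X_{\underline i}=X_{i_1}\cdots X_{i_n}$, $|\underline i|=n$; $\pi_n$ is the projection onto degree $n$. A state is a positive unital linear functional. $\sigma_z$ ($z\in\mathbb C$) is the algebra automorphism of $\mathscr P$ with $\sigma_z(X_j)=\sum_k[A^{iz}]_{jk}X_k$; in $\sigma_{-i}$ the $i$ is the imaginary unit. $\|\sum c(\underline i)X_{\underline i}\|_R=\sum|c(\underline i)|R^{|\underline i|}$. $\rho$ is linear with $\rho(X_{j_1}\cdots X_{j_n})=\sigma_{-i}(X_{j_n})X_{j_1}\cdots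 X_{j_{n-1}}$, $\rho(c)=c$ for constants. $\|P\|_{R,\sigma}=\sum_n\sup_{k\in\mathbb Z}\|\rho^k(\pi_n(P))\|_R$. $\mathscr P^{(R,\sigma)}$ is the completion of $\{P\in\mathscr P:\|P\|_{R,\sigma}<\infty\}$ in $\|\cdot\|_{R,\sigma}$ (a space of non-commutative power series; maps are extended degree by degree), and $\mathscr P_{c.s.}^{(R,\sigma)}=\{P\in\mathscr P^{(R,\sigma)}:\rho(P)=P\}$. $\delta_j:\mathscr P\to\mathscr P\otimes\mathscr P^{op}$ is the derivation with $\delta_j(X_i)=\delta_{i=j}1\otimes1$; $\partial_j=\sum_k\alpha_{kj}\delta_k$. $\mathscr D_j(X_{k_1}\cdots X_{k_n})=\sum_{l=1}^n\alpha_{jk_l}\sigma_{-i}(X_{k_{l+1}}\cdots X_{k_n})X_{k_1}\cdots X_{k_{l-1}}$, $\mathscr DP=(\mathscr D_1P,\dots,\mathscr D_NP)$. For $f=(f_1,\dots,f_N)$, $[\mathscr J_\sigma f]_{ij}=\partial_jf_i$; $\mathrm{Tr}(Q)=\sum_iQ_{ii}$; $f\#g=\sum_jf_jg_j$. A linear functional $\psi$ on $\mathscr P$ (evaluated termwise on power series) satisfies the Schwinger-Dyson equation with potential $V$ if $\psi(\mathscr D(V)\#P)=(\psi\otimes\psi^{op})(\mathrm{Tr}(\mathscr J_\sigma P))$ for all $P\in\mathscr P^N$.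
   Formalization: Existence is claimed only for self-adjoint V (V = V* ); uniqueness holds for all V as stated. Without self-adjointness existence fails: for N = 1, A = 1, W = ieX (e real, nonzero) the equation forces φ(X) = −ie, which is not real. *)

theory Defs
  imports "HOL-Analysis.Analysis"
begin

section \<open>The matrix \<open>A\<close> and its powers\<close>

text \<open>The index set \<open>{1,\<dots>,N}\<close> is a finite type \<open>'n\<close> with \<open>N = CARD('n)\<close>. The bijection
  \<open>idx\<close> from \<open>'n\<close> to \<open>{0..<N}\<close> fixes the order of rows and columns. Blocks are numbered from 0,
  so block \<open>k < L\<close> sits at the positions \<open>2k\<close> and \<open>2k+1\<close>.\<close>

definition modular_matrix :: "('n::finite \<Rightarrow> nat) \<Rightarrow> nat \<Rightarrow> (nat \<Rightarrow> real) \<Rightarrow> complex^'n^'n" where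
  "modular_matrix idx L lam = (\<chi> a b.
     let p = idx a; q = idx b; k = p div 2; l = complex_of_real (lam k) in
     if k < L \<and> q div 2 = k then
       (if p = q then (l + inverse l) / 2
        else if p < q then - \<i> * (l - inverse l) / 2
        else \<i> * (l - inverse l) / 2)
     else if p = q then 1 else 0)"

text \<open>Functional calculus for a positive definite matrix \<open>M\<close>: \<open>M\<^sup>z\<close> multiplies every
  eigenvector with eigenvalue \<open>x\<close> by \<open>x\<^sup>z\<close>.\<close>

definition mat_powr :: "complex^'n^'n \<Rightarrow> complex \<Rightarrow> complex^'n^'n" where
  "mat_powr M z = (THE B. \<forall>x v. M *v v = complex_of_real x *s v \<longrightarrow>
                                B *v v = (complex_of_real x powr z) *s v)"

definition alpha :: "complex^'n^'n \<Rightarrow> 'n \<Rightarrow> 'n \<Rightarrow> complex" where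
  "alpha A j k = (2 *\<^sub>R matrix_inv (mat 1 + A)) $ j $ k"

definition mat_norm :: "complex^'n^'n \<Rightarrow> real" where
  "mat_norm A = onorm (\<lambda>v. A *v v)"


section \<open>Non-commutative polynomials and power series\<close>

text \<open>A power series \<open>\<Sum>\<^sub>w c(w) X\<^sub>w\<close> is its coefficient function \<open>c\<close> on words; the
  polynomials are the power series of finite support.\<close>

type_synonym 'n ncps = "'n list \<Rightarrow> complex"

definition nc_polys :: "'n ncps set" where
  "nc_polys = {P. finite {w. P w \<noteq> 0}}"

definition nc_mon :: "'n list \<Rightarrow> 'n ncps" where
  "nc_mon v = (\<lambda>w. if w = v then 1 else 0)"

definition nc_mult :: "'n ncps \<Rightarrow> 'n ncps \<Rightarrow> 'n ncps" where
  "nc_mult P Q = (\<lambda>w. \<Sum>m\<le>length w. P (take m w) * Q (drop m w))"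

definition nc_star :: "'n ncps \<Rightarrow> 'n ncps" where
  "nc_star P = (\<lambda>w. cnj (P (rev w)))"

definition nc_proj :: "nat \<Rightarrow> 'n ncps \<Rightarrow> 'n ncps" where
  "nc_proj n P = (\<lambda>w. if length w = n then P w else 0)"

text \<open>Linear extension, degree by degree, of a map \<open>T\<close> that is given on monomials and sends
  a monomial of degree \<open>n + d\<close> to a homogeneous polynomial of degree \<open>n\<close>.\<close>

definition nc_extend :: "nat \<Rightarrow> ('n::finite list \<Rightarrow> 'n ncps) \<Rightarrow> 'n ncps \<Rightarrow> 'n ncps" where
  "nc_extend d T P = (\<lambda>w. \<Sum>v | length v = length w + d. P v * T v w)"

definition nc_sigma_var :: "complex^'n^'n \<Rightarrow> complex \<Rightarrow> 'n \<Rightarrow> 'n ncps" where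
  "nc_sigma_var A z j = (\<lambda>w. \<Sum>k\<in>UNIV. mat_powr A (\<i> * z) $ j $ k * nc_mon [k] w)"

definition nc_sigma :: "complex^'n^'n \<Rightarrow> complex \<Rightarrow> 'n ncps \<Rightarrow> 'n ncps" where
  "nc_sigma A z =
     nc_extend 0 (\<lambda>v. foldr (\<lambda>j Q. nc_mult (nc_sigma_var A z j) Q) v (nc_mon []))"

definition nc_rho :: "complex^'n^'n \<Rightarrow> 'n ncps \<Rightarrow> 'n ncps" where
  "nc_rho A = nc_extend 0 (\<lambda>v.
     if v = [] then nc_mon []
     else nc_mult (nc_sigma A (- \<i>) (nc_mon [last v])) (nc_mon (butlast v)))"

definition nc_rho_pow :: "complex^'n^'n \<Rightarrow> int \<Rightarrow> 'n ncps \<Rightarrow> 'n ncps" where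
  "nc_rho_pow A k =
     (if 0 \<le> k then nc_rho A ^^ nat k else inv (nc_rho A) ^^ nat (- k))"


section \<open>Norms and spaces of power series\<close>

text \<open>Both norms may be infinite on a given power series; the second one already on
  polynomials.\<close>

definition nc_norm :: "real \<Rightarrow> 'n ncps \<Rightarrow> ennreal" where
  "nc_norm R P = (\<Sum>\<^sub>\<infinity>w. ennreal (cmod (P w) * R ^ length w))"

definition nc_norm_sigma :: "complex^'n^'n \<Rightarrow> real \<Rightarrow> 'n ncps \<Rightarrow> ennreal" where
  "nc_norm_sigma A R P = (\<Sum>n. SUP k. nc_norm R (nc_rho_pow A k (nc_proj n P)))"

text \<open>The completion is realised inside the power series as the set of limits, in the norm
  \<open>nc_norm_sigma\<close>, of polynomials of finite norm.\<close>

definition nc_space :: "complex^'n^'n \<Rightarrow> real \<Rightarrow> 'n ncps set" where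
  "nc_space A R = {P. \<forall>e>0. \<exists>Q\<in>nc_polys. nc_norm_sigma A R Q < \<infinity> \<and>
                          nc_norm_sigma A R (\<lambda>w. P w - Q w) < e}"

definition nc_space_cs :: "complex^'n^'n \<Rightarrow> real \<Rightarrow> 'n ncps set" where
  "nc_space_cs A R = {P \<in> nc_space A R. nc_rho A P = P}"


section \<open>Derivatives\<close>

text \<open>An element of the algebraic tensor square of the polynomials is its coefficient function
  on pairs of words. As \<open>\<delta>\<^sub>j(X\<^sub>v) = \<Sum>\<^bsub>v = u j w\<^esub> X\<^sub>u \<otimes> X\<^sub>w\<close>, the coefficient of
  \<open>X\<^sub>u \<otimes> X\<^sub>w\<close> in \<open>\<delta>\<^sub>j(P)\<close> is the coefficient of \<open>X\<^sub>u X\<^sub>j X\<^sub>w\<close> in \<open>P\<close>.\<close>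

type_synonym 'n nc_tensor = "'n list \<times> 'n list \<Rightarrow> complex"

definition free_diff :: "'n \<Rightarrow> 'n ncps \<Rightarrow> 'n nc_tensor" where
  "free_diff j P = (\<lambda>(u, w). P (u @ j # w))"

definition sigma_diff :: "complex^'n^'n \<Rightarrow> 'n \<Rightarrow> 'n ncps \<Rightarrow> 'n nc_tensor" where
  "sigma_diff A j P = (\<lambda>t. \<Sum>k\<in>UNIV. alpha A k j * free_diff k P t)"

definition sigma_jacobian ::
    "complex^'n^'n \<Rightarrow> ('n \<Rightarrow> 'n ncps) \<Rightarrow> 'n \<Rightarrow> 'n \<Rightarrow> 'n nc_tensor" where
  "sigma_jacobian A f i j = sigma_diff A j (f i)"

definition tensor_trace :: "('n::finite \<Rightarrow> 'n \<Rightarrow> 'n nc_tensor) \<Rightarrow> 'n nc_tensor" where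
  "tensor_trace Q = (\<lambda>t. \<Sum>i\<in>UNIV. Q i i t)"

definition cyclic_diff :: "complex^'n^'n \<Rightarrow> 'n \<Rightarrow> 'n ncps \<Rightarrow> 'n ncps" where
  "cyclic_diff A j = nc_extend 1 (\<lambda>v w. \<Sum>l<length v.
     alpha A j (v ! l) *
     nc_mult (nc_sigma A (- \<i>) (nc_mon (drop (Suc l) v))) (nc_mon (take l v)) w)"

definition cyclic_grad :: "complex^'n^'n \<Rightarrow> 'n ncps \<Rightarrow> 'n \<Rightarrow> 'n ncps" where
  "cyclic_grad A P j = cyclic_diff A j P"

definition nc_dot :: "('n::finite \<Rightarrow> 'n ncps) \<Rightarrow> ('n \<Rightarrow> 'n ncps) \<Rightarrow> 'n ncps" where
  "nc_dot f g = (\<lambda>w. \<Sum>j\<in>UNIV. nc_mult (f j) (g j) w)"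


section \<open>States and the Schwinger-Dyson equation\<close>

text \<open>Functionals on the polynomials are represented by functions on all power series, of
  which only the values on \<open>nc_polys\<close> matter.\<close>

definition nc_linear :: "('n ncps \<Rightarrow> complex) \<Rightarrow> bool" where
  "nc_linear \<phi> \<longleftrightarrow>
     (\<forall>P\<in>nc_polys. \<forall>Q\<in>nc_polys. \<phi> (\<lambda>w. P w + Q w) = \<phi> P + \<phi> Q) \<and>
     (\<forall>c. \<forall>P\<in>nc_polys. \<phi> (\<lambda>w. c * P w) = c * \<phi> P)"

definition nc_state :: "('n ncps \<Rightarrow> complex) \<Rightarrow> bool" where
  "nc_state \<phi> \<longleftrightarrow> nc_linear \<phi> \<and> \<phi> (nc_mon []) = 1 \<and>
     (\<forall>P\<in>nc_polys. \<phi> (nc_mult (nc_star P) P) \<in> \<real>\<^sub>\<ge>\<^sub>0)"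

definition tensor_eval :: "('n ncps \<Rightarrow> complex) \<Rightarrow> 'n nc_tensor \<Rightarrow> complex" where
  "tensor_eval \<phi> Q = (\<Sum>(u, w) | Q (u, w) \<noteq> 0. Q (u, w) * \<phi> (nc_mon u) * \<phi> (nc_mon w))"

text \<open>The left-hand side evaluates \<open>\<phi>\<close> termwise on a power series; its convergence is part of
  the equation.\<close>

definition schwinger_dyson ::
    "complex^'n^'n \<Rightarrow> 'n ncps \<Rightarrow> ('n ncps \<Rightarrow> complex) \<Rightarrow> bool" where
  "schwinger_dyson A V \<phi> \<longleftrightarrow> (\<forall>P. (\<forall>i. P i \<in> nc_polys) \<longrightarrow>
     ((\<lambda>w. nc_dot (cyclic_grad A V) P w * \<phi> (nc_mon w)) has_sum
        tensor_eval \<phi> (tensor_trace (sigma_jacobian A P))) UNIV)"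

definition V_quad :: "complex^'n^'n \<Rightarrow> 'n ncps" where
  "V_quad A = (\<lambda>w. 1 / 2 *
     (\<Sum>j\<in>UNIV. \<Sum>k\<in>UNIV. ((1 / 2) *\<^sub>R (mat 1 + A)) $ j $ k * nc_mon [k, j] w))"

text \<open>A potential that is not self-adjoint need not admit a solution: for \<open>N = 1\<close> and
  \<open>V = X\<^sup>2/2 + i e X\<close> with real \<open>e \<noteq> 0\<close>, the equation for \<open>P = 1\<close> reads \<open>\<phi>(X) = - i e\<close>, whereas
  \<open>\<phi>(X)\<close> is real for every state. Uniqueness does not need this.\<close>

definition sd_solution ::
    "complex^'n^'n \<Rightarrow> 'n ncps \<Rightarrow> ('n ncps \<Rightarrow> complex) \<Rightarrow> bool" where
  "sd_solution A V \<phi> \<longleftrightarrow> nc_state \<phi> \<and> schwinger_dyson A V \<phi> \<and>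
     (\<forall>w. cmod (\<phi> (nc_mon w)) \<le> 3 ^ length w)"

end

theory Submission
  imports Defs "HOL-Library.Poly_Mapping" "HOL-Complex_Analysis.Great_Picard" "HOL-Computational_Algebra.Formal_Power_Series" "HOL-Real_Asymp.Real_Asymp"
begin

text \<open>
  The Schwinger-Dyson equation is equivalent to a recursion on words. Since \<open>\<rho>(V) = V\<close>, the
  \<open>|u| + 1\<close> terms that contribute to the coefficient of a word \<open>u\<close> in the cyclic gradient are
  equal, and \<open>\<D>\<^sub>j V = X\<^sub>j + d\<^sub>j\<close> with \<open>d\<^sub>j(u) = (|u| + 1) (\<Sum>\<^sub>k \<alpha>\<^sub>j\<^sub>k W(u k))\<close>. Hence \<open>\<phi>\<close> is a
  solution if and only if
  \<open>\<phi>(j w) = (\<Sum>\<^bsub>w = a k b\<^esub> \<alpha>\<^sub>k\<^sub>j \<phi>(a) \<phi>(b)) - (\<Sum>\<^sub>u d\<^sub>j(u) \<phi>(u w))\<close>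
  for every letter \<open>j\<close> and word \<open>w\<close> (\<open>schwinger_dyson_iff_sd_word\<close>), and if \<open>\<parallel>W\<parallel>\<close> is small, so
  is the \<^emph>\<open>drift\<close> \<open>d\<close> (\<open>small_driftI\<close>).

  \<^bold>\<open>Uniqueness.\<close> On functionals with \<open>|\<phi>(w)| \<le> 3\<^bsup>|w|\<^esup>\<close> the right-hand side of the recursion is a
  contraction in the norm \<open>sup\<^sub>w |\<phi>(w)| (37/10)\<^bsup>- |w|\<^esup>\<close>: a splitting \<open>w = a k b\<close> costs a
  geometric series with ratio \<open>3 / (37/10)\<close>, and the drift costs \<open>1/20\<close>.

  \<^bold>\<open>Existence without positivity.\<close> For a drift of finite support, put a parameter \<open>t\<close> in front
  of it and solve the recursion in formal power series in \<open>t\<close>. A majorant (\<open>om_convolution\<close>)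
  shows that the series converge absolutely at \<open>t = 1\<close> and that their sums satisfy the bound
  \<open>3\<^bsup>|w|\<^esup>\<close>.

  \<^bold>\<open>Positivity.\<close> This is the difficult part: the recursion removes the first letter of a word
  and does not show any positivity. It is obtained from a dynamics for which the solution is
  stationary. The first step is to show that the equation holds with the letter \<open>j\<close> at every
  position of the word, not only at the first one. A solution in power series has two kinds of
  defect, the failure of this equation and the failure of the KMS condition, which moves a
  letter from the end of a word to its front at the cost of the matrix \<open>A\<close>. As the drift is the
  cyclic gradient of an invariant potential, the defects satisfy linear recursions that express
  them through defects of shorter words and \<open>t\<close> times other defects; so they are divisible by
  all powers of \<open>t\<close>, and vanish (\<open>defects_divisible\<close>). Summing the equation over the positions
  in a word gives \<open>gen \<phi> \<phi> = 0\<close>, where \<open>gen \<psi> f\<close> is, up to sign, the time derivative of \<open>f\<close>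
  under the free Langevin equation \<open>dX\<^sub>j = - \<D>\<^sub>j V dt + \<surd>2 dS\<^sub>j\<close>, with the words that stand
  between two contracted noise letters evaluated in \<open>\<psi>\<close> (\<open>sol_stationary\<close>).

  The second step is that every \<open>\<phi>\<close> of moderate growth with \<open>gen \<phi> \<phi> = 0\<close> is positive
  (\<open>stationary_positive\<close>). For a fixed positive \<open>\<psi>\<close> the linear evolution with generator \<open>gen \<psi>\<close>
  is approximated by steps of length \<open>h\<close>, each of which preserves positivity: add noise, which
  is positive by the Schur product theorem (\<open>positive_noise\<close>), then substitute
  \<open>X\<^sub>j - h (X\<^sub>j + d\<^sub>j)\<close> for \<open>X\<^sub>j\<close> (\<open>positive_subst\<close>). The steps also preserve the bound
  \<open>(37/10)\<^bsup>|w|\<^esup>\<close>, so averages over longer and longer times have a limit point \<open>\<xi>\<close>, which is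
  positive and satisfies \<open>gen \<psi> \<xi> = 0\<close> (\<open>positive_stationary_exists\<close>). The map \<open>\<psi> \<mapsto> \<xi>\<close> contracts
  towards \<open>\<phi>\<close>, by the estimate that gives uniqueness. Iterating it from evaluation at \<open>0\<close> yields
  positive functionals that converge to \<open>\<phi>\<close>.

  Finally, drifts of infinite support are approximated by their truncations to words of length
  below \<open>N\<close>; the solutions are bounded by \<open>3\<^bsup>|w|\<^esup>\<close>, so a subsequence converges, and its limit is
  a solution, because \<open>d\<close> is summable with the larger weight \<open>(19/5)\<^bsup>|w|\<^esup>\<close>
  (\<open>gibbs_state_exists\<close>).
\<close>

section \<open>Sums over the letters of a word\<close>

text \<open>\<open>ssum w F\<close> is the sum of \<open>F a k b\<close> over all ways to write \<open>w = a k b\<close> with a letter \<open>k\<close>. The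
  recursion on \<open>w\<close> lets \<open>induction\<close> and \<open>simp\<close> handle such sums without indices into lists.\<close>

primrec ssum :: "'n list \<Rightarrow> ('n list \<Rightarrow> 'n \<Rightarrow> 'n list \<Rightarrow> 'b::comm_monoid_add) \<Rightarrow> 'b" where
  "ssum [] F = 0"
| "ssum (j # w) F = F [] j w + ssum w (\<lambda>a. F (j # a))"

lemma ssum_cong [fundef_cong]:
  assumes "w = w'" "\<And>a k b. w' = a @ k # b \<Longrightarrow> F a k b = G a k b"
  shows "ssum w F = ssum w' G"
  unfolding assms(1) using assms(2)
proof (induction w' arbitrary: F G)
  case (Cons j w)
  have "ssum w (\<lambda>a. F (j # a)) = ssum w (\<lambda>a. G (j # a))"
    by (rule Cons.IH) (auto intro!: Cons.prems)
  moreover have "F [] j w = G [] j w" by (auto intro!: Cons.prems)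
  ultimately show ?case by simp
qed auto

lemma ssum_append:
  "ssum (u @ v) F = ssum u (\<lambda>a k b. F a k (b @ v)) + ssum v (\<lambda>a k b. F (u @ a) k b)"
  by (induction u arbitrary: F) (auto simp: add.assoc)

lemma ssum_conv_sum:
  "ssum w F = (\<Sum>i<length w. F (take i w) (w ! i) (drop (Suc i) w))"
proof (induction w arbitrary: F)
  case (Cons j w)
  show ?case by (simp add: Cons.IH sum.lessThan_Suc_shift del: sum.lessThan_Suc)
qed auto

lemma ssum_0 [simp]: "ssum w (\<lambda>a k b. 0) = 0"
  by (induction w) auto

lemma ssum_add: "ssum w (\<lambda>a k b. F a k b + G a k b) = ssum w F + ssum w G"
  by (simp add: ssum_conv_sum sum.distrib)

lemma ssum_diff: "ssum w (\<lambda>a k b. F a k b - G a k b) = ssum w F - ssum w (G :: _ \<Rightarrow> _ \<Rightarrow> _ \<Rightarrow> 'b::ab_group_add)"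
  by (simp add: ssum_conv_sum sum_subtractf)

lemma ssum_mult_left: "ssum w (\<lambda>a k b. c * F a k b) = c * ssum w (F :: _ \<Rightarrow> _ \<Rightarrow> _ \<Rightarrow> 'b::semiring_0)"
  by (simp add: ssum_conv_sum sum_distrib_left)

lemma ssum_mult_right: "ssum w (\<lambda>a k b. F a k b * c) = ssum w (F :: _ \<Rightarrow> _ \<Rightarrow> _ \<Rightarrow> 'b::semiring_0) * c"
  by (simp add: ssum_conv_sum sum_distrib_right)

lemma ssum_sum: "ssum w (\<lambda>a k b. \<Sum>i\<in>I. F i a k b) = (\<Sum>i\<in>I. ssum w (F i))"
  by (simp add: ssum_conv_sum sum.swap[of _ I])

lemma ssum_commute:
  "ssum v (\<lambda>a k b. ssum w (\<lambda>a' k' b'. F a k b a' k' b')) = ssum w (\<lambda>a' k' b'. ssum v (\<lambda>a k b. F a k b a' k' b'))"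
  unfolding ssum_conv_sum by (rule sum.swap)

text \<open>Both sides run over the pairs of letters of \<open>w\<close>: choosing the right one first or the left one
  first makes no difference. Hence the contractions of a letter to its left and those to its
  right have the same sum, which is used in \<open>sol_stationary\<close>.\<close>

lemma ssum_assoc:
  "ssum w (\<lambda>a k b. ssum a (\<lambda>a' k' b'. F a' k' b' k b))
     = ssum w (\<lambda>a' k' c. ssum c (\<lambda>b' k b. F a' k' b' k b))"
  by (induction w arbitrary: F) (auto simp: ssum_add)

lemma norm_ssum: "norm (ssum w F) \<le> ssum w (\<lambda>a k b. norm (F a k b :: 'b::real_normed_vector))"
  unfolding ssum_conv_sum by (rule norm_sum)

lemma ssum_mono:
  assumes "\<And>a k b. w = a @ k # b \<Longrightarrow> F a k b \<le> (G a k b :: real)"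
  shows "ssum w F \<le> ssum w G"
  unfolding ssum_conv_sum
  by (intro sum_mono assms) (simp add: id_take_nth_drop)

lemma ssum_length: "ssum w (\<lambda>a k b. f (length a) (length b)) = (\<Sum>i<length w. f i (length w - 1 - i))"
  unfolding ssum_conv_sum by (intro sum.cong) auto

lemma norm_ssum_le:
  assumes "\<And>a k b. w = a @ k # b \<Longrightarrow> norm (F a k b :: 'b::real_normed_vector) \<le> f (length a) (length b)"
  shows "norm (ssum w F) \<le> (\<Sum>i<length w. f i (length w - 1 - i))"
proof -
  have "norm (ssum w F) \<le> ssum w (\<lambda>a k b. norm (F a k b))" by (rule norm_ssum)
  also have "\<dots> \<le> ssum w (\<lambda>a k b. f (length a) (length b))" by (intro ssum_mono assms)
  finally show ?thesis by (simp add: ssum_length)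
qed

lemma geometric_convolution:
  fixes b K :: real
  assumes "0 \<le> b" "b < K"
  shows "(\<Sum>i<n. b ^ i * K ^ (n - 1 - i)) \<le> K ^ n / (K - b)"
proof -
  have "K ^ n - b ^ n = (K - b) * (\<Sum>i<n. b ^ (n - Suc i) * K ^ i)"
    by (rule power_diff_sumr2)
  also have "(\<Sum>i<n. b ^ (n - Suc i) * K ^ i) = (\<Sum>i<n. b ^ i * K ^ (n - 1 - i))"
    by (subst sum.nat_diff_reindex[symmetric]) (intro sum.cong, auto)
  finally have "(\<Sum>i<n. b ^ i * K ^ (n - 1 - i)) * (K - b) = K ^ n - b ^ n" by simp
  also have "\<dots> \<le> K ^ n" using assms by simp
  finally show ?thesis using assms by (simp add: pos_le_divide_eq)
qed

lemma geometric_convolution':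
  fixes b K :: real
  assumes "0 \<le> b" "b < K"
  shows "(\<Sum>i<n. K ^ i * b ^ (n - 1 - i)) \<le> K ^ n / (K - b)"
proof -
  have "(\<Sum>i<n. K ^ i * b ^ (n - 1 - i)) = (\<Sum>i<n. b ^ i * K ^ (n - 1 - i))"
    by (subst sum.nat_diff_reindex[symmetric]) (intro sum.cong, auto)
  then show ?thesis using geometric_convolution[OF assms, of n] by simp
qed

section \<open>The Schwinger-Dyson equation on words, and uniqueness\<close>

text \<open>The Schwinger-Dyson equation tested on monomials, for a potential with cyclic gradient
  \<open>X\<^sub>j + d\<^sub>j\<close>; the term \<open>\<phi>(j w)\<close> comes from the quadratic part of the potential.\<close>

definition sd_word :: "('n \<Rightarrow> 'n \<Rightarrow> complex) \<Rightarrow> ('n \<Rightarrow> 'n ncps) \<Rightarrow> 'n ncps \<Rightarrow> bool" where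
  "sd_word al d \<phi> \<longleftrightarrow> \<phi> [] = 1 \<and> (\<forall>j w. ((\<lambda>u. d j u * \<phi> (u @ w)) has_sum
       (ssum w (\<lambda>a k b. al k j * \<phi> a * \<phi> b) - \<phi> (j # w))) UNIV)"

text \<open>Three growth rates occur. Solutions grow like \<open>3\<^bsup>|w|\<^esup>\<close>; differences of solutions, and the
  approximations to stationary functionals, are controlled with the rate \<open>37/10\<close>, which makes
  \<open>2 / (37/10 - 3) + 1/20 \<le> 9/10 * (37/10)\<close>; and the drift is summable with the rate \<open>19/5\<close>,
  which leaves room above \<open>37/10\<close> for one step of noise and lies below the radius \<open>4\<close> of the
  potential, so that a derivative can be taken.\<close>

definition small_drift :: "('n \<Rightarrow> 'n ncps) \<Rightarrow> bool" where
  "small_drift d \<longleftrightarrow> (\<forall>j. (\<lambda>u. cmod (d j u) * (19/5) ^ length u) summable_on UNIV \<and>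
      (\<Sum>\<^sub>\<infinity>u. cmod (d j u) * (19/5) ^ length u) \<le> 1/20)"

lemma small_drift_sum:
  assumes "small_drift d" "0 \<le> r" "r \<le> 19/5"
  shows "(\<lambda>u. cmod (d j u) * r ^ length u) summable_on UNIV"
    and "(\<Sum>\<^sub>\<infinity>u. cmod (d j u) * r ^ length u) \<le> 1/20"
proof -
  have 1: "(\<lambda>u. cmod (d j u) * (19/5) ^ length u) summable_on UNIV"
    and 2: "(\<Sum>\<^sub>\<infinity>u. cmod (d j u) * (19/5) ^ length u) \<le> 1/20"
    using assms by (auto simp: small_drift_def)
  have le: "cmod (d j u) * r ^ length u \<le> cmod (d j u) * (19/5) ^ length u" for u
    by (intro mult_left_mono power_mono) (use assms in auto)
  show 3: "(\<lambda>u. cmod (d j u) * r ^ length u) summable_on UNIV"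
    by (rule summable_on_comparison_test[OF 1]) (use assms le in auto)
  have "(\<Sum>\<^sub>\<infinity>u. cmod (d j u) * r ^ length u) \<le> (\<Sum>\<^sub>\<infinity>u. cmod (d j u) * (19/5) ^ length u)"
    by (intro infsum_mono 1 3 le)
  with 2 show "(\<Sum>\<^sub>\<infinity>u. cmod (d j u) * r ^ length u) \<le> 1/20" by simp
qed

lemma small_drift_has_sum_bound:
  assumes d: "small_drift d" and r: "0 \<le> r" "r \<le> 19/5" and C: "C \<ge> 0"
    and s: "((\<lambda>u. d j u * f u) has_sum s) UNIV"
    and f: "\<And>u. cmod (f u) \<le> C * r ^ length u"
  shows "cmod s \<le> C / 20"
proof -
  have le: "cmod (d j u * f u) \<le> C * (cmod (d j u) * r ^ length u)" for u
    using mult_left_mono[OF f[of u], of "cmod (d j u)"] by (simp add: norm_mult mult_ac)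
  have sm: "(\<lambda>u. C * (cmod (d j u) * r ^ length u)) summable_on UNIV"
    by (intro summable_on_cmult_right small_drift_sum[OF d r])
  have sm': "(\<lambda>u. cmod (d j u * f u)) summable_on UNIV"
    by (rule summable_on_comparison_test[OF sm]) (use le in auto)
  have "cmod s = cmod (\<Sum>\<^sub>\<infinity>u. d j u * f u)" using s by (simp add: infsumI)
  also have "\<dots> \<le> (\<Sum>\<^sub>\<infinity>u. cmod (d j u * f u))"
    by (rule norm_infsum_bound) (use sm' in simp)
  also have "\<dots> \<le> (\<Sum>\<^sub>\<infinity>u. C * (cmod (d j u) * r ^ length u))"
    by (intro infsum_mono sm sm' le)
  also have "\<dots> = C * (\<Sum>\<^sub>\<infinity>u. cmod (d j u) * r ^ length u)"
    by (rule infsum_cmult_right) (use small_drift_sum[OF d r] in simp)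
  also have "\<dots> \<le> C * (1/20)" by (intro mult_left_mono small_drift_sum[OF d r] C)
  finally show ?thesis by simp
qed

lemma has_sum_diff:
  fixes f g :: "'a \<Rightarrow> 'b::real_normed_vector"
  assumes "(f has_sum a) S" "(g has_sum b) S"
  shows "((\<lambda>x. f x - g x) has_sum (a - b)) S"
proof -
  have "((\<lambda>x. - g x) has_sum - b) S" using assms(2) by (simp add: has_sum_uminus)
  from has_sum_add[OF assms(1) this] show ?thesis by simp
qed

text \<open>The product \<open>\<phi>(a) \<phi>(b)\<close> changes by \<open>\<phi>(a) (\<phi>(b) - \<psi>(b)) + (\<phi>(a) - \<psi>(a)) \<psi>(b)\<close>, and for \<open>|w| = n\<close>
  each of the two summands contributes at most \<open>\<delta> K\<^bsup>n\<^esup> / (K - 3)\<close> with \<open>K = 37/10\<close>.\<close>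

lemma sd_word_contraction:
  assumes al: "\<And>j k. cmod (al j k) \<le> 1" and d: "small_drift d"
    and sd: "sd_word al d \<phi>" "sd_word al d \<psi>"
    and b: "\<And>w. cmod (\<phi> w) \<le> 3 ^ length w" "\<And>w. cmod (\<psi> w) \<le> 3 ^ length w"
    and D: "\<And>w. cmod (\<phi> w - \<psi> w) \<le> \<delta> * (37/10) ^ length w"
  shows "cmod (\<phi> w - \<psi> w) \<le> (9/10 * \<delta>) * (37/10) ^ length w"
proof -
  have d0: "\<delta> \<ge> 0" using order_trans[OF norm_ge_zero D[of "[]"]] by simp
  show ?thesis
  proof (cases w)
    case Nil
    then show ?thesis using sd d0 by (simp add: sd_word_def)
  next
    case (Cons j v)
    let ?n = "length v" and ?K = "37/10 :: real"
    let ?S = "\<lambda>\<phi>. ssum v (\<lambda>a k b. al k j * \<phi> a * \<phi> b)"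
    have hs: "((\<lambda>u. d j u * (\<phi> (u @ v) - \<psi> (u @ v))) has_sum
                 ((?S \<phi> - \<phi> w) - (?S \<psi> - \<psi> w))) UNIV"
      using sd Cons unfolding sd_word_def
      by (auto simp: right_diff_distrib intro!: has_sum_diff)
    have 1: "cmod ((?S \<phi> - \<phi> w) - (?S \<psi> - \<psi> w)) \<le> (\<delta> * ?K ^ ?n) / 20"
      by (rule small_drift_has_sum_bound[OF d _ _ _ hs, where r = ?K])
         (use d0 D[of "_ @ v"] in \<open>auto simp: power_add mult_ac\<close>)
    have "?S \<phi> - ?S \<psi> = ssum v (\<lambda>a k b. al k j * (\<phi> a * (\<phi> b - \<psi> b) + (\<phi> a - \<psi> a) * \<psi> b))"
      by (simp add: ssum_diff[symmetric] algebra_simps)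
    also have "cmod \<dots> \<le> (\<Sum>i<?n. 3 ^ i * (\<delta> * ?K ^ (?n - 1 - i)) + (\<delta> * ?K ^ i) * 3 ^ (?n - 1 - i))"
    proof (rule norm_ssum_le)
      fix a k c
      have "cmod (al k j * (\<phi> a * (\<phi> c - \<psi> c) + (\<phi> a - \<psi> a) * \<psi> c))
              \<le> 1 * cmod (\<phi> a * (\<phi> c - \<psi> c) + (\<phi> a - \<psi> a) * \<psi> c)"
        unfolding norm_mult by (intro mult_right_mono al) auto
      also have "\<dots> \<le> cmod (\<phi> a) * cmod (\<phi> c - \<psi> c) + cmod (\<phi> a - \<psi> a) * cmod (\<psi> c)"
        using norm_triangle_ineq[of "\<phi> a * (\<phi> c - \<psi> c)" "(\<phi> a - \<psi> a) * \<psi> c"] by (simp add: norm_mult)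
      also have "\<dots> \<le> 3 ^ length a * (\<delta> * ?K ^ length c) + (\<delta> * ?K ^ length a) * 3 ^ length c"
        by (intro add_mono mult_mono b D) (use d0 in auto)
      finally show "cmod (al k j * (\<phi> a * (\<phi> c - \<psi> c) + (\<phi> a - \<psi> a) * \<psi> c))
          \<le> 3 ^ length a * (\<delta> * ?K ^ length c) + (\<delta> * ?K ^ length a) * 3 ^ length c" .
    qed
    also have "\<dots> = \<delta> * ((\<Sum>i<?n. 3 ^ i * ?K ^ (?n - 1 - i)) + (\<Sum>i<?n. ?K ^ i * 3 ^ (?n - 1 - i)))"
      by (simp add: sum.distrib sum_distrib_left mult_ac distrib_left)
    also have "\<dots> \<le> \<delta> * (?K ^ ?n / (?K - 3) + ?K ^ ?n / (?K - 3))"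
      by (intro mult_left_mono add_mono geometric_convolution geometric_convolution' d0) auto
    finally have 2: "cmod (?S \<phi> - ?S \<psi>) \<le> \<delta> * ?K ^ ?n * (20/7)" by simp
    have "\<phi> w - \<psi> w = (?S \<phi> - ?S \<psi>) - ((?S \<phi> - \<phi> w) - (?S \<psi> - \<psi> w))" by simp
    then have "cmod (\<phi> w - \<psi> w) \<le> cmod (?S \<phi> - ?S \<psi>) + cmod ((?S \<phi> - \<phi> w) - (?S \<psi> - \<psi> w))"
      by (metis norm_triangle_ineq4)
    also have "\<dots> \<le> \<delta> * ?K ^ ?n * (20/7 + 1/20)" using 1 2 by simp
    also have "\<dots> \<le> \<delta> * ?K ^ ?n * (9/10 * ?K)" by (intro mult_left_mono) (use d0 in auto)
    also have "\<dots> = (9/10 * \<delta>) * ?K ^ length w" using Cons by simp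
    finally show ?thesis .
  qed
qed

lemma le_zero_of_geometric:
  fixes x c q :: real
  assumes "\<And>m::nat. x \<le> c * q ^ m" "0 \<le> q" "q < 1"
  shows "x \<le> 0"
proof -
  have "(\<lambda>m. c * q ^ m) \<longlonglongrightarrow> c * 0"
    by (intro tendsto_mult tendsto_const LIMSEQ_realpow_zero assms)
  then have "x \<le> c * 0"
    by (rule LIMSEQ_le_const) (use assms in auto)
  then show ?thesis by simp
qed

lemma sd_word_unique:
  assumes al: "\<And>j k. cmod (al j k) \<le> 1" and d: "small_drift d"
    and sd: "sd_word al d \<phi>" "sd_word al d \<psi>"
    and b: "\<And>w. cmod (\<phi> w) \<le> 3 ^ length w" "\<And>w. cmod (\<psi> w) \<le> 3 ^ length w"
  shows "\<phi> = \<psi>"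
proof
  fix w
  have "cmod (\<phi> w - \<psi> w) \<le> (2 * (9/10) ^ m) * (37/10) ^ length w" for m w
  proof (induction m arbitrary: w)
    case 0
    have "cmod (\<phi> w - \<psi> w) \<le> 3 ^ length w + 3 ^ length w"
      using norm_triangle_ineq4[of "\<phi> w" "\<psi> w"] b[of w] by linarith
    also have "\<dots> \<le> 2 * (37/10) ^ length w"
      using power_mono[of 3 "37/10 :: real" "length w"] by simp
    finally show ?case by simp
  next
    case (Suc m)
    show ?case using sd_word_contraction[OF al d sd b Suc.IH, of w] by (simp add: mult_ac)
  qed
  then have "cmod (\<phi> w - \<psi> w) \<le> (2 * (37/10) ^ length w) * (9/10) ^ m" for m
    by (simp add: mult_ac)
  then have "cmod (\<phi> w - \<psi> w) \<le> 0" by (rule le_zero_of_geometric) auto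
  then show "\<phi> w = \<psi> w" by simp
qed

section \<open>Moving the distinguished letter into a word\<close>

definition words :: "nat \<Rightarrow> 'n::finite list set" where
  "words n = {w. length w = n}"

definition words_below :: "nat \<Rightarrow> 'n::finite list set" where
  "words_below n = {w. length w < n}"

lemma finite_words [simp]: "finite (words n :: 'n::finite list set)"
  using finite_lists_length_eq[of "UNIV :: 'n set" n] by (simp add: words_def)

lemma finite_words_below [simp]: "finite (words_below n :: 'n::finite list set)"
proof -
  have "words_below n = (\<Union>m<n. words m :: 'n list set)" by (auto simp: words_below_def words_def)
  then show ?thesis by simp
qed

lemma words_0 [simp]: "words 0 = {[]}" by (auto simp: words_def)

lemma sum_words_Suc: "(\<Sum>w\<in>words (Suc n). F w) = (\<Sum>j\<in>UNIV. \<Sum>w\<in>words n. F (j # w))"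
  unfolding sum.cartesian_product
  by (rule sum.reindex_bij_witness[of _ "\<lambda>(j, w). j # w" "\<lambda>w. (hd w, tl w)"])
     (auto simp: words_def hd_Cons_tl simp flip: length_greater_0_conv)

lemma sum_words_Suc': "(\<Sum>w\<in>words (Suc n). F w) = (\<Sum>w\<in>words n. \<Sum>j\<in>UNIV. F (w @ [j]))"
  unfolding sum.cartesian_product
  by (rule sum.reindex_bij_witness[of _ "\<lambda>(w, j). w @ [j]" "\<lambda>w. (butlast w, last w)"])
     (auto simp: words_def length_Suc_conv_rev)

lemma sum_words_below_swap:
  "(\<Sum>u\<in>words_below N. \<Sum>v\<in>words (length u). F u v) = (\<Sum>v\<in>words_below N. \<Sum>u\<in>words (length v). F u v)"
  unfolding sum.Sigma[OF finite_words_below ballI[OF finite_words]]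
  by (rule sum.reindex_bij_witness[of _ "\<lambda>(v, u). (u, v)" "\<lambda>(u, v). (v, u)"])
     (auto simp: words_def words_below_def)

text \<open>A word with a marked letter is a triple of a prefix, a letter and a suffix. In this form the
  roles of prefix and suffix can be exchanged.\<close>

lemma sum_ssum_words_below:
  "(\<Sum>u\<in>words_below N. ssum u F)
     = (\<Sum>(p, q) | p + q + 1 < N. \<Sum>a\<in>words p. \<Sum>b\<in>words q. \<Sum>k\<in>UNIV. F a k b)"
proof -
  have fin: "finite {(p, q). p + q + 1 < N}"
    by (rule finite_subset[of _ "{..<N} \<times> {..<N}"]) auto
  have "(\<Sum>u\<in>words_below N. ssum u F)
      = (\<Sum>(u, i)\<in>Sigma (words_below N) (\<lambda>u. {..<length u}). F (take i u) (u ! i) (drop (Suc i) u))"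
    unfolding ssum_conv_sum by (subst sum.Sigma) auto
  also have "\<dots> = (\<Sum>(x, a, b, k)\<in>Sigma {(p, q). p + q + 1 < N} (\<lambda>(p, q). words p \<times> words q \<times> UNIV). F a k b)"
    by (rule sum.reindex_bij_witness[of _ "\<lambda>(x, a, b, k). (a @ k # b, length a)"
          "\<lambda>(u, i). ((i, length u - Suc i), take i u, drop (Suc i) u, u ! i)"])
       (auto simp: words_def words_below_def id_take_nth_drop[symmetric])
  also have "\<dots> = (\<Sum>(p, q) | p + q + 1 < N. \<Sum>(a, b, k)\<in>words p \<times> words q \<times> UNIV. F a k b)"
    by (subst sum.Sigma[OF fin, symmetric]) (auto simp: split_def)
  finally show ?thesis by (simp add: sum.cartesian_product)
qed

text \<open>The matrix entry of the tensor power of \<open>A\<close> between two words of the same length, with the words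
  in the order (column, row).\<close>

definition tw :: "('n \<Rightarrow> 'n \<Rightarrow> 'r::comm_ring_1) \<Rightarrow> 'n list \<Rightarrow> 'n list \<Rightarrow> 'r" where
  "tw A c c' = prod_list (map2 (\<lambda>x y. A y x) c c')"

lemma tw_Nil [simp]: "tw A [] [] = 1" by (simp add: tw_def)
lemma tw_Cons [simp]: "tw A (j # c) (j' # c') = A j' j * tw A c c'" by (simp add: tw_def)
lemma tw_snoc: "length c = length c' \<Longrightarrow> tw A (c @ [j]) (c' @ [j']) = A j' j * tw A c c'"
  by (simp add: tw_def mult.commute)

text \<open>A solution \<open>\<phi>\<close> of the Schwinger-Dyson recursion with values in a commutative ring and with the
  drift multiplied by \<open>t\<close>. The hypothesis \<open>al_flip\<close> is the KMS condition for the covariance \<open>\<alpha>\<close>;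
  \<open>cov\<close> says that the drift transforms under \<open>A\<close> like the variables; and \<open>hess\<close> is the symmetry
  of the second derivatives of an invariant potential: instead of differentiating by the \<open>i\<close>-th
  and then by the \<open>j\<close>-th variable one may exchange the order, up to a rotation of the word,
  which twists the rotated block \<open>b\<close> by \<open>A\<close>.\<close>

locale sd_ring =
  fixes al A :: "'n::finite \<Rightarrow> 'n \<Rightarrow> 'r::comm_ring_1" and d :: "'n \<Rightarrow> 'n list \<Rightarrow> 'r"
    and N :: nat and t :: 'r and \<phi> :: "'n list \<Rightarrow> 'r"
  assumes phi_Nil: "\<phi> [] = 1"
    and phi_Cons: "\<phi> (j # w) = ssum w (\<lambda>a k b. al k j * \<phi> a * \<phi> b)
                     - t * (\<Sum>u\<in>words_below N. d j u * \<phi> (u @ w))"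
    and al_flip: "al j k = (\<Sum>m\<in>UNIV. al k m * A m j)"
    and cov: "(\<Sum>m\<in>UNIV. A m j * d m u) = (\<Sum>v\<in>words (length u). d j v * tw A v u)"
    and hess: "(\<Sum>k\<in>UNIV. al j k * d i (a @ k # b))
                 = (\<Sum>c\<in>words (length b). tw A c b * (\<Sum>k\<in>UNIV. al k i * d j (c @ k # a)))"
begin

text \<open>The failure of the Schwinger-Dyson equation for the letter \<open>j\<close> standing between \<open>P\<close> and \<open>Q\<close>. A
  contraction of \<open>j\<close> with a letter to its right has the covariance \<open>\<alpha>\<^sub>k\<^sub>j\<close>, and \<open>\<alpha>\<^sub>j\<^sub>k\<close> with one
  to its left.\<close>

definition sd_defect :: "'n \<Rightarrow> 'n list \<Rightarrow> 'n list \<Rightarrow> 'r" where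
  "sd_defect j P Q = \<phi> (P @ j # Q) + t * (\<Sum>u\<in>words_below N. d j u * \<phi> (P @ u @ Q))
     - ssum Q (\<lambda>a k b. al k j * \<phi> a * \<phi> (P @ b))
     - ssum P (\<lambda>a k b. al j k * \<phi> b * \<phi> (a @ Q))"

text \<open>The failure of the KMS condition, which moves a block \<open>c\<close> from the end of a word to its front.\<close>

definition kms_defect :: "'n list \<Rightarrow> 'n list \<Rightarrow> 'r" where
  "kms_defect P c = \<phi> (P @ c) - (\<Sum>b\<in>words (length c). tw A c b * \<phi> (b @ P))"

lemma sd_defect_Nil: "sd_defect j [] Q = 0"
  by (simp add: sd_defect_def phi_Cons)

lemma kms_defect_Nil [simp]: "kms_defect P [] = 0"
  by (simp add: kms_defect_def)

lemma kms_defect_snoc: "kms_defect P (c @ [j]) = kms_defect (P @ c) [j] + (\<Sum>m\<in>UNIV. A m j * kms_defect (m # P) c)"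
proof -
  have "(\<Sum>b\<in>words (length (c @ [j])). tw A (c @ [j]) b * \<phi> (b @ P))
      = (\<Sum>b\<in>words (length c). \<Sum>m\<in>UNIV. A m j * tw A c b * \<phi> (b @ m # P))"
    by (simp add: sum_words_Suc') (intro sum.cong refl, simp add: words_def tw_snoc)
  then show ?thesis
    by (simp add: kms_defect_def sum_words_Suc sum_subtractf right_diff_distrib sum_distrib_left mult_ac
          sum.swap[of _ "words _"])
qed

text \<open>Expand both terms of the defect at the letter \<open>j\<close>: it is the last one of \<open>P j\<close> and, after the
  twist by \<open>A\<close>, the first one of \<open>m P\<close>. The contractions with the letters of \<open>P\<close> match by
  \<open>al_flip\<close> and the drifts match by \<open>cov\<close>, up to a KMS defect with a factor \<open>t\<close>.\<close>

lemma kms_defect_single: "kms_defect P [j] = sd_defect j P [] - t * (\<Sum>u\<in>words_below N. d j u * kms_defect P u)"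
proof -
  let ?D = "\<lambda>m. \<Sum>u\<in>words_below N. d m u * \<phi> (u @ P)"
  let ?S = "\<lambda>m. ssum P (\<lambda>a k b. al k m * \<phi> a * \<phi> b)"
  have 1: "(\<Sum>m\<in>UNIV. A m j * ?S m) = ssum P (\<lambda>a k b. al j k * \<phi> b * \<phi> a)"
    by (simp add: al_flip[of j] ssum_mult_left[symmetric] ssum_sum[symmetric] sum_distrib_left
        sum_distrib_right mult_ac)
  have "(\<Sum>m\<in>UNIV. A m j * ?D m) = (\<Sum>u\<in>words_below N. (\<Sum>m\<in>UNIV. A m j * d m u) * \<phi> (u @ P))"
    by (simp add: sum_distrib_left sum_distrib_right mult_ac sum.swap[of _ "words_below N"])
  also have "\<dots> = (\<Sum>u\<in>words_below N. \<Sum>v\<in>words (length u). d j v * tw A v u * \<phi> (u @ P))"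
    by (simp add: cov sum_distrib_right)
  also have "\<dots> = (\<Sum>v\<in>words_below N. d j v * (\<Sum>u\<in>words (length v). tw A v u * \<phi> (u @ P)))"
    by (subst sum_words_below_swap) (simp add: sum_distrib_left mult_ac)
  finally have 2: "(\<Sum>m\<in>UNIV. A m j * ?D m) = \<dots>" .
  have "(\<Sum>b\<in>words (length [j]). tw A [j] b * \<phi> (b @ P)) = (\<Sum>m\<in>UNIV. A m j * \<phi> (m # P))"
    by (simp add: sum_words_Suc)
  also have "\<dots> = (\<Sum>m\<in>UNIV. A m j * ?S m) - t * (\<Sum>m\<in>UNIV. A m j * ?D m)"
    unfolding phi_Cons by (simp add: right_diff_distrib sum_subtractf sum_distrib_left mult_ac)
  finally show ?thesis
    by (simp add: kms_defect_def sd_defect_def 1 2 right_diff_distrib sum_subtractf)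
qed

text \<open>Cutting \<open>u = a k b\<close> in \<open>d\<^sub>i\<close> and cutting \<open>u = c k a\<close> in \<open>d\<^sub>j\<close> are related by \<open>hess\<close>: the block
  \<open>b\<close> behind the removed letter becomes a twisted block \<open>c\<close> in front of it.\<close>

lemma hess_sum:
  "(\<Sum>u\<in>words_below N. d i u * ssum u (\<lambda>a k b. al j k * G a b))
     = (\<Sum>u\<in>words_below N. d j u * ssum u (\<lambda>c k a. al k i * (\<Sum>b\<in>words (length c). tw A c b * G a b)))"
proof -
  have "(\<Sum>u\<in>words_below N. d i u * ssum u (\<lambda>a k b. al j k * G a b))
      = (\<Sum>u\<in>words_below N. ssum u (\<lambda>a k b. al j k * d i (a @ k # b) * G a b))"
    by (intro sum.cong refl, subst ssum_mult_left[symmetric], rule ssum_cong) (auto simp: mult_ac)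
  also have "\<dots> = (\<Sum>(p, q) | p + q + 1 < N. \<Sum>a\<in>words p. \<Sum>b\<in>words q.
                    (\<Sum>k\<in>UNIV. al j k * d i (a @ k # b)) * G a b)"
    by (simp add: sum_ssum_words_below sum_distrib_right)
  also have "\<dots> = (\<Sum>(p, q) | p + q + 1 < N. \<Sum>a\<in>words p. \<Sum>b\<in>words q.
                    \<Sum>c\<in>words q. \<Sum>k\<in>UNIV. al k i * d j (c @ k # a) * (tw A c b * G a b))"
    unfolding hess
    by (intro sum.cong refl) (auto simp: sum_distrib_right sum_distrib_left words_def mult_ac intro!: sum.cong)
  also have "\<dots> = (\<Sum>(p, q) | p + q + 1 < N. \<Sum>c\<in>words q. \<Sum>a\<in>words p. \<Sum>k\<in>UNIV.
                    al k i * d j (c @ k # a) * (\<Sum>b\<in>words (length c). tw A c b * G a b))"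
  proof (intro sum.cong refl, clarify)
    fix p q
    have "(\<Sum>a\<in>words p. \<Sum>b\<in>words q. \<Sum>c\<in>words q. \<Sum>k\<in>UNIV. al k i * d j (c @ k # a) * (tw A c b * G a b))
        = (\<Sum>c\<in>words q. \<Sum>a\<in>words p. \<Sum>k\<in>UNIV. \<Sum>b\<in>words q. al k i * d j (c @ k # a) * (tw A c b * G a b))"
      by (subst (2) sum.swap, subst sum.swap, intro sum.cong refl, rule sum.swap)
    then show "(\<Sum>a\<in>words p. \<Sum>b\<in>words q. \<Sum>c\<in>words q. \<Sum>k\<in>UNIV. al k i * d j (c @ k # a) * (tw A c b * G a b))
        = (\<Sum>c\<in>words q. \<Sum>a\<in>words p. \<Sum>k\<in>UNIV. al k i * d j (c @ k # a) * (\<Sum>b\<in>words (length c). tw A c b * G a b))"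
      by (auto simp: sum_distrib_left words_def intro!: sum.cong)
  qed
  also have "\<dots> = (\<Sum>(p, q) | p + q + 1 < N. \<Sum>c\<in>words p. \<Sum>a\<in>words q. \<Sum>k\<in>UNIV.
                    al k i * d j (c @ k # a) * (\<Sum>b\<in>words (length c). tw A c b * G a b))"
    by (rule sum.reindex_bij_witness[of _ "\<lambda>(p, q). (q, p)" "\<lambda>(p, q). (q, p)"]) auto
  also have "\<dots> = (\<Sum>u\<in>words_below N. ssum u (\<lambda>c k a. al k i * d j (c @ k # a) * (\<Sum>b\<in>words (length c). tw A c b * G a b)))"
    by (simp add: sum_ssum_words_below)
  also have "\<dots> = (\<Sum>u\<in>words_below N. d j u * ssum u (\<lambda>c k a. al k i * (\<Sum>b\<in>words (length c). tw A c b * G a b)))"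
    by (intro sum.cong refl, subst ssum_mult_left[symmetric], rule ssum_cong) (auto simp: mult_ac)
  finally show ?thesis .
qed

lemma phi_Cons_append:
  "\<phi> (i # u @ v) = ssum u (\<lambda>a k b. al k i * \<phi> a * \<phi> (b @ v)) + ssum v (\<lambda>a k b. al k i * \<phi> (u @ a) * \<phi> b)
     - t * (\<Sum>x\<in>words_below N. d i x * \<phi> (x @ u @ v))"
  unfolding phi_Cons by (simp add: ssum_append)

text \<open>The key recursion. Expand every occurrence of \<open>\<phi>(i ...)\<close> in the defect at its first letter \<open>i\<close>.
  Terms in which \<open>i\<close> is contracted with a letter of \<open>P\<close> or \<open>Q\<close> assemble to defects of shorter
  words; the drift of \<open>i\<close> gives \<open>t\<close> times defects. What remains are the contractions between \<open>i\<close>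
  and a letter of the drift of \<open>j\<close> and those between \<open>j\<close> and a letter of the drift of \<open>i\<close>. By
  the symmetry of second derivatives they cancel, except that one of them has a block on the
  wrong side of \<open>P\<close>: this is a KMS defect.\<close>

lemma sd_defect_Cons:
  "sd_defect j (i # P) Q = ssum P (\<lambda>a k b. al k i * \<phi> a * sd_defect j b Q) + ssum Q (\<lambda>a k b. al k i * sd_defect j P a * \<phi> b)
     - t * (\<Sum>u\<in>words_below N. d i u * sd_defect j (u @ P) Q)
     + t * (\<Sum>u\<in>words_below N. d j u * ssum u (\<lambda>c k e. al k i * \<phi> (e @ Q) * kms_defect P c))"
proof -
  define U where "U = (words_below N :: 'n list set)"
  note [simp] = U_def[symmetric]
  define a1 where "a1 = ssum P (\<lambda>a k b. al k i * \<phi> a * \<phi> (b @ j # Q))"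
  define a2 where "a2 = al j i * \<phi> P * \<phi> Q"
  define a3 where "a3 = ssum Q (\<lambda>a k b. al k i * \<phi> (P @ j # a) * \<phi> b)"
  define a4 where "a4 = (\<Sum>u\<in>U. d i u * \<phi> (u @ P @ j # Q))"
  \<comment> \<open>In \<open>L1\<close> to \<open>L4\<close> the letter \<open>i\<close> is removed from the four terms of the defect; \<open>a2\<close>, the
    contraction of \<open>i\<close> with \<open>j\<close>, occurs in \<open>L1\<close> and in \<open>L4\<close> and cancels.\<close>
  have L1: "\<phi> (i # P @ j # Q) = a1 + a2 + a3 - t * a4"
    unfolding a1_def a2_def a3_def a4_def by (simp add: phi_Cons_append[of i P "j # Q"] add.assoc)
  define b1 where "b1 = (\<Sum>u\<in>U. d j u * ssum P (\<lambda>a k b. al k i * \<phi> a * \<phi> (b @ u @ Q)))"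
  define b2 where "b2 = (\<Sum>u\<in>U. d j u * ssum u (\<lambda>c k e. al k i * \<phi> (P @ c) * \<phi> (e @ Q)))"
  define b3 where "b3 = (\<Sum>u\<in>U. d j u * ssum Q (\<lambda>a k b. al k i * \<phi> (P @ u @ a) * \<phi> b))"
  define b4 where "b4 = (\<Sum>u\<in>U. d j u * (\<Sum>v\<in>U. d i v * \<phi> (v @ P @ u @ Q)))"
  have L2: "(\<Sum>u\<in>U. d j u * \<phi> (i # P @ u @ Q)) = b1 + b2 + b3 - t * b4"
    unfolding b1_def b2_def b3_def b4_def sum_distrib_left sum.distrib[symmetric] sum_subtractf[symmetric]
    by (intro sum.cong refl)
       (simp add: phi_Cons_append[of i P "_ @ Q"] ssum_append algebra_simps sum_distrib_left)
  define c1 where "c1 = ssum Q (\<lambda>a k b. al k j * \<phi> a * ssum P (\<lambda>a' k' b'. al k' i * \<phi> a' * \<phi> (b' @ b)))"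
  define c2 where "c2 = ssum Q (\<lambda>a k b. al k j * \<phi> a * ssum b (\<lambda>a' k' b'. al k' i * \<phi> (P @ a') * \<phi> b'))"
  define c3 where "c3 = ssum Q (\<lambda>a k b. al k j * \<phi> a * (\<Sum>v\<in>U. d i v * \<phi> (v @ P @ b)))"
  have L3: "ssum Q (\<lambda>a k b. al k j * \<phi> a * \<phi> (i # P @ b)) = c1 + c2 - t * c3"
    unfolding c1_def c2_def c3_def phi_Cons_append
    by (simp add: right_diff_distrib distrib_left ssum_add ssum_diff ssum_mult_left[symmetric] mult_ac)
  define e1 where "e1 = ssum P (\<lambda>a k b. al j k * \<phi> b * ssum a (\<lambda>a' k' b'. al k' i * \<phi> a' * \<phi> (b' @ Q)))"
  define e2 where "e2 = ssum P (\<lambda>a k b. al j k * \<phi> b * ssum Q (\<lambda>a' k' b'. al k' i * \<phi> (a @ a') * \<phi> b'))"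
  define e3 where "e3 = ssum P (\<lambda>a k b. al j k * \<phi> b * (\<Sum>v\<in>U. d i v * \<phi> (v @ a @ Q)))"
  have L4: "ssum (i # P) (\<lambda>a k b. al j k * \<phi> b * \<phi> (a @ Q)) = a2 + (e1 + e2 - t * e3)"
    unfolding a2_def e1_def e2_def e3_def
    by (simp add: phi_Cons_append right_diff_distrib distrib_left ssum_add ssum_diff ssum_mult_left[symmetric] mult_ac)
  have L: "sd_defect j (i # P) Q = (a1 + a2 + a3 - t * a4) + t * (b1 + b2 + b3 - t * b4) - (c1 + c2 - t * c3)
      - (a2 + (e1 + e2 - t * e3))"
    using L1 L2 L3 L4 by (simp add: sd_defect_def)
  \<comment> \<open>\<open>R1\<close> to \<open>R4\<close> collect these pieces into the four terms of the claim. The term \<open>f1\<close> is the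
    contraction of \<open>j\<close> with a letter of the drift of \<open>i\<close>; it enters through \<open>R3\<close> and \<open>R4\<close> and
    drops out of the sum.\<close>
  have R1: "ssum P (\<lambda>a k b. al k i * \<phi> a * sd_defect j b Q) = a1 + t * b1 - c1 - e1"
  proof -
    have "b1 = ssum P (\<lambda>a k b. al k i * \<phi> a * (\<Sum>u\<in>U. d j u * \<phi> (b @ u @ Q)))"
      unfolding b1_def by (simp add: ssum_mult_left[symmetric] ssum_sum[symmetric] sum_distrib_left mult_ac)
    moreover have "c1 = ssum P (\<lambda>a k b. al k i * \<phi> a * ssum Q (\<lambda>a' k' b'. al k' j * \<phi> a' * \<phi> (b @ b')))"
      unfolding c1_def ssum_mult_left[symmetric] by (subst ssum_commute) (simp add: mult_ac)
    moreover have "e1 = ssum P (\<lambda>a k b. al k i * \<phi> a * ssum b (\<lambda>a' k' b'. al j k' * \<phi> b' * \<phi> (a' @ Q)))"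
      unfolding e1_def ssum_mult_left[symmetric] by (subst ssum_assoc) (simp add: mult_ac)
    ultimately show ?thesis unfolding a1_def sd_defect_def
      by (simp add: right_diff_distrib distrib_left ssum_add ssum_diff ssum_mult_left[symmetric] mult_ac)
  qed
  have R2: "ssum Q (\<lambda>a k b. al k i * sd_defect j P a * \<phi> b) = a3 + t * b3 - c2 - e2"
  proof -
    have "b3 = ssum Q (\<lambda>a k b. al k i * (\<Sum>u\<in>U. d j u * \<phi> (P @ u @ a)) * \<phi> b)"
      unfolding b3_def by (simp add: ssum_mult_left[symmetric] ssum_sum[symmetric] sum_distrib_left sum_distrib_right mult_ac)
    moreover have "c2 = ssum Q (\<lambda>a k b. al k i * ssum a (\<lambda>a' k' b'. al k' j * \<phi> a' * \<phi> (P @ b')) * \<phi> b)"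
      unfolding c2_def ssum_mult_left[symmetric] ssum_mult_right[symmetric] ssum_assoc by (simp add: mult_ac)
    moreover have "e2 = ssum Q (\<lambda>a k b. al k i * ssum P (\<lambda>a' k' b'. al j k' * \<phi> b' * \<phi> (a' @ a)) * \<phi> b)"
      unfolding e2_def ssum_mult_left[symmetric] ssum_mult_right[symmetric] by (subst ssum_commute) (simp add: mult_ac)
    ultimately show ?thesis unfolding a3_def sd_defect_def
      by (simp add: right_diff_distrib left_diff_distrib distrib_left distrib_right ssum_add ssum_diff
           ssum_mult_left[symmetric] mult_ac)
  qed
  define f1 where "f1 = (\<Sum>u\<in>U. d i u * ssum u (\<lambda>a k b. al j k * (\<phi> (a @ Q) * \<phi> (b @ P))))"
  have R3: "(\<Sum>u\<in>U. d i u * sd_defect j (u @ P) Q) = a4 + t * b4 - c3 - f1 - e3"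
  proof -
    have "b4 = (\<Sum>u\<in>U. d i u * (\<Sum>v\<in>U. d j v * \<phi> (u @ P @ v @ Q)))"
      unfolding b4_def sum_distrib_left by (subst sum.swap) (simp add: mult_ac)
    moreover have "c3 = (\<Sum>u\<in>U. d i u * ssum Q (\<lambda>a k b. al k j * \<phi> a * \<phi> (u @ P @ b)))"
      unfolding c3_def by (simp add: ssum_mult_left[symmetric] ssum_sum[symmetric] sum_distrib_left mult_ac)
    moreover have "e3 = (\<Sum>u\<in>U. d i u * ssum P (\<lambda>a k b. al j k * \<phi> b * \<phi> (u @ a @ Q)))"
      unfolding e3_def by (simp add: ssum_mult_left[symmetric] ssum_sum[symmetric] sum_distrib_left mult_ac)
    ultimately show ?thesis unfolding a4_def f1_def sd_defect_def
      by (simp add: ssum_append right_diff_distrib distrib_left sum.distrib sum_subtractf sum_distrib_left mult_ac)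
  qed
  have R4: "(\<Sum>u\<in>U. d j u * ssum u (\<lambda>c k e. al k i * \<phi> (e @ Q) * kms_defect P c)) = b2 - f1"
  proof -
    have "f1 = (\<Sum>u\<in>U. d j u * ssum u (\<lambda>c k e. al k i * (\<Sum>b\<in>words (length c). tw A c b * (\<phi> (e @ Q) * \<phi> (b @ P)))))"
      unfolding f1_def using hess_sum[of i j "\<lambda>a b. \<phi> (a @ Q) * \<phi> (b @ P)"] by simp
    then show ?thesis unfolding b2_def kms_defect_def
      by (simp add: right_diff_distrib ssum_diff sum_subtractf sum_distrib_left mult_ac)
  qed
  show ?thesis unfolding U_def[symmetric] L R1 R2 R3 R4 by (simp add: algebra_simps)
qed

lemma ssum_dvd: "(\<And>a k b. w = a @ k # b \<Longrightarrow> x dvd F a k b) \<Longrightarrow> x dvd ssum w (F :: _ \<Rightarrow> _ \<Rightarrow> _ \<Rightarrow> 'r)"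
  unfolding ssum_conv_sum by (intro dvd_sum) (simp add: id_take_nth_drop)

text \<open>Induction on \<open>n\<close>: in the recursions for both defects every term is a defect with a factor \<open>t\<close>,
  an \<open>sd_defect\<close> with a shorter first word, or, for \<open>kms_defect\<close>, reduces to single letters and
  then to \<open>sd_defect\<close>. So an inner induction on the first word raises the power of \<open>t\<close> by one.\<close>

lemma defects_divisible: "t ^ n dvd sd_defect j P Q \<and> t ^ n dvd kms_defect P c"
proof (induction n arbitrary: j P Q c)
  case (Suc n)
  have m: "t ^ Suc n dvd t * (\<Sum>u\<in>V. x u * y u)" if "\<And>u. t ^ n dvd y u" for V :: "'n list set" and x y
    using that by (auto intro!: mult_dvd_mono dvd_sum)
  have sd_defect: "t ^ Suc n dvd sd_defect j P Q" for j P Q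
  proof (induction P arbitrary: Q rule: length_induct)
    case (1 P)
    show ?case
    proof (cases P)
      case (Cons i P')
      have "t ^ Suc n dvd ssum P' (\<lambda>a k b. al k i * \<phi> a * sd_defect j b Q)"
      proof (intro ssum_dvd dvd_mult)
        fix a k b assume "P' = a @ k # b"
        then have "length b < length P" using Cons by simp
        then show "t ^ Suc n dvd sd_defect j b Q" using 1 by blast
      qed
      moreover have "t ^ Suc n dvd ssum Q (\<lambda>a k b. al k i * sd_defect j P' a * \<phi> b)"
        using 1 Cons by (intro ssum_dvd dvd_mult2 dvd_mult) simp
      moreover have "t ^ Suc n dvd t * (\<Sum>u\<in>words_below N. d i u * sd_defect j (u @ P') Q)"
        by (intro m) (use Suc.IH in auto)
      moreover have "t ^ Suc n dvd t * (\<Sum>u\<in>words_below N. d j u *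
          ssum u (\<lambda>c k e. al k i * \<phi> (e @ Q) * kms_defect P' c))"
        by (intro m ssum_dvd dvd_mult) (use Suc.IH in auto)
      ultimately show ?thesis unfolding Cons sd_defect_Cons by (intro dvd_add dvd_diff)
    qed (simp add: sd_defect_Nil)
  qed
  have T1: "t ^ Suc n dvd kms_defect P [j]" for P j
    unfolding kms_defect_single by (intro dvd_diff sd_defect m) (use Suc.IH in auto)
  have "t ^ Suc n dvd kms_defect P c" for P c
  proof (induction c arbitrary: P rule: rev_induct)
    case (snoc j c)
    then show ?case unfolding kms_defect_snoc by (intro dvd_add T1 dvd_sum dvd_mult) auto
  qed simp
  with sd_defect show ?case by blast
qed auto

end

section \<open>A majorant\<close>

text \<open>The factor \<open>1 / (n + 1)\<^sup>2\<close> makes the convolution square of the sequence comparable to the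
  sequence itself, while powers \<open>3\<^bsup>n\<^esup>\<close> alone would gain a factor \<open>n\<close>. The factor \<open>11/10\<close> is
  needed in low degree: a word of length 2 can have the value \<open>\<alpha>\<^sub>j\<^sub>j = 1\<close> already without any
  drift.\<close>

definition om :: "nat \<Rightarrow> real" where
  "om n = (if n = 0 then 1 else 11/10 * 3 ^ n / (real n + 1)\<^sup>2)"

lemma om_0 [simp]: "om 0 = 1" by (simp add: om_def)

lemma om_pos: "om n > 0" by (simp add: om_def)

lemma om_nonneg [simp]: "om n \<ge> 0" using om_pos[of n] by linarith

lemma om_Suc_le: "om (Suc n) \<le> 3 * om n"
proof (cases "n = 0")
  case False
  have "(3 * 3 ^ n) / (real n + 2)\<^sup>2 \<le> (3 * 3 ^ n) / (real n + 1)\<^sup>2"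
    by (intro divide_left_mono power_mono) auto
  then show ?thesis using False by (simp add: om_def add.commute)
qed (simp add: om_def power2_eq_square)

lemma om_add_le: "om (m + n) \<le> 3 ^ m * om n"
proof (induction m)
  case (Suc m)
  show ?case using om_Suc_le[of "m + n"] Suc by simp
qed simp

lemma om_le: "om n \<le> 3 ^ n"
  using om_add_le[of n 0] by simp

lemma sum_inverse_squares_le: "n \<ge> 2 \<Longrightarrow> (\<Sum>i<n. 1 / (real i + 1)\<^sup>2) \<le> 7/4 - 1 / real n"
proof (induction n rule: nat_induct_at_least)
  case base
  show ?case by (simp add: numeral_2_eq_2 power2_eq_square)
next
  case (Suc n)
  have "1 / (real n + 1)\<^sup>2 \<le> 1 / real n - 1 / (real n + 1)"
  proof -
    have "1 / (real n + 1)\<^sup>2 \<le> 1 / (real n * (real n + 1))"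
      unfolding power2_eq_square by (intro divide_left_mono mult_right_mono) (use Suc.hyps in auto)
    also have "\<dots> = 1 / real n - 1 / (real n + 1)" using Suc.hyps by (simp add: field_simps)
    finally show ?thesis .
  qed
  then show ?case using Suc.IH by (simp add: add.commute)
qed

lemma sum_inverse_le: "n \<ge> 1 \<Longrightarrow> (\<Sum>i<n. 1 / (real i + 1)) \<le> (real n + 1) / 2"
proof (induction n rule: nat_induct_at_least)
  case (Suc n)
  have "1 / (real n + 1) \<le> 1/2" using Suc.hyps by (simp add: field_simps)
  moreover have "(real (Suc n) + 1) / 2 = (real n + 1) / 2 + 1/2" by (simp add: field_simps)
  moreover have "(\<Sum>i<Suc n. 1 / (real i + 1)) = (\<Sum>i<n. 1 / (real i + 1)) + 1 / (real n + 1)" by simp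
  ultimately show ?case using Suc.IH by linarith
qed simp

text \<open>A sequence that grows by splitting at a letter and by a drift of size \<open>1/20\<close> stays below \<open>om\<close>.
  For \<open>n \<ge> 4\<close> write \<open>s = n + 1 = a + b\<close> and use
  \<open>1 / (a b)\<^sup>2 = (1/a\<^sup>2 + 1/b\<^sup>2 + (2/s) (1/a + 1/b)) / s\<^sup>2\<close>, so that the convolution is at most
  \<open>121/100 * 3\<^bsup>n - 1\<^esup> (7/2 + 2) / s\<^sup>2\<close>. The first values of \<open>n\<close> are computed.\<close>

lemma om_convolution: "(\<Sum>i<n. om i * om (n - 1 - i)) + om n / 20 \<le> om (Suc n)"
proof -
  consider "n = 0" | "n = 1" | "n = 2" | "n = 3" | "n \<ge> 4" by linarith
  then show ?thesis
  proof cases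
    case 5
    define s where "s = real n + 1"
    have s: "s \<ge> 5" using 5 by (simp add: s_def)
    define S1 where "S1 = (\<Sum>i<n. 1 / (real i + 1)\<^sup>2)"
    define S2 where "S2 = (\<Sum>i<n. 1 / (real i + 1))"
    have S1: "S1 \<le> 7/4"
      using order.trans[OF sum_inverse_squares_le[of n], of "7/4"] 5 unfolding S1_def by simp
    have S2: "S2 \<le> s / 2"
      using sum_inverse_le[of n] 5 unfolding S2_def s_def by simp
    have om': "om i \<le> 11/10 * 3 ^ i / (real i + 1)\<^sup>2" for i by (simp add: om_def)
    have "(\<Sum>i<n. om i * om (n - 1 - i))
        \<le> (\<Sum>i<n. (11/10 * 3 ^ i / (real i + 1)\<^sup>2) * (11/10 * 3 ^ (n - 1 - i) / (real (n - 1 - i) + 1)\<^sup>2))"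
      by (intro sum_mono mult_mono om') auto
    also have "\<dots> = (\<Sum>i<n. (121/100 * 3 ^ (n - 1) / s\<^sup>2) *
        (1 / (real i + 1)\<^sup>2 + 1 / (real (n - Suc i) + 1)\<^sup>2
          + 2 / s * (1 / (real i + 1) + 1 / (real (n - Suc i) + 1))))"
    proof (intro sum.cong refl)
      fix i assume "i \<in> {..<n}"
      then have i: "i < n" by simp
      define a b where "a = real i + 1" and "b = real (n - Suc i) + 1"
      have ab: "a > 0" "b > 0" "s = a + b" using i by (auto simp: a_def b_def s_def of_nat_diff)
      have p: "(3::real) ^ i * 3 ^ (n - 1 - i) = 3 ^ (n - 1)"
        using i by (simp flip: power_add)
      have "1 / (a\<^sup>2 * b\<^sup>2) = (1 / s\<^sup>2) * (1 / a\<^sup>2 + 1 / b\<^sup>2 + 2 / s * (1 / a + 1 / b))"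
      proof -
        have 1: "2 / s * (1 / a + 1 / b) = 2 / (a * b)"
          using ab by (simp add: divide_simps)
        have 2: "1 / a\<^sup>2 + 1 / b\<^sup>2 + 2 / (a * b) = s\<^sup>2 / (a\<^sup>2 * b\<^sup>2)"
          using ab by (simp add: divide_simps) (simp add: algebra_simps power2_eq_square)
        show ?thesis unfolding 1 2 using ab by simp
      qed
      then have "121/100 * 3 ^ (n - 1) * (1 / (a\<^sup>2 * b\<^sup>2))
          = 121/100 * 3 ^ (n - 1) * ((1 / s\<^sup>2) * (1 / a\<^sup>2 + 1 / b\<^sup>2 + 2 / s * (1 / a + 1 / b)))"
        by simp
      then show "(11/10 * 3 ^ i / (real i + 1)\<^sup>2) * (11/10 * 3 ^ (n - 1 - i) / (real (n - 1 - i) + 1)\<^sup>2)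
          = (121/100 * 3 ^ (n - 1) / s\<^sup>2) *
        (1 / (real i + 1)\<^sup>2 + 1 / (real (n - Suc i) + 1)\<^sup>2
          + 2 / s * (1 / (real i + 1) + 1 / (real (n - Suc i) + 1)))"
        unfolding p[symmetric] a_def[symmetric] b_def[symmetric] by (simp add: a_def[symmetric] b_def[symmetric] mult_ac)
    qed
    also have "\<dots> = (121/100 * 3 ^ (n - 1) / s\<^sup>2) * (S1 + S1 + 2 / s * (S2 + S2))"
      unfolding sum_distrib_left[symmetric] sum.distrib S1_def S2_def
        sum.nat_diff_reindex[of "\<lambda>i. 1 / (real i + 1)\<^sup>2" n] sum.nat_diff_reindex[of "\<lambda>i. 1 / (real i + 1)" n] ..
    also have "\<dots> \<le> (121/100 * 3 ^ (n - 1) / s\<^sup>2) * (7/4 + 7/4 + 2 / s * (s / 2 + s / 2))"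
      by (intro mult_left_mono add_mono S1 S2) (use s in auto)
    also have "\<dots> = 3 ^ (n - 1) * ((6655/1000) / s\<^sup>2)" using s by simp
    finally have 1: "(\<Sum>i<n. om i * om (n - 1 - i)) \<le> 3 ^ (n - 1) * ((6655/1000) / s\<^sup>2)" .
    have p: "(3::real) ^ n = 3 * 3 ^ (n - 1)" using 5 by (cases n) auto
    have 2: "om n / 20 = 3 ^ (n - 1) * ((165/1000) / s\<^sup>2)"
      using 5 by (simp add: om_def p s_def)
    have 3: "om (Suc n) = 3 ^ (n - 1) * ((99/10) / (s + 1)\<^sup>2)"
      using 5 by (simp add: om_def p s_def add.commute)
    have "(s + 1)\<^sup>2 \<le> (6/5 * s)\<^sup>2" by (intro power_mono) (use s in auto)
    then have "(s + 1)\<^sup>2 \<le> 36/25 * s\<^sup>2"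
      unfolding power_mult_distrib by (simp add: power2_eq_square)
    then have "682/100 * (s + 1)\<^sup>2 \<le> 99/10 * s\<^sup>2"
      using zero_le_power2[of s] by linarith
    then have "(682/100) / s\<^sup>2 \<le> (99/10) / (s + 1)\<^sup>2"
      using s by (simp add: divide_simps)
    then have "3 ^ (n - 1) * ((6655/1000) / s\<^sup>2) + 3 ^ (n - 1) * ((165/1000) / s\<^sup>2)
        \<le> 3 ^ (n - 1) * ((99/10) / (s + 1)\<^sup>2)"
      unfolding distrib_left[symmetric] add_divide_distrib[symmetric] by (intro mult_left_mono) auto
    with 1 2 3 show ?thesis by linarith
  qed (simp_all add: om_def numeral_2_eq_2 numeral_3_eq_3 power2_eq_square)
qed

section \<open>The solution for a drift of finite support\<close>

text \<open>The coefficient of \<open>t\<^bsup>m\<^esup>\<close> in the solution of the recursion with drift \<open>t d\<close>. The drift may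
  lengthen words but lowers \<open>m\<close>, which makes the recursion well-founded.\<close>

function sd_coeff :: "('n \<Rightarrow> 'n \<Rightarrow> complex) \<Rightarrow> ('n::finite \<Rightarrow> 'n ncps) \<Rightarrow> nat \<Rightarrow> nat \<Rightarrow> 'n list \<Rightarrow> complex" where
  "sd_coeff al d N m [] = (if m = 0 then 1 else 0)"
| "sd_coeff al d N m (j # w) = ssum w (\<lambda>a k b. al k j * (\<Sum>i\<in>{0..m}. sd_coeff al d N i a * sd_coeff al d N (m - i) b))
     - (if m = 0 then 0 else \<Sum>u\<in>words_below N. d j u * sd_coeff al d N (m - 1) (u @ w))"
  by pat_completeness auto
termination
  by (relation "measures [\<lambda>(al, d, N, m, w). m, \<lambda>(al, d, N, m, w). length w]") auto

definition sd_series :: "('n \<Rightarrow> 'n \<Rightarrow> complex) \<Rightarrow> ('n::finite \<Rightarrow> 'n ncps) \<Rightarrow> nat \<Rightarrow> 'n list \<Rightarrow> complex fps" where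
  "sd_series al d N w = Abs_fps (\<lambda>m. sd_coeff al d N m w)"

lemma fps_nth_ssum: "fps_nth (ssum w F) m = ssum w (\<lambda>a k b. fps_nth (F a k b) m)"
  by (simp add: ssum_conv_sum fps_sum_nth)

lemma fps_const_sum: "fps_const (sum f S) = (\<Sum>x\<in>S. fps_const (f x :: 'a::comm_monoid_add))"
  by (intro fps_ext) (auto simp: fps_sum_nth)

lemma sd_series_Cons:
  "sd_series al d N (j # w) = ssum w (\<lambda>a k b. fps_const (al k j) * sd_series al d N a * sd_series al d N b)
     - fps_X * (\<Sum>u\<in>words_below N. fps_const (d j u) * sd_series al d N (u @ w))"
proof (rule fps_ext)
  fix m
  have "fps_nth (sd_series al d N a * sd_series al d N b) m = (\<Sum>i\<in>{0..m}. sd_coeff al d N i a * sd_coeff al d N (m - i) b)" for a b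
    by (simp add: sd_series_def fps_mult_nth)
  then show "fps_nth (sd_series al d N (j # w)) m = fps_nth (ssum w (\<lambda>a k b. fps_const (al k j) * sd_series al d N a * sd_series al d N b)
     - fps_X * (\<Sum>u\<in>words_below N. fps_const (d j u) * sd_series al d N (u @ w))) m"
    by (simp add: mult.assoc fps_nth_ssum fps_sum_nth) (simp add: sd_series_def)
qed

lemma tw_fps_const: "tw (\<lambda>i j. fps_const (A i j)) c b = fps_const (tw A c b)"
  by (induction c b rule: list_induct2') (auto simp: tw_def)

lemma fps_eq_0_if_X_powers_dvd:
  assumes "\<And>n. fps_X ^ n dvd f"
  shows "f = (0 :: 'a::comm_ring_1 fps)"
proof (rule fps_ext)
  fix m
  obtain g where "f = fps_X ^ Suc m * g" using assms[of "Suc m"] by (auto elim: dvdE)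
  then show "fps_nth f m = fps_nth 0 m" by (simp add: fps_X_power_mult_nth del: power_Suc)
qed

text \<open>Evaluation at \<open>t = 1\<close> is a ring homomorphism on the power series that converge absolutely there,
  so identities between formal power series carry over to their values.\<close>

definition fps_abs_summable :: "complex fps \<Rightarrow> bool" where "fps_abs_summable f \<longleftrightarrow> summable (\<lambda>k. cmod (fps_nth f k))"
definition fps_at_1 :: "complex fps \<Rightarrow> complex" where "fps_at_1 f = suminf (fps_nth f)"

lemma fps_abs_summable_summable: "fps_abs_summable f \<Longrightarrow> summable (fps_nth f)"
  unfolding fps_abs_summable_def by (rule summable_norm_cancel)

lemma fps_abs_summable_mult: "fps_abs_summable f \<Longrightarrow> fps_abs_summable g \<Longrightarrow> fps_abs_summable (f * g)"
  unfolding fps_abs_summable_def fps_mult_nth atLeast0AtMost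
proof -
  assume a: "summable (\<lambda>k. cmod (fps_nth f k))" "summable (\<lambda>k. cmod (fps_nth g k))"
  have "summable (\<lambda>k. \<Sum>i\<le>k. cmod (fps_nth f i) * cmod (fps_nth g (k - i)))"
    using a by (intro summable_Cauchy_product) auto
  then show "summable (\<lambda>k. cmod (\<Sum>i\<le>k. fps_nth f i * fps_nth g (k - i)))"
    by (rule summable_comparison_test'[where N = 0])
       (auto intro!: order.trans[OF norm_sum] simp: norm_mult)
qed

lemma fps_at_1_mult: "fps_abs_summable f \<Longrightarrow> fps_abs_summable g \<Longrightarrow> fps_at_1 (f * g) = fps_at_1 f * fps_at_1 g"
  unfolding fps_abs_summable_def fps_at_1_def fps_mult_nth atLeast0AtMost by (rule Cauchy_product[symmetric])

lemma fps_abs_summable_add: "fps_abs_summable f \<Longrightarrow> fps_abs_summable g \<Longrightarrow> fps_abs_summable (f + g)"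
proof -
  assume "fps_abs_summable f" "fps_abs_summable g"
  then have "summable (\<lambda>k. cmod (fps_nth f k) + cmod (fps_nth g k))"
    unfolding fps_abs_summable_def by (rule summable_add)
  then show "fps_abs_summable (f + g)" unfolding fps_abs_summable_def
    by (rule summable_comparison_test'[where N = 0]) (auto intro: norm_triangle_ineq)
qed

lemma fps_at_1_add: "fps_abs_summable f \<Longrightarrow> fps_abs_summable g \<Longrightarrow> fps_at_1 (f + g) = fps_at_1 f + fps_at_1 g"
  using suminf_add[OF fps_abs_summable_summable fps_abs_summable_summable] unfolding fps_at_1_def by (simp add: fps_add_nth[abs_def])

lemma fps_abs_summable_0 [simp]: "fps_abs_summable 0" and fps_at_1_0 [simp]: "fps_at_1 0 = 0"
  using suminf_zero by (auto simp: fps_abs_summable_def fps_at_1_def fps_zero_nth[abs_def])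

lemma fps_abs_summable_const [simp]: "fps_abs_summable (fps_const c)" and fps_at_1_const [simp]: "fps_at_1 (fps_const c) = c"
proof -
  show "fps_abs_summable (fps_const c)" unfolding fps_abs_summable_def
    by (rule summable_finite[of "{0}"]) auto
  have "fps_at_1 (fps_const c) = (\<Sum>k\<in>{0}. fps_nth (fps_const c) k)"
    unfolding fps_at_1_def by (rule suminf_finite) auto
  then show "fps_at_1 (fps_const c) = c" by simp
qed

lemma fps_abs_summable_X [simp]: "fps_abs_summable fps_X" and fps_at_1_X [simp]: "fps_at_1 fps_X = 1"
proof -
  show "fps_abs_summable fps_X" unfolding fps_abs_summable_def
    by (rule summable_finite[of "{1}"]) (auto simp: fps_X_def)
  have "fps_at_1 fps_X = (\<Sum>k\<in>{1}. fps_nth fps_X k)"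
    unfolding fps_at_1_def by (rule suminf_finite) (auto simp: fps_X_def)
  then show "fps_at_1 fps_X = 1" by simp
qed

lemma fps_abs_summable_sum: "(\<And>x. x \<in> S \<Longrightarrow> fps_abs_summable (f x)) \<Longrightarrow> fps_abs_summable (sum f S)"
  by (induction S rule: infinite_finite_induct) (auto intro: fps_abs_summable_add)

lemma fps_at_1_sum: "(\<And>x. x \<in> S \<Longrightarrow> fps_abs_summable (f x)) \<Longrightarrow> fps_at_1 (sum f S) = (\<Sum>x\<in>S. fps_at_1 (f x))"
  by (induction S rule: infinite_finite_induct) (auto simp: fps_at_1_add fps_abs_summable_sum)

lemma fps_abs_summable_ssum: "(\<And>a k b. fps_abs_summable (F a k b)) \<Longrightarrow> fps_abs_summable (ssum w F)"
  unfolding ssum_conv_sum by (rule fps_abs_summable_sum)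

lemma fps_at_1_ssum: "(\<And>a k b. fps_abs_summable (F a k b)) \<Longrightarrow> fps_at_1 (ssum w F) = ssum w (\<lambda>a k b. fps_at_1 (F a k b))"
  unfolding ssum_conv_sum by (rule fps_at_1_sum)

lemma small_drift_finite:
  assumes "small_drift d" "0 \<le> r" "r \<le> 19/5" "finite U"
  shows "(\<Sum>u\<in>U. cmod (d j u) * r ^ length u) \<le> 1/20"
proof -
  have "(\<Sum>u\<in>U. cmod (d j u) * r ^ length u) \<le> (\<Sum>\<^sub>\<infinity>u. cmod (d j u) * r ^ length u)"
    by (rule finite_sum_le_infsum) (use small_drift_sum[OF assms(1-3)] assms in auto)
  with small_drift_sum(2)[OF assms(1-3), of j] show ?thesis by linarith
qed

lemma drift_sum_bound:
  assumes "small_drift d" "0 \<le> r" "r \<le> 19/5" "finite U" "C \<ge> 0"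
    and f: "\<And>u. u \<in> U \<Longrightarrow> cmod (f u) \<le> C * r ^ length u"
  shows "cmod (\<Sum>u\<in>U. d j u * f u) \<le> C / 20"
proof -
  have "cmod (\<Sum>u\<in>U. d j u * f u) \<le> (\<Sum>u\<in>U. cmod (d j u) * (C * r ^ length u))"
    by (intro order.trans[OF norm_sum] sum_mono) (auto simp: norm_mult intro!: mult_left_mono f)
  also have "\<dots> = C * (\<Sum>u\<in>U. cmod (d j u) * r ^ length u)" by (simp add: sum_distrib_left mult_ac)
  also have "\<dots> \<le> C * (1/20)" by (intro mult_left_mono small_drift_finite assms)
  finally show ?thesis by simp
qed

text \<open>The partial sums of the coefficients satisfy the recursion as an inequality, with a shift of \<open>n\<close>
  in the drift term. The outer induction is on \<open>n\<close>, the inner one on the length of the word.\<close>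

lemma sd_coeff_sums_le:
  assumes al: "\<And>j k. cmod (al j k) \<le> 1" and d: "small_drift d"
  shows "(\<Sum>m<n. cmod (sd_coeff al d N m w)) \<le> om (length w)"
proof (induction n arbitrary: w)
  case (Suc n)
  show ?case
  proof (induction w rule: length_induct)
    case (1 w)
    show ?case
    proof (cases w)
      case (Cons j v)
      let ?p = "sd_coeff al d N" and ?l = "length v"
      have A: "cmod (ssum v (\<lambda>a k b. al k j * (\<Sum>i\<in>{0..m}. ?p i a * ?p (m - i) b)))
            \<le> ssum v (\<lambda>a k b. \<Sum>i\<le>m. cmod (?p i a) * cmod (?p (m - i) b))" for m
      proof (intro order.trans[OF norm_ssum] ssum_mono)
        fix a k b
        have "cmod (al k j * (\<Sum>i\<in>{0..m}. ?p i a * ?p (m - i) b)) \<le> 1 * cmod (\<Sum>i\<in>{0..m}. ?p i a * ?p (m - i) b)"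
          unfolding norm_mult by (intro mult_right_mono al) auto
        also have "\<dots> \<le> (\<Sum>i\<le>m. cmod (?p i a) * cmod (?p (m - i) b))"
          by (auto intro!: order.trans[OF norm_sum] simp: norm_mult atLeast0AtMost)
        finally show "cmod (al k j * (\<Sum>i\<in>{0..m}. ?p i a * ?p (m - i) b)) \<le> (\<Sum>i\<le>m. cmod (?p i a) * cmod (?p (m - i) b))" .
      qed
      have "cmod (?p m (j # v)) \<le> ssum v (\<lambda>a k b. \<Sum>i\<le>m. cmod (?p i a) * cmod (?p (m - i) b))
           + (if m = 0 then 0 else \<Sum>u\<in>words_below N. cmod (d j u) * cmod (?p (m - 1) (u @ v)))" for m
      proof -
        have "cmod (if m = 0 then 0 else \<Sum>u\<in>words_below N. d j u * ?p (m - 1) (u @ v))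
           \<le> (if m = 0 then 0 else \<Sum>u\<in>words_below N. cmod (d j u) * cmod (?p (m - 1) (u @ v)))"
          by (auto intro!: order.trans[OF norm_sum] simp: norm_mult)
        from add_mono[OF A[of m] this] show ?thesis
          unfolding sd_coeff.simps(2) by (rule order.trans[OF norm_triangle_ineq4])
      qed
      then have "(\<Sum>m<Suc n. cmod (?p m w)) \<le> (\<Sum>m<Suc n. ssum v (\<lambda>a k b. \<Sum>i\<le>m. cmod (?p i a) * cmod (?p (m - i) b))
           + (if m = 0 then 0 else \<Sum>u\<in>words_below N. cmod (d j u) * cmod (?p (m - 1) (u @ v))))"
        unfolding Cons by (rule sum_mono)
      also have "\<dots> = ssum v (\<lambda>a k b. \<Sum>m<Suc n. \<Sum>i\<le>m. cmod (?p i a) * cmod (?p (m - i) b))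
           + (\<Sum>u\<in>words_below N. cmod (d j u) * (\<Sum>m<n. cmod (?p m (u @ v))))"
      proof -
        have "(\<Sum>m<Suc n. if m = 0 then 0 else \<Sum>u\<in>words_below N. cmod (d j u) * cmod (?p (m - 1) (u @ v)))
            = (\<Sum>m<n. \<Sum>u\<in>words_below N. cmod (d j u) * cmod (?p m (u @ v)))"
          by (subst sum.lessThan_Suc_shift) simp
        also have "\<dots> = (\<Sum>u\<in>words_below N. cmod (d j u) * (\<Sum>m<n. cmod (?p m (u @ v))))"
          unfolding sum_distrib_left by (rule sum.swap)
        finally have e: "(\<Sum>m<Suc n. if m = 0 then 0 else \<Sum>u\<in>words_below N. cmod (d j u) * cmod (?p (m - 1) (u @ v)))
            = (\<Sum>u\<in>words_below N. cmod (d j u) * (\<Sum>m<n. cmod (?p m (u @ v))))" .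
        show ?thesis unfolding sum.distrib e ssum_sum ..
      qed
      also have "ssum v (\<lambda>a k b. \<Sum>m<Suc n. \<Sum>i\<le>m. cmod (?p i a) * cmod (?p (m - i) b))
          \<le> ssum v (\<lambda>a k b. om (length a) * om (length b))"
      proof (intro ssum_mono)
        fix a k b assume v: "v = a @ k # b"
        have "(\<Sum>m<Suc n. \<Sum>i\<le>m. cmod (?p i a) * cmod (?p (m - i) b))
            = (\<Sum>(m, i)\<in>Sigma {..<Suc n} (\<lambda>m. {..m}). cmod (?p i a) * cmod (?p (m - i) b))"
          by (subst sum.Sigma) auto
        also have "\<dots> = (\<Sum>(i, l)\<in>{(i, l). i + l < Suc n}. cmod (?p i a) * cmod (?p l b))"
          by (rule sum.reindex_bij_witness[of _ "\<lambda>(i, l). (i + l, i)" "\<lambda>(m, i). (i, m - i)"]) auto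
        also have "\<dots> \<le> (\<Sum>(i, l)\<in>{..<Suc n} \<times> {..<Suc n}. cmod (?p i a) * cmod (?p l b))"
          by (intro sum_mono2) auto
        also have "\<dots> = (\<Sum>i<Suc n. cmod (?p i a)) * (\<Sum>l<Suc n. cmod (?p l b))"
          by (simp only: sum_product sum.cartesian_product)
        also have "\<dots> \<le> om (length a) * om (length b)"
          using 1 v Cons by (intro mult_mono) (auto intro!: sum_nonneg simp del: sum.lessThan_Suc)
        finally show "(\<Sum>m<Suc n. \<Sum>i\<le>m. cmod (?p i a) * cmod (?p (m - i) b)) \<le> om (length a) * om (length b)" .
      qed
      also have "\<dots> = (\<Sum>i<?l. om i * om (?l - 1 - i))" by (rule ssum_length)
      also have "(\<Sum>u\<in>words_below N. cmod (d j u) * (\<Sum>m<n. cmod (?p m (u @ v))))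
          \<le> (\<Sum>u\<in>words_below N. cmod (d j u) * (3 ^ length u * om ?l))"
        by (intro sum_mono mult_left_mono order.trans[OF Suc.IH]) (auto simp: om_add_le)
      also have "\<dots> = (\<Sum>u\<in>words_below N. cmod (d j u) * 3 ^ length u) * om ?l"
        unfolding sum_distrib_right by (simp only: mult.assoc)
      also have "\<dots> \<le> (1/20) * om ?l"
        by (intro mult_right_mono small_drift_finite d) auto
      also have "(\<Sum>i<?l. om i * om (?l - 1 - i)) + (1/20) * om ?l \<le> om (length w)"
        using om_convolution[of ?l] Cons by simp
      finally show ?thesis by (simp only: Cons list.size)
    next
      case Nil
      have "(\<Sum>m<Suc n. cmod (sd_coeff al d N m [])) = 1"
        by (subst sum.lessThan_Suc_shift) simp
      then show ?thesis by (simp only: Nil list.size om_0)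
    qed
  qed
qed simp

text \<open>Scalar data whose extension to formal power series, with the variable as \<open>t\<close>, satisfies the
  hypotheses of \<open>sd_ring\<close>.\<close>

locale kms_drift =
  fixes al A :: "'n::finite \<Rightarrow> 'n \<Rightarrow> complex" and d :: "'n \<Rightarrow> 'n ncps" and N :: nat
  assumes al_le: "cmod (al j k) \<le> 1"
    and d_supp: "length u \<ge> N \<Longrightarrow> d j u = 0"
    and d_small: "small_drift d"
    and al_flip: "al j k = (\<Sum>m\<in>UNIV. al k m * A m j)"
    and cov: "(\<Sum>m\<in>UNIV. A m j * d m u) = (\<Sum>v\<in>words (length u). d j v * tw A v u)"
    and hess: "(\<Sum>k\<in>UNIV. al j k * d i (a @ k # b))
                 = (\<Sum>c\<in>words (length b). tw A c b * (\<Sum>k\<in>UNIV. al k i * d j (c @ k # a)))"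
begin

interpretation F: sd_ring "\<lambda>j k. fps_const (al j k)" "\<lambda>j k. fps_const (A j k)" "\<lambda>j u. fps_const (d j u)"
    N fps_X "sd_series al d N"
proof
  show "sd_series al d N [] = 1"
    by (rule fps_ext) (simp add: sd_series_def)
  show "fps_const (al j k) = (\<Sum>m\<in>UNIV. fps_const (al k m) * fps_const (A m j))" for j k
    by (subst al_flip) (simp add: fps_const_sum)
  show "(\<Sum>m\<in>UNIV. fps_const (A m j) * fps_const (d m u))
      = (\<Sum>v\<in>words (length u). fps_const (d j v) * tw (\<lambda>j k. fps_const (A j k)) v u)" for j u
    using arg_cong[OF cov[of j u], of fps_const] by (simp add: tw_fps_const fps_const_sum)
  show "(\<Sum>k\<in>UNIV. fps_const (al j k) * fps_const (d i (a @ k # b)))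
      = (\<Sum>c\<in>words (length b). tw (\<lambda>j k. fps_const (A j k)) c b *
           (\<Sum>k\<in>UNIV. fps_const (al k i) * fps_const (d j (c @ k # a))))" for j i a b
    using arg_cong[OF hess[of j i a b], of fps_const] by (simp add: tw_fps_const fps_const_sum flip: fps_const_mult)
qed (rule sd_series_Cons)

lemma sd_defect_series_eq_0: "F.sd_defect j P Q = 0"
  using F.defects_divisible by (intro fps_eq_0_if_X_powers_dvd) blast

definition sol :: "'n ncps" where "sol w = fps_at_1 (sd_series al d N w)"

lemma fps_abs_summable_sd_series: "fps_abs_summable (sd_series al d N w)"
  unfolding fps_abs_summable_def sd_series_def fps_nth_Abs_fps
  by (rule summableI_nonneg_bounded) (use sd_coeff_sums_le[OF al_le d_small] in auto)

lemma sol_le_om: "cmod (sol w) \<le> om (length w)"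
proof -
  have s: "summable (\<lambda>k. cmod (sd_coeff al d N k w))"
    using fps_abs_summable_sd_series[of w] by (simp add: fps_abs_summable_def sd_series_def)
  have "cmod (sol w) \<le> suminf (\<lambda>k. cmod (sd_coeff al d N k w))"
    unfolding sol_def fps_at_1_def sd_series_def fps_nth_Abs_fps by (rule summable_norm[OF s])
  also have "\<dots> \<le> om (length w)"
    by (rule suminf_le_const[OF s]) (rule sd_coeff_sums_le[OF al_le d_small])
  finally show ?thesis .
qed

lemma sol_Nil: "sol [] = 1"
  using fps_at_1_const[of 1] by (simp add: sol_def F.phi_Nil)

lemma sol_middle:
  "sol (P @ j # Q) + (\<Sum>u\<in>words_below N. d j u * sol (P @ u @ Q))
     = ssum Q (\<lambda>a k b. al k j * sol a * sol (P @ b)) + ssum P (\<lambda>a k b. al j k * sol b * sol (a @ Q))"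
proof -
  let ?f = "sd_series al d N" and ?c = fps_const
  have "?f (P @ j # Q) + fps_X * (\<Sum>u\<in>words_below N. ?c (d j u) * ?f (P @ u @ Q))
     = ssum Q (\<lambda>a k b. ?c (al k j) * ?f a * ?f (P @ b)) + ssum P (\<lambda>a k b. ?c (al j k) * ?f b * ?f (a @ Q))"
    using sd_defect_series_eq_0[of j P Q] by (simp add: F.sd_defect_def algebra_simps)
  from arg_cong[OF this, of fps_at_1] show ?thesis
    by (simp add: fps_at_1_add fps_at_1_mult fps_at_1_sum fps_at_1_ssum fps_abs_summable_mult fps_abs_summable_sum fps_abs_summable_ssum fps_abs_summable_sd_series sol_def)
qed

lemma has_sum_words_below:
  assumes "\<And>u. length u \<ge> N \<Longrightarrow> f u = (0 :: complex)"
  shows "(f has_sum (\<Sum>u\<in>words_below N. f u)) UNIV"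
proof -
  have "(f has_sum (\<Sum>u\<in>words_below N. f u)) (words_below N)" by simp
  then show ?thesis
    by (rule has_sum_cong_neutral[THEN iffD1, rotated -1]) (use assms in \<open>auto simp: words_below_def\<close>)
qed

lemma sd_word_sol: "sd_word al d sol"
  unfolding sd_word_def
proof (intro conjI allI sol_Nil)
  fix j w
  have "(\<Sum>u\<in>words_below N. d j u * sol (u @ w)) = ssum w (\<lambda>a k b. al k j * sol a * sol b) - sol (j # w)"
    using sol_middle[of "[]" j w] by (simp add: algebra_simps)
  then show "((\<lambda>u. d j u * sol (u @ w)) has_sum (ssum w (\<lambda>a k b. al k j * sol a * sol b) - sol (j # w))) UNIV"
    using has_sum_words_below[of "\<lambda>u. d j u * sol (u @ w)"] d_supp by simp
qed

text \<open>Sum \<open>sol_middle\<close> over the letters of \<open>w\<close>. A contraction between two letters is counted once from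
  each of them, hence the factor 2.\<close>

lemma sol_stationary:
  "ssum w (\<lambda>a j b. sol (a @ j # b) + (\<Sum>u\<in>words_below N. d j u * sol (a @ u @ b)))
     = 2 * ssum w (\<lambda>a j b. ssum b (\<lambda>a' k b'. al k j * sol a' * sol (a @ b')))"
  unfolding sol_middle ssum_add
  by (subst ssum_assoc) (simp add: mult_ac)

end

section \<open>Positive kernels and positive functionals\<close>

definition psd_on :: "'i set \<Rightarrow> ('i \<Rightarrow> 'i \<Rightarrow> complex) \<Rightarrow> bool" where
  "psd_on I k \<longleftrightarrow> (\<forall>c. (\<Sum>u\<in>I. \<Sum>v\<in>I. cnj (c u) * c v * k u v) \<in> \<real>\<^sub>\<ge>\<^sub>0)"

lemma sum_nonneg_Reals: "(\<And>i. i \<in> I \<Longrightarrow> f i \<in> \<real>\<^sub>\<ge>\<^sub>0) \<Longrightarrow> sum f I \<in> (\<real>\<^sub>\<ge>\<^sub>0 :: complex set)"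
  by (induction I rule: infinite_finite_induct) auto

lemma psd_onD: "psd_on I k \<Longrightarrow> (\<Sum>u\<in>I. \<Sum>v\<in>I. cnj (c u) * c v * k u v) \<in> \<real>\<^sub>\<ge>\<^sub>0"
  by (simp add: psd_on_def)

lemma psd_on_subset:
  assumes "psd_on I k" "J \<subseteq> I" "finite I"
  shows "psd_on J k"
  unfolding psd_on_def
proof
  fix c :: "_ \<Rightarrow> complex"
  define c' where "c' u = (if u \<in> J then c u else 0)" for u
  have *: "(\<Sum>u\<in>J. F u) = (\<Sum>u\<in>I. if u \<in> J then F u else 0)" for F :: "_ \<Rightarrow> complex"
    using assms by (simp add: sum.If_cases Int_absorb1)
  have "(\<Sum>u\<in>J. \<Sum>v\<in>J. cnj (c u) * c v * k u v) = (\<Sum>u\<in>I. \<Sum>v\<in>I. cnj (c' u) * c' v * k u v)"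
    unfolding * by (intro sum.cong refl) (auto simp: c'_def intro!: sum.cong)
  then show "(\<Sum>u\<in>J. \<Sum>v\<in>J. cnj (c u) * c v * k u v) \<in> \<real>\<^sub>\<ge>\<^sub>0"
    using psd_onD[OF assms(1)] by simp
qed

lemma psd_on_diag: "psd_on I k \<Longrightarrow> x \<in> I \<Longrightarrow> finite I \<Longrightarrow> k x x \<in> \<real>\<^sub>\<ge>\<^sub>0"
  using psd_onD[OF psd_on_subset[of I k "{x}"], of "\<lambda>_. 1"] by simp

lemma psd_on_hermitian:
  assumes "psd_on I k" "finite I" "u \<in> I" "v \<in> I"
  shows "k v u = cnj (k u v)"
proof (cases "u = v")
  case True
  then show ?thesis using psd_on_diag[OF assms(1,3,2)] by (simp add: complex_nonneg_Reals_iff complex_eq_iff)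
next
  case False
  have p: "psd_on {u, v} k" by (rule psd_on_subset[OF assms(1)]) (use assms in auto)
  note d = psd_on_diag[OF assms(1,3,2)] psd_on_diag[OF assms(1,4,2)]
  have 1: "Im (k u v + k v u) = 0"
    using psd_onD[OF p, of "\<lambda>_. 1"] d False by (simp add: complex_nonneg_Reals_iff)
  have 2: "Im (\<i> * k u v - \<i> * k v u) = 0"
    using psd_onD[OF p, of "\<lambda>x. if x = u then 1 else \<i>"] d False by (simp add: complex_nonneg_Reals_iff)
  show ?thesis using 1 2 by (simp add: complex_eq_iff)
qed

text \<open>Cholesky decomposition. If the new diagonal entry is zero, then so is its row, by positivity on
  two points; otherwise pass to the Schur complement.\<close>

lemma psd_on_gram:
  assumes "finite I" "psd_on I k"
  shows "\<exists>g. \<forall>u\<in>I. \<forall>v\<in>I. k u v = (\<Sum>e\<in>I. cnj (g e u) * g e v)"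
  using assms
proof (induction I arbitrary: k rule: finite_induct)
  case (insert x I)
  have fin: "finite (insert x I)" using insert by simp
  have herm: "k v u = cnj (k u v)" if "u \<in> insert x I" "v \<in> insert x I" for u v
    using psd_on_hermitian[OF insert.prems fin that] .
  have kI: "psd_on I k" by (rule psd_on_subset[OF insert.prems]) (use fin in auto)
  have a: "k x x \<in> \<real>\<^sub>\<ge>\<^sub>0" by (rule psd_on_diag[OF insert.prems _ fin]) auto
  show ?case
  proof (cases "k x x = 0")
    case True
    have z: "k x v = 0" if v: "v \<in> I" for v
    proof (rule ccontr)
      assume n: "k x v \<noteq> 0"
      have xv: "x \<noteq> v" using v insert by auto
      have p: "psd_on {x, v} k" by (rule psd_on_subset[OF insert.prems]) (use v fin in auto)
      \<comment> \<open>The quadratic form at the vector \<open>- t k(x,v)\<close>, \<open>1\<close> is \<open>k(v,v) - 2 t |k(x,v)|\<^sup>2\<close>; this \<open>t\<close> makes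
        it \<open>- 1\<close>.\<close>
      define t where "t = (Re (k v v) + 1) / (2 * (cmod (k x v))\<^sup>2)"
      have h: "k v x = cnj (k x v)" by (rule herm) (use v in auto)
      have vv: "k v v \<in> \<real>\<^sub>\<ge>\<^sub>0" by (rule psd_on_diag[OF insert.prems _ fin]) (use v in auto)
      have "(\<Sum>u\<in>{x, v}. \<Sum>w\<in>{x, v}. cnj (if u = x then - of_real t * k x v else 1)
            * (if w = x then - of_real t * k x v else 1) * k u w)
          = k v v - of_real t * (cnj (k x v) * k x v) - of_real t * (k x v * cnj (k x v))"
        using xv True by (simp add: h)
      also have "\<dots> = k v v - of_real (2 * t * (cmod (k x v))\<^sup>2)"
      proof -
        have "k x v * cnj (k x v) = of_real ((cmod (k x v))\<^sup>2)" by (simp only: complex_norm_square)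
        then show ?thesis by (simp add: mult.commute[of "cnj (k x v)"] del: of_real_power)
      qed
      also have "2 * t * (cmod (k x v))\<^sup>2 = Re (k v v) + 1" using n by (simp add: t_def)
      finally show False
        using psd_onD[OF p, of "\<lambda>u. if u = x then - of_real t * k x v else 1"] vv
        by (simp add: complex_nonneg_Reals_iff)
    qed
    obtain g where g: "\<forall>u\<in>I. \<forall>v\<in>I. k u v = (\<Sum>e\<in>I. cnj (g e u) * g e v)"
      using insert.IH[OF kI] by blast
    define g' where "g' e u = (if e = x \<or> u = x then 0 else g e u)" for e u
    have "k u v = (\<Sum>e\<in>insert x I. cnj (g' e u) * g' e v)" if "u \<in> insert x I" "v \<in> insert x I" for u v
    proof (cases "u = x \<or> v = x")
      case T: True
      have "k u v = cnj (k v u)" by (rule herm) (use that in auto)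
      then have "k u v = 0" using T z True that by auto
      then show ?thesis using T by simp (auto simp: g'_def intro!: sum.neutral[symmetric])
    next
      case False
      have ne: "e \<noteq> x" if "e \<in> I" for e using that insert by auto
      show ?thesis using False g that insert ne by (simp add: g'_def)
    qed
    then show ?thesis by blast
  next
    case False
    define r where "r = Re (k x x)"
    have r: "r > 0" "k x x = of_real r"
      using a False by (auto simp: r_def complex_nonneg_Reals_iff complex_eq_iff order.order_iff_strict)
    define k' where "k' u v = k u v - k u x * k x v / r" for u v
    have "psd_on I k'" unfolding psd_on_def
    proof
      fix c :: "_ \<Rightarrow> complex"
      define S where "S = (\<Sum>v\<in>I. k x v * c v)"
      define c' where "c' u = (if u = x then - S / r else c u)" for u
      have c'I: "c' u = c u" if "u \<in> I" for u using that insert by (auto simp: c'_def)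
      have cS: "cnj S = (\<Sum>u\<in>I. cnj (c u) * k u x)"
      proof -
        have "k u x = cnj (k x u)" if "u \<in> I" for u by (rule herm) (use that in auto)
        then show ?thesis unfolding S_def by (simp add: mult.commute)
      qed
      have "(\<Sum>u\<in>insert x I. \<Sum>v\<in>insert x I. cnj (c' u) * c' v * k u v)
          = cnj (c' x) * c' x * k x x + (\<Sum>v\<in>I. cnj (c' x) * c v * k x v)
            + ((\<Sum>u\<in>I. cnj (c u) * c' x * k u x) + (\<Sum>u\<in>I. \<Sum>v\<in>I. cnj (c u) * c v * k u v))"
        using insert.hyps by (simp add: c'I sum.distrib)
      also have "(\<Sum>v\<in>I. cnj (c' x) * c v * k x v) = cnj (c' x) * S"
        by (simp add: S_def sum_distrib_left mult_ac)
      also have "(\<Sum>u\<in>I. cnj (c u) * c' x * k u x) = c' x * cnj S"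
        by (simp add: cS sum_distrib_left mult_ac)
      also have "cnj (c' x) * c' x * k x x + cnj (c' x) * S + (c' x * cnj S + (\<Sum>u\<in>I. \<Sum>v\<in>I. cnj (c u) * c v * k u v))
         = (\<Sum>u\<in>I. \<Sum>v\<in>I. cnj (c u) * c v * k u v) - cnj S * S / r"
        using r by (simp add: c'_def field_simps)
      also have "\<dots> = (\<Sum>u\<in>I. \<Sum>v\<in>I. cnj (c u) * c v * k' u v)"
        unfolding cS unfolding S_def k'_def
        by (simp add: right_diff_distrib sum_subtractf sum_distrib_left sum_distrib_right sum_divide_distrib mult_ac)
      finally show "(\<Sum>u\<in>I. \<Sum>v\<in>I. cnj (c u) * c v * k' u v) \<in> \<real>\<^sub>\<ge>\<^sub>0"
        using psd_onD[OF insert.prems, of c'] by simp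
    qed
    from insert.IH[OF this] obtain g where g: "\<forall>u\<in>I. \<forall>v\<in>I. k' u v = (\<Sum>e\<in>I. cnj (g e u) * g e v)"
      by blast
    define g' where "g' e u = (if e = x then k x u / sqrt r else if u = x then 0 else g e u)" for e u
    have sq: "complex_of_real (sqrt r) * complex_of_real (sqrt r) = of_real r"
      using r by (simp flip: of_real_mult)
    have "k u v = (\<Sum>e\<in>insert x I. cnj (g' e u) * g' e v)" if uv: "u \<in> insert x I" "v \<in> insert x I" for u v
    proof -
      have ne: "e \<noteq> x" if "e \<in> I" for e using that insert by auto
      have "(\<Sum>e\<in>insert x I. cnj (g' e u) * g' e v)
          = cnj (k x u) * k x v / r + (\<Sum>e\<in>I. if u = x \<or> v = x then 0 else cnj (g e u) * g e v)"
        using insert.hyps ne sq by (auto simp: g'_def intro!: sum.cong)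
      also have "cnj (k x u) = k u x" using herm[of x u] uv by simp
      also have "k u x * k x v / r + (\<Sum>e\<in>I. if u = x \<or> v = x then 0 else cnj (g e u) * g e v) = k u v"
      proof (cases "u = x \<or> v = x")
        case True
        then show ?thesis using r by auto
      next
        case False
        then have "(\<Sum>e\<in>I. cnj (g e u) * g e v) = k' u v" using g uv by auto
        then show ?thesis using False by (simp add: k'_def)
      qed
      finally show ?thesis by simp
    qed
    then show ?thesis by blast
  qed
qed simp

lemma schur_product:
  assumes "finite I" "psd_on I k" "psd_on I l"
  shows "psd_on I (\<lambda>u v. k u v * l u v)"
  unfolding psd_on_def
proof
  fix c :: "_ \<Rightarrow> complex"
  obtain g where g: "\<forall>u\<in>I. \<forall>v\<in>I. k u v = (\<Sum>e\<in>I. cnj (g e u) * g e v)"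
    using psd_on_gram[OF assms(1,2)] by blast
  have "(\<Sum>u\<in>I. \<Sum>v\<in>I. cnj (c u) * c v * (k u v * l u v))
      = (\<Sum>u\<in>I. \<Sum>v\<in>I. \<Sum>e\<in>I. cnj (c u * g e u) * (c v * g e v) * l u v)"
    using g by (intro sum.cong refl) (simp add: sum_distrib_left sum_distrib_right mult_ac)
  also have "\<dots> = (\<Sum>e\<in>I. \<Sum>u\<in>I. \<Sum>v\<in>I. cnj (c u * g e u) * (c v * g e v) * l u v)"
    by (rule trans[OF sum.cong[OF refl sum.swap] sum.swap])
  also have "\<dots> \<in> \<real>\<^sub>\<ge>\<^sub>0"
    by (intro sum_nonneg_Reals psd_onD[OF assms(3)])
  finally show "(\<Sum>u\<in>I. \<Sum>v\<in>I. cnj (c u) * c v * (k u v * l u v)) \<in> \<real>\<^sub>\<ge>\<^sub>0" .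
qed

lemma psd_on_pullback:
  assumes "finite I" "psd_on (h ` I) k"
  shows "psd_on I (\<lambda>i j. k (h i) (h j))"
  unfolding psd_on_def
proof
  fix c :: "_ \<Rightarrow> complex"
  define c' where "c' x = (\<Sum>i | i \<in> I \<and> h i = x. c i)" for x
  let ?X = "\<lambda>i j. cnj (c i) * c j * k (h i) (h j)"
  have "(\<Sum>x\<in>h ` I. \<Sum>y\<in>h ` I. cnj (c' x) * c' y * k x y)
      = (\<Sum>x\<in>h ` I. \<Sum>y\<in>h ` I. \<Sum>i | i \<in> I \<and> h i = x. \<Sum>j | j \<in> I \<and> h j = y. ?X i j)"
    unfolding c'_def cnj_sum sum_product sum_distrib_right
    by (intro sum.cong refl) (auto simp: sum_distrib_left sum_distrib_right)
  also have "\<dots> = (\<Sum>x\<in>h ` I. \<Sum>i | i \<in> I \<and> h i = x. \<Sum>y\<in>h ` I. \<Sum>j | j \<in> I \<and> h j = y. ?X i j)"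
    by (intro sum.cong refl sum.swap)
  also have "\<dots> = (\<Sum>i\<in>I. \<Sum>j\<in>I. ?X i j)"
    unfolding sum.image_gen[OF assms(1), of _ h, symmetric] ..
  finally show "(\<Sum>i\<in>I. \<Sum>j\<in>I. cnj (c i) * c j * k (h i) (h j)) \<in> \<real>\<^sub>\<ge>\<^sub>0"
    using psd_onD[OF assms(2), of c'] by simp
qed

text \<open>With concatenation as addition of words, finitely supported functions on words are the free
  algebra.\<close>

instantiation list :: (type) monoid_add
begin
definition plus_list :: "'a list \<Rightarrow> 'a list \<Rightarrow> 'a list" where "plus_list = append"
definition zero_list :: "'a list" where "zero_list = []"
instance by standard (auto simp: plus_list_def zero_list_def)
end

type_synonym 'n fa = "'n list \<Rightarrow>\<^sub>0 complex"

definition mon :: "'n list \<Rightarrow> 'n fa" where "mon w = Poly_Mapping.single w 1"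
definition cst :: "complex \<Rightarrow> 'n fa" where "cst c = Poly_Mapping.single [] c"
definition lin :: "('n list \<Rightarrow> complex) \<Rightarrow> 'n fa \<Rightarrow> complex" where
  "lin f p = (\<Sum>w\<in>Poly_Mapping.keys p. Poly_Mapping.lookup p w * f w)"

lemma lin_superset:
  assumes "finite F" "Poly_Mapping.keys p \<subseteq> F"
  shows "lin f p = (\<Sum>w\<in>F. Poly_Mapping.lookup p w * f w)"
  unfolding lin_def by (rule sum.mono_neutral_left) (use assms in \<open>auto simp: in_keys_iff\<close>)

lemma lin_0 [simp]: "lin f 0 = 0" by (simp add: lin_def)

lemma lin_single [simp]: "lin f (Poly_Mapping.single w c) = c * f w"
  by (subst lin_superset[of "{w}"]) auto

lemma lin_add: "lin f (p + q) = lin f p + lin f q"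
proof -
  let ?F = "Poly_Mapping.keys p \<union> Poly_Mapping.keys q"
  have "lin f (p + q) = (\<Sum>w\<in>?F. Poly_Mapping.lookup (p + q) w * f w)"
    by (rule lin_superset) (simp, rule Poly_Mapping.keys_add)
  also have "\<dots> = lin f p + lin f q"
    by (subst (1 2) lin_superset[of ?F]) (auto simp: lookup_add distrib_right sum.distrib)
  finally show ?thesis .
qed

lemma lin_sum: "lin f (\<Sum>i\<in>I. p i) = (\<Sum>i\<in>I. lin f (p i))"
  by (induction I rule: infinite_finite_induct) (auto simp: lin_add)

lemma lin_ssum: "lin f (ssum w F) = ssum w (\<lambda>a k b. lin f (F a k b))"
  unfolding ssum_conv_sum by (rule lin_sum)

lemma lin_mon [simp]: "lin f (mon w) = f w" by (simp add: mon_def)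

lemma fa_decompose: "p = (\<Sum>w\<in>Poly_Mapping.keys p. Poly_Mapping.single w (Poly_Mapping.lookup p w))"
proof (rule poly_mapping_eqI)
  fix v
  show "Poly_Mapping.lookup p v
     = Poly_Mapping.lookup (\<Sum>w\<in>Poly_Mapping.keys p. Poly_Mapping.single w (Poly_Mapping.lookup p w)) v"
    by (auto simp: lookup_sum lookup_single when_def in_keys_iff)
qed

lemma fa_induct [case_names single add]:
  assumes s: "\<And>w c. P (Poly_Mapping.single w c)" and a: "\<And>p q. P p \<Longrightarrow> P q \<Longrightarrow> P (p + q)"
  shows "P (p :: 'n fa)"
proof -
  have 0: "P 0" using s[of "[]" 0] by simp
  have "P (\<Sum>w\<in>F. Poly_Mapping.single w (c w))" for F c
    by (induction F rule: infinite_finite_induct) (use 0 s a in auto)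
  then show ?thesis by (subst fa_decompose)
qed

lemma single_times: "Poly_Mapping.single u c * Poly_Mapping.single v d = (Poly_Mapping.single (u @ v) (c * d) :: 'n fa)"
  by (simp add: mult_single plus_list_def)

lemma mon_mult: "mon u * mon v = mon (u @ v)" by (simp add: mon_def single_times)

lemma mon_Nil: "mon [] = 1" by (simp add: mon_def zero_list_def[symmetric])

lemma cst_central: "cst c * p = p * cst c"
  by (induction p rule: fa_induct) (auto simp: cst_def single_times mult.commute distrib_left distrib_right)

lemma lin_cst_mult [simp]: "lin f (cst c * p) = c * lin f p"
  by (induction p rule: fa_induct) (auto simp: cst_def single_times lin_add distrib_left)

lemma lin_uminus: "lin f (- p) = - lin f p"
  by (simp add: lin_def sum_negf)

lemma lin_diff: "lin f (p - q) = lin f p - lin f q"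
  using lin_add[of f p "- q"] by (simp add: lin_uminus)

definition star :: "'n fa \<Rightarrow> 'n fa" where
  "star p = (\<Sum>w\<in>Poly_Mapping.keys p. Poly_Mapping.single (rev w) (cnj (Poly_Mapping.lookup p w)))"

lemma lookup_star: "Poly_Mapping.lookup (star p) w = cnj (Poly_Mapping.lookup p (rev w))"
proof -
  have "Poly_Mapping.lookup (star p) w
     = (\<Sum>v\<in>Poly_Mapping.keys p. if v = rev w then cnj (Poly_Mapping.lookup p v) else 0)"
    unfolding star_def lookup_sum by (intro sum.cong refl) (auto simp: lookup_single when_def)
  also have "\<dots> = cnj (Poly_Mapping.lookup p (rev w))" by (auto simp: in_keys_iff)
  finally show ?thesis .
qed

lemma star_add: "star (p + q) = star p + star q"
  by (rule poly_mapping_eqI) (simp add: lookup_star lookup_add)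

lemma star_single [simp]: "star (Poly_Mapping.single w c) = Poly_Mapping.single (rev w) (cnj c)"
  by (rule poly_mapping_eqI) (auto simp: lookup_star lookup_single when_def)

lemma star_0 [simp]: "star 0 = 0" by (rule poly_mapping_eqI) (simp add: lookup_star)

lemma star_diff: "star (p - q) = star p - star q"
  by (rule poly_mapping_eqI) (simp add: lookup_star lookup_minus)

lemma star_sum: "star (\<Sum>i\<in>I. p i) = (\<Sum>i\<in>I. star (p i))"
  by (induction I rule: infinite_finite_induct) (auto simp: star_add)

lemma star_ssum: "star (ssum w F) = ssum w (\<lambda>a k b. star (F a k b))"
  unfolding ssum_conv_sum by (rule star_sum)

lemma star_mult: "star (p * q) = star q * star p"
proof (induction p rule: fa_induct)
  case (single w c)
  show ?case
    by (induction q rule: fa_induct) (auto simp: single_times distrib_left distrib_right star_add mult.commute)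
qed (auto simp: distrib_left distrib_right star_add)

lemma star_mon [simp]: "star (mon w) = mon (rev w)" by (simp add: mon_def)
lemma star_cst [simp]: "star (cst c) = cst (cnj c)" by (simp add: cst_def)
lemma star_1 [simp]: "star 1 = (1 :: 'n fa)" using star_mon[of "[]"] by (simp add: mon_Nil)

text \<open>Functionals are given by their values on words. This is positivity on squares \<open>P\<^sup>* P\<close> of
  polynomials.\<close>

definition positive :: "'n ncps \<Rightarrow> bool" where
  "positive f \<longleftrightarrow> (\<forall>F. finite F \<longrightarrow> psd_on F (\<lambda>u v. f (rev u @ v)))"

lemma lin_star_mult:
  "lin f (star p * q) = (\<Sum>u\<in>Poly_Mapping.keys p. \<Sum>v\<in>Poly_Mapping.keys q.
      cnj (Poly_Mapping.lookup p u) * Poly_Mapping.lookup q v * f (rev u @ v))"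
proof -
  have "star p * q = (\<Sum>u\<in>Poly_Mapping.keys p. \<Sum>v\<in>Poly_Mapping.keys q.
     Poly_Mapping.single (rev u @ v) (cnj (Poly_Mapping.lookup p u) * Poly_Mapping.lookup q v))"
  proof -
    have "star p * q = star p * (\<Sum>v\<in>Poly_Mapping.keys q. Poly_Mapping.single v (Poly_Mapping.lookup q v))"
      using fa_decompose[of q] by simp
    then show ?thesis unfolding star_def by (simp add: sum_product single_times)
  qed
  then show ?thesis by (simp add: lin_sum)
qed

lemma positive_lin: "positive f \<Longrightarrow> lin f (star p * p) \<in> \<real>\<^sub>\<ge>\<^sub>0"
  unfolding lin_star_mult positive_def by (intro psd_onD) auto

lemma positive_gram:
  assumes "positive f" "finite I"
  shows "psd_on I (\<lambda>i j. lin f (star (q i) * q j))"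
  unfolding psd_on_def
proof
  fix c :: "_ \<Rightarrow> complex"
  let ?p = "\<Sum>i\<in>I. cst (c i) * q i"
  have "star ?p * ?p = (\<Sum>i\<in>I. \<Sum>j\<in>I. cst (cnj (c i)) * (cst (c j) * (star (q i) * q j)))"
    unfolding star_sum star_mult star_cst sum_product
    by (intro sum.cong refl) (simp add: cst_central[symmetric] mult.assoc, metis cst_central mult.assoc)
  then have "lin f (star ?p * ?p) = (\<Sum>i\<in>I. \<Sum>j\<in>I. cnj (c i) * c j * lin f (star (q i) * q j))"
    by (simp add: lin_sum mult.assoc)
  then show "(\<Sum>i\<in>I. \<Sum>j\<in>I. cnj (c i) * c j * lin f (star (q i) * q j)) \<in> \<real>\<^sub>\<ge>\<^sub>0"
    using positive_lin[OF assms(1), of ?p] by simp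
qed

lemma positive_hermitian: "positive f \<Longrightarrow> f (rev w) = cnj (f w)"
  using psd_on_hermitian[of "{[], w}" "\<lambda>u v. f (rev u @ v)" "[]" w] by (simp add: positive_def)

section \<open>Positivity of one step of the dynamics\<close>

text \<open>Substitute \<open>X\<^sub>j + \<surd>\<tau> S\<^sub>j\<close> for \<open>X\<^sub>j\<close>, where \<open>S\<close> has mean zero and covariance \<open>\<alpha>\<close>, and take the
  expectation over \<open>S\<close>, keeping only those contractions of \<open>S\<close> that neither cross nor enclose
  one another; the word enclosed by a contraction is evaluated in \<open>\<psi>\<close>. To first order in \<open>\<tau>\<close>
  this agrees with free noise, and it is linear in the outer functional.\<close>

function noise :: "('n \<Rightarrow> 'n \<Rightarrow> complex) \<Rightarrow> real \<Rightarrow> 'n ncps \<Rightarrow> 'n list \<Rightarrow> 'n fa" where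
  "noise al \<tau> \<psi> [] = 1"
| "noise al \<tau> \<psi> (j # w) = mon [j] * noise al \<tau> \<psi> w
     + ssum w (\<lambda>a k b. cst (of_real \<tau> * al k j * \<psi> a) * noise al \<tau> \<psi> b)"
  by pat_completeness auto
termination
  by (relation "measures [\<lambda>(al, \<tau>, \<psi>, w). length w]") auto

lemma lin_cst_mid: "lin f (p * (cst c * q)) = c * lin f (p * q)"
  by (metis cst_central lin_cst_mult mult.assoc)

text \<open>In \<open>u\<^sup>* v\<close> at most one contraction can connect \<open>u\<^sup>*\<close> with \<open>v\<close>, because two of them would cross
  or be nested. Either there is none, or it connects \<open>k\<close> with \<open>l\<close>, encloses the word \<open>a\<^sup>* a'\<close>,
  and leaves \<open>b\<^sup>*\<close> and \<open>b'\<close> outside.\<close>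

lemma noise_split:
  fixes \<tau> :: real
  assumes al: "\<And>j k. cnj (al j k) = al k j" and \<psi>: "\<And>w. cnj (\<psi> w) = \<psi> (rev w)"
  defines "E \<equiv> noise al \<tau> \<psi>"
  shows "lin f (E (rev u @ v)) = lin f (star (E u) * E v)
     + of_real \<tau> * ssum u (\<lambda>a k b. ssum v (\<lambda>a' l b'. al l k * \<psi> (rev a @ a') * lin f (star (E b) * E b')))"
proof (induction u arbitrary: v)
  case Nil
  show ?case by (simp add: E_def)
next
  case (Cons j u)
  define X where "X a k b a' l b' = al l k * \<psi> (rev a @ a') * lin f (star (E b) * E b')" for a k b a' l b'
  have EC: "E (j # w) = mon [j] * E w + ssum w (\<lambda>a k b. cst (of_real \<tau> * al k j * \<psi> a) * E b)" for w
    by (simp add: E_def)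
  have 1: "lin f (star (E u) * E (j # v)) = lin f (star (E u) * mon [j] * E v)
      + of_real \<tau> * ssum v (\<lambda>a' l b'. al l j * \<psi> a' * lin f (star (E u) * E b'))"
    by (simp add: EC distrib_left lin_add mult.assoc ssum_mult_left[symmetric] lin_ssum lin_cst_mid)
  have 2: "lin f (star (E (j # u)) * E v) = lin f (star (E u) * mon [j] * E v)
      + of_real \<tau> * ssum u (\<lambda>a k b. al j k * \<psi> (rev a) * lin f (star (E b) * E v))"
    by (simp add: EC star_add star_mult star_ssum distrib_right lin_add mult.assoc ssum_mult_right[symmetric]
        ssum_mult_left[symmetric] lin_ssum lin_cst_mid al \<psi>)
  have 3: "ssum u (\<lambda>a k b. ssum (j # v) (X a k b))
      = ssum u (\<lambda>a k b. al j k * \<psi> (rev a) * lin f (star (E b) * E v))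
        + ssum u (\<lambda>a k b. ssum v (\<lambda>a'. X a k b (j # a')))"
    by (simp add: ssum_add X_def)
  have 4: "ssum (j # u) (\<lambda>a k b. ssum v (X a k b))
      = ssum v (\<lambda>a' l b'. al l j * \<psi> a' * lin f (star (E u) * E b'))
        + ssum u (\<lambda>a k b. ssum v (\<lambda>a'. X a k b (j # a')))"
    by (simp add: X_def[abs_def])
  have "lin f (E (rev (j # u) @ v)) = lin f (star (E u) * E (j # v)) + of_real \<tau> * ssum u (\<lambda>a k b. ssum (j # v) (X a k b))"
    using Cons.IH[of "j # v"] unfolding X_def by simp
  also have "\<dots> = lin f (star (E (j # u)) * E v) + of_real \<tau> * ssum (j # u) (\<lambda>a k b. ssum v (X a k b))"
    unfolding 1 2 3 4 by (simp add: distrib_left)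
  finally show ?case unfolding X_def .
qed

text \<open>By \<open>noise_split\<close> the kernel is a sum of a Gram kernel and of a pullback of the product of three
  positive kernels: the covariance of the two contracted letters, \<open>\<psi>\<close> on the enclosed words and
  \<open>f\<close> on the outer ones. The product is positive by Schur.\<close>

lemma positive_noise:
  fixes al :: "'n::finite \<Rightarrow> 'n \<Rightarrow> complex"
  assumes al: "\<And>j k. cnj (al j k) = al k j" "psd_on UNIV (\<lambda>k l. al l k)"
    and pos: "positive \<psi>" "positive f" and \<tau>: "\<tau> \<ge> 0"
  shows "positive (\<lambda>w. lin f (noise al \<tau> \<psi> w))"
  unfolding positive_def
proof (intro allI impI)
  fix F :: "'n list set"
  assume F: "finite F"
  define E where "E = noise al \<tau> \<psi>"
  have \<psi>: "cnj (\<psi> w) = \<psi> (rev w)" for w using positive_hermitian[OF pos(1)] by metis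
  \<comment> \<open>Words with a marked letter, that is, the possible ends of a contraction in \<open>u\<close> or \<open>v\<close>.\<close>
  define I where "I = Sigma F (\<lambda>v. {..<length v})"
  have I: "finite I" using F by (simp add: I_def)
  define pre where "pre = (\<lambda>(v, i). take i v :: 'n list)"
  define letter where "letter = (\<lambda>(v, i). v ! i :: 'n)"
  define post where "post = (\<lambda>(v, i). drop (Suc i) v :: 'n list)"
  define K where "K x y = al (letter y) (letter x) * (\<psi> (rev (pre x) @ pre y) * lin f (star (E (post x)) * E (post y)))" for x y
  have K: "psd_on I K"
    unfolding K_def
  proof (intro schur_product I)
    show "psd_on I (\<lambda>x y. al (letter y) (letter x))"
      by (rule psd_on_pullback[OF I, of letter "\<lambda>k l. al l k"]) (rule psd_on_subset[OF al(2)], auto)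
    show "psd_on I (\<lambda>x y. \<psi> (rev (pre x) @ pre y))"
      by (rule psd_on_pullback[OF I, of pre "\<lambda>u v. \<psi> (rev u @ v)"]) (use pos(1) I in \<open>auto simp: positive_def\<close>)
    show "psd_on I (\<lambda>x y. lin f (star (E (post x)) * E (post y)))"
      by (rule positive_gram[OF pos(2) I])
  qed
  have split: "lin f (E (rev u @ v)) = lin f (star (E u) * E v)
     + of_real \<tau> * ssum u (\<lambda>a k b. ssum v (\<lambda>a' l b'. al l k * \<psi> (rev a @ a') * lin f (star (E b) * E b')))" for u v
    unfolding E_def by (rule noise_split) (fact al(1) \<psi>)+
  show "psd_on F (\<lambda>u v. lin f (E (rev u @ v)))" unfolding psd_on_def
  proof
    fix c :: "_ \<Rightarrow> complex"
    have "(\<Sum>u\<in>F. \<Sum>v\<in>F. cnj (c u) * c v * lin f (E (rev u @ v)))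
        = (\<Sum>u\<in>F. \<Sum>v\<in>F. cnj (c u) * c v * lin f (star (E u) * E v))
          + of_real \<tau> * (\<Sum>u\<in>F. \<Sum>v\<in>F. \<Sum>i<length u. \<Sum>i'<length v. cnj (c u) * c v * K (u, i) (v, i'))"
      unfolding split K_def ssum_conv_sum
      by (simp add: pre_def post_def letter_def distrib_left sum.distrib sum_distrib_left mult_ac)
    also have "(\<Sum>u\<in>F. \<Sum>v\<in>F. \<Sum>i<length u. \<Sum>i'<length v. cnj (c u) * c v * K (u, i) (v, i'))
        = (\<Sum>x\<in>I. \<Sum>y\<in>I. cnj (c (fst x)) * c (fst y) * K x y)"
    proof -
      have "(\<Sum>x\<in>I. \<Sum>y\<in>I. cnj (c (fst x)) * c (fst y) * K x y)
          = (\<Sum>u\<in>F. \<Sum>i<length u. \<Sum>v\<in>F. \<Sum>i'<length v. cnj (c u) * c v * K (u, i) (v, i'))"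
      proof -
        have sI: "(\<Sum>x\<in>I. G x) = (\<Sum>u\<in>F. \<Sum>i<length u. G (u, i))" for G :: "_ \<Rightarrow> complex"
          unfolding I_def using F by (subst sum.Sigma) auto
        show ?thesis unfolding sI by simp
      qed
      also have "\<dots> = (\<Sum>u\<in>F. \<Sum>v\<in>F. \<Sum>i<length u. \<Sum>i'<length v. cnj (c u) * c v * K (u, i) (v, i'))"
        by (intro sum.cong refl sum.swap)
      finally show ?thesis ..
    qed
    finally show "(\<Sum>u\<in>F. \<Sum>v\<in>F. cnj (c u) * c v * lin f (E (rev u @ v))) \<in> \<real>\<^sub>\<ge>\<^sub>0"
      using psd_onD[OF K, of "\<lambda>x. c (fst x)"] psd_onD[OF positive_gram[OF pos(2) F, of E], of c] \<tau>
      by (auto intro!: nonneg_Reals_add_I nonneg_Reals_mult_I)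
  qed
qed

primrec subst :: "('n \<Rightarrow> 'n fa) \<Rightarrow> 'n list \<Rightarrow> 'n fa" where
  "subst q [] = 1"
| "subst q (j # w) = q j * subst q w"

lemma subst_append: "subst q (u @ v) = subst q u * subst q v"
  by (induction u) (auto simp: mult.assoc)

lemma star_subst: "(\<And>j. star (q j) = q j) \<Longrightarrow> star (subst q w) = subst q (rev w)"
  by (induction w) (auto simp: star_mult subst_append)

lemma positive_subst:
  assumes "\<And>j. star (q j) = q j" "positive f"
  shows "positive (\<lambda>w. lin f (subst q w))"
  unfolding positive_def subst_append star_subst[OF assms(1), symmetric]
  using positive_gram[OF assms(2)] by blast

section \<open>Error estimates for one step\<close>

lemma norm_add_bound:
  "norm z \<le> c \<Longrightarrow> norm y \<le> b \<Longrightarrow> x = y + z \<Longrightarrow> norm x \<le> b + c" for x y z :: "'a::real_normed_vector"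
  using norm_triangle_ineq[of y z] by simp

lemma norm_diff_bound:
  "norm z \<le> c \<Longrightarrow> norm y \<le> b \<Longrightarrow> x = y - z \<Longrightarrow> norm x \<le> b + c" for x y z :: "'a::real_normed_vector"
  using norm_triangle_ineq4[of y z] by simp

lemma sum_triangle: "(\<Sum>i<n. \<Sum>m<i. g m) = (\<Sum>m<n. real (n - 1 - m) * g m)"
proof (induction n)
  case (Suc n)
  have "(\<Sum>m<n. real (n - 1 - m) * g m) + (\<Sum>m<n. g m) = (\<Sum>m<n. real (n - m) * g m)"
    unfolding sum.distrib[symmetric]
    by (intro sum.cong refl) (auto simp: algebra_simps of_nat_diff)
  then show ?case using Suc by simp
qed simp

text \<open>A pair of letters splits \<open>w\<close> into three blocks, and \<open>F\<close> sees only the lengths of the inner block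
  and of the two outer blocks together. An inner block of length \<open>m\<close> has \<open>|w| - 1 - m\<close>
  positions; by the symmetry of \<open>F\<close> this number may be averaged with that for the complementary
  length, which gives \<open>|w| / 2\<close>. In stationary equations this factor cancels against the number
  of letters in \<open>w\<close>.\<close>

lemma ssum_pairs_length:
  assumes sym: "\<And>m l. F m l = F l m"
  shows "2 * ssum w (\<lambda>x k y. ssum y (\<lambda>x' k' y'. F (length x') (length x + length y')))
     = real (length w) * (\<Sum>m<length w - 1. F m (length w - 2 - m))"
proof (cases "length w")
  case 0
  then show ?thesis by simp
next
  case (Suc n)
  define g where "g m = (F m (n - 1 - m) :: real)" for m
  have "ssum w (\<lambda>x k y. ssum y (\<lambda>x' k' y'. F (length x') (length x + length y')))
      = (\<Sum>i<Suc n. \<Sum>m<n - i. F m (i + (n - i - 1 - m)))"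
    unfolding ssum_length[where f = "\<lambda>i l. F i (length _ + l)"]
      ssum_length[where f = "\<lambda>i l. \<Sum>m<l. F m (i + (l - 1 - m))"]
    by (simp add: Suc)
  also have "\<dots> = (\<Sum>i<Suc n. \<Sum>m<n - i. g m)"
    unfolding g_def by (intro sum.cong refl arg_cong2[where f = F]) auto
  also have "\<dots> = (\<Sum>i<Suc n. \<Sum>m<i. g m)"
    using sum.nat_diff_reindex[of "\<lambda>i. \<Sum>m<i. g m" "Suc n"] by simp
  also have "\<dots> = (\<Sum>m<n. real (n - m) * g m)"
    unfolding sum_triangle by simp
  finally have 1: "ssum w (\<lambda>x k y. ssum y (\<lambda>x' k' y'. F (length x') (length x + length y'))) = (\<Sum>m<n. real (n - m) * g m)" .
  have "(\<Sum>m<n. real (n - m) * g m) = (\<Sum>m<n. real (n - (n - Suc m)) * g (n - Suc m))"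
    by (rule sum.nat_diff_reindex[symmetric])
  also have "\<dots> = (\<Sum>m<n. (real m + 1) * g m)"
    by (intro sum.cong refl) (auto simp: g_def sym)
  finally have 2: "(\<Sum>m<n. real (n - m) * g m) = (\<Sum>m<n. (real m + 1) * g m)" .
  have "2 * (\<Sum>m<n. real (n - m) * g m) = (\<Sum>m<n. real (n - m) * g m) + (\<Sum>m<n. (real m + 1) * g m)"
    using 2 by simp
  also have "\<dots> = (\<Sum>m<n. real (Suc n) * g m)"
    unfolding sum.distrib[symmetric] by (intro sum.cong refl) (auto simp: of_nat_diff algebra_simps)
  finally show ?thesis using Suc by (simp only: 1 sum_distrib_left[symmetric] g_def) (simp add: g_def)
qed

lemma norm_ssum_pairs_le:
  assumes sym: "\<And>m l. F m l = F l m"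
    and le: "\<And>x k y x' k' y'. cmod (H x k x' k' y') \<le> F (length x') (length x + length y')"
  shows "2 * cmod (ssum w (\<lambda>x k y. ssum y (\<lambda>x' k' y'. H x k x' k' y')))
      \<le> real (length w) * (\<Sum>m<length w - 1. F m (length w - 2 - m))"
proof -
  have "cmod (ssum w (\<lambda>x k y. ssum y (\<lambda>x' k' y'. H x k x' k' y')))
      \<le> ssum w (\<lambda>x k y. ssum y (\<lambda>x' k' y'. F (length x') (length x + length y')))"
    by (intro order.trans[OF norm_ssum] ssum_mono order.trans[OF norm_ssum] le)
  with ssum_pairs_length[of F w, OF sym] show ?thesis by linarith
qed

locale positive_drift =
  fixes al :: "'n::finite \<Rightarrow> 'n \<Rightarrow> complex" and d :: "'n \<Rightarrow> 'n ncps" and N :: nat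
  assumes al_le: "cmod (al j k) \<le> 1"
    and al_herm: "cnj (al j k) = al k j"
    and al_psd: "psd_on UNIV (\<lambda>k l. al l k)"
    and d_supp: "length u \<ge> N \<Longrightarrow> d j u = 0"
    and d_small: "small_drift d"
    and d_sa: "d j (rev u) = cnj (d j u)"
begin

text \<open>The derivation that replaces a letter \<open>k\<close> by \<open>X\<^sub>k + d\<^sub>k\<close>, applied to the block \<open>w\<close> behind a
  fixed prefix \<open>a\<close>. The prefix is carried along for the inductions on \<open>w\<close>.\<close>

definition drift_term :: "'n ncps \<Rightarrow> 'n list \<Rightarrow> 'n list \<Rightarrow> complex" where
  "drift_term f a w = ssum w (\<lambda>x k y. f (a @ x @ k # y) + (\<Sum>u\<in>words_below N. d k u * f (a @ x @ u @ y)))"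

definition noise_term :: "'n ncps \<Rightarrow> 'n ncps \<Rightarrow> 'n list \<Rightarrow> 'n list \<Rightarrow> complex" where
  "noise_term \<psi> f a w = ssum w (\<lambda>x k y. ssum y (\<lambda>x' k' y'. al k' k * \<psi> x' * f (a @ x @ y')))"

text \<open>The negative of the generator of the free Langevin dynamics, with \<open>\<psi>\<close> on the enclosed words; it
  is linear in \<open>f\<close>.\<close>

definition gen :: "'n ncps \<Rightarrow> 'n ncps \<Rightarrow> 'n list \<Rightarrow> complex" where
  "gen \<psi> f w = drift_term f [] w - 2 * noise_term \<psi> f [] w"

text \<open>The Euler step \<open>X\<^sub>j - h (X\<^sub>j + d\<^sub>j)\<close> of the drift.\<close>

definition shifted :: "real \<Rightarrow> 'n \<Rightarrow> 'n fa" where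
  "shifted h j = cst (1 - of_real h) * mon [j] - (\<Sum>u\<in>words_below N. cst (of_real h * d j u) * mon u)"

lemma star_shifted: "star (shifted h j) = shifted h j"
proof -
  have "(\<Sum>u\<in>words_below N. cst (of_real h * cnj (d j u)) * mon (rev u))
      = (\<Sum>u\<in>words_below N. cst (of_real h * d j u) * mon u)"
    by (rule sum.reindex_bij_witness[of _ rev rev]) (auto simp: words_below_def d_sa)
  then show ?thesis
    by (simp add: shifted_def star_diff star_mult star_sum cst_central[symmetric])
qed

definition nstep :: "real \<Rightarrow> 'n ncps \<Rightarrow> 'n ncps \<Rightarrow> 'n ncps" where
  "nstep h \<psi> f w = lin f (noise al (2 * h) \<psi> w)"

definition sstep :: "real \<Rightarrow> 'n ncps \<Rightarrow> 'n ncps" where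
  "sstep h g w = lin g (subst (shifted h) w)"

lemma nstep_Cons:
  "lin f (mon a * noise al \<tau> \<psi> (j # w)) = lin f (mon (a @ [j]) * noise al \<tau> \<psi> w)
     + of_real \<tau> * ssum w (\<lambda>x k y. al k j * \<psi> x * lin f (mon a * noise al \<tau> \<psi> y))"
  by (simp add: distrib_left lin_add mult.assoc[symmetric] mon_mult)
     (simp add: mult.assoc ssum_mult_left[symmetric] lin_ssum lin_cst_mid)

lemma subst_Cons:
  "lin g (mon a * subst (shifted h) (j # w)) = (1 - of_real h) * lin g (mon (a @ [j]) * subst (shifted h) w)
     - of_real h * (\<Sum>u\<in>words_below N. d j u * lin g (mon (a @ u) * subst (shifted h) w))"
proof -
  have "mon a * subst (shifted h) (j # w) = cst (1 - of_real h) * (mon (a @ [j]) * subst (shifted h) w)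
      - (\<Sum>u\<in>words_below N. cst (of_real h * d j u) * (mon (a @ u) * subst (shifted h) w))"
    by (simp add: shifted_def right_diff_distrib left_diff_distrib sum_distrib_left sum_distrib_right)
       (simp add: mon_mult[symmetric] mult.assoc, simp add: mult.assoc[symmetric] cst_central[symmetric])
  then show ?thesis by (simp add: lin_diff lin_sum sum_distrib_left mult.assoc)
qed

context
  fixes h :: real and \<psi> :: "'n ncps"
  assumes h: "0 \<le> h" "h \<le> 1/100" and \<psi>: "\<And>w. cmod (\<psi> w) \<le> 3 ^ length w"
begin

lemma pair_term_le:
  assumes "cmod z \<le> x"
  shows "cmod (al k' k * \<psi> v * z) \<le> 3 ^ length v * x"
proof -
  have "cmod (al k' k * \<psi> v * z) \<le> 1 * 3 ^ length v * x"
    unfolding norm_mult by (intro mult_mono al_le \<psi> assms) auto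
  then show ?thesis by simp
qed

text \<open>One step of noise raises the growth rate by \<open>2 h / (37/10 - 3) = 20/7 h\<close>.\<close>

lemma noise_bound:
  assumes f: "\<And>w. cmod (f w) \<le> (37/10) ^ length w"
  shows "cmod (lin f (mon a * noise al (2 * h) \<psi> w)) \<le> (37/10) ^ length a * (37/10 + 20/7 * h) ^ length w"
proof (induction w arbitrary: a rule: length_induct)
  case (1 w)
  show ?case
  proof (cases w)
    case (Cons j v)
    let ?r = "37/10 :: real" and ?s = "37/10 + 20/7 * h" and ?n = "length v"
    have "cmod (ssum v (\<lambda>x k y. al k j * \<psi> x * lin f (mon a * noise al (2 * h) \<psi> y)))
       \<le> (\<Sum>i<?n. 3 ^ i * (?r ^ length a * ?s ^ (?n - 1 - i)))"
      by (intro norm_ssum_le pair_term_le) (use 1 Cons in auto)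
    also have "\<dots> = ?r ^ length a * (\<Sum>i<?n. 3 ^ i * ?s ^ (?n - 1 - i))"
      by (simp add: sum_distrib_left mult_ac)
    also have "\<dots> \<le> ?r ^ length a * (?s ^ ?n / (?s - 3))"
      by (intro mult_left_mono geometric_convolution) (use h in auto)
    also have "\<dots> \<le> ?r ^ length a * (?s ^ ?n / (7/10))"
      by (intro mult_left_mono divide_left_mono) (use h in auto)
    finally have 2: "cmod (of_real (2 * h) * ssum v (\<lambda>x k y. al k j * \<psi> x * lin f (mon a * noise al (2 * h) \<psi> y)))
       \<le> 2 * h * (?r ^ length a * (?s ^ ?n / (7/10)))"
      using h unfolding norm_mult by (intro mult_mono) auto
    have 3: "cmod (lin f (mon (a @ [j]) * noise al (2 * h) \<psi> v)) \<le> ?r ^ length (a @ [j]) * ?s ^ ?n"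
    proof -
      have "cmod (lin f (mon a' * noise al (2 * h) \<psi> v)) \<le> ?r ^ length a' * ?s ^ ?n" for a'
        using 1 Cons by simp
      then show ?thesis .
    qed
    have "cmod (lin f (mon a * noise al (2 * h) \<psi> w)) \<le> ?r ^ length (a @ [j]) * ?s ^ ?n
        + 2 * h * (?r ^ length a * (?s ^ ?n / (7/10)))"
      unfolding Cons nstep_Cons by (intro order.trans[OF norm_triangle_ineq] add_mono 2 3)
    also have "\<dots> = ?r ^ length a * ?s ^ length w" using Cons by (simp add: algebra_simps)
    finally show ?thesis .
  qed (use f in auto)
qed

lemma noise_error1:
  assumes f: "\<And>w. cmod (f w) \<le> (37/10) ^ length w"
  shows "cmod (lin f (mon a * noise al (2 * h) \<psi> w) - f (a @ w))
           \<le> 2 * h * length w * (19/5) ^ (length a + length w)"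
  (is "_ \<le> _ * ?L ^ _")
proof (induction w arbitrary: a)
  case (Cons j w)
  let ?n = "length w" and ?X = "ssum w (\<lambda>x k y. al k j * \<psi> x * lin f (mon a * noise al (2 * h) \<psi> y))"
  have L: "cmod (lin f (mon a * noise al (2 * h) \<psi> y)) \<le> ?L ^ length a * ?L ^ length y" for y
  proof -
    have "(37/10) ^ length a * (37/10 + 20/7 * h) ^ length y \<le> ?L ^ length a * ?L ^ length y"
      by (intro mult_mono power_mono) (use h in auto)
    then show ?thesis using noise_bound[OF f, of a y] by linarith
  qed
  have "cmod ?X \<le> (\<Sum>i<?n. 3 ^ i * (?L ^ length a * ?L ^ (?n - 1 - i)))"
    by (intro norm_ssum_le pair_term_le L)
  also have "\<dots> = ?L ^ length a * (\<Sum>i<?n. 3 ^ i * ?L ^ (?n - 1 - i))"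
    by (simp add: sum_distrib_left mult_ac)
  also have "\<dots> \<le> ?L ^ length a * (?L ^ ?n / (?L - 3))"
    by (intro mult_left_mono geometric_convolution) auto
  also have "\<dots> \<le> ?L ^ (length a + length (j # w))" by (simp add: power_add)
  finally have "cmod (of_real (2 * h) * ?X) \<le> 2 * h * ?L ^ (length a + length (j # w))"
    using h unfolding norm_mult by (intro mult_mono) auto
  moreover have "cmod (lin f (mon (a @ [j]) * noise al (2 * h) \<psi> w) - f ((a @ [j]) @ w))
      \<le> 2 * h * ?n * ?L ^ (length (a @ [j]) + ?n)" by (rule Cons.IH)
  moreover have "lin f (mon a * noise al (2 * h) \<psi> (j # w)) - f (a @ j # w)
      = (lin f (mon (a @ [j]) * noise al (2 * h) \<psi> w) - f ((a @ [j]) @ w)) + of_real (2 * h) * ?X"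
    unfolding nstep_Cons by simp
  ultimately have "cmod (lin f (mon a * noise al (2 * h) \<psi> (j # w)) - f (a @ j # w))
      \<le> 2 * h * ?n * ?L ^ (length (a @ [j]) + ?n) + 2 * h * ?L ^ (length a + length (j # w))"
    by (rule norm_add_bound)
  also have "\<dots> = 2 * h * length (j # w) * ?L ^ (length a + length (j # w))" by (simp add: algebra_simps)
  finally show ?case .
qed simp

lemma noise_error2:
  assumes f: "\<And>w. cmod (f w) \<le> (37/10) ^ length w"
  shows "cmod (lin f (mon a * noise al (2 * h) \<psi> w) - f (a @ w) - of_real (2 * h) * noise_term \<psi> f a w)
           \<le> (2 * h * length w)\<^sup>2 * (19/5) ^ (length a + length w)"
  (is "_ \<le> _ * ?L ^ _")
proof (induction w arbitrary: a)
  case Nil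
  then show ?case by (simp add: noise_term_def)
next
  case (Cons j w)
  let ?n = "length w" and ?e = "\<lambda>y. lin f (mon a * noise al (2 * h) \<psi> y) - f (a @ y)"
  let ?X = "ssum w (\<lambda>x k y. al k j * \<psi> x * ?e y)"
  let ?b = "lin f (mon (a @ [j]) * noise al (2 * h) \<psi> w) - f ((a @ [j]) @ w) - of_real (2 * h) * noise_term \<psi> f (a @ [j]) w"
  have "cmod ?X \<le> (\<Sum>i<?n. 3 ^ i * (2 * h * ?n * (?L ^ length a * ?L ^ (?n - 1 - i))))"
  proof (intro norm_ssum_le pair_term_le)
    fix x k y assume w: "w = x @ k # y"
    have "2 * h * length y * ?L ^ (length a + length y) \<le> 2 * h * ?n * ?L ^ (length a + length y)"
      using w h by (intro mult_right_mono mult_left_mono) auto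
    then show "cmod (?e y) \<le> 2 * h * ?n * (?L ^ length a * ?L ^ length y)"
      using noise_error1[OF f, of a y] unfolding power_add by linarith
  qed
  also have "\<dots> = 2 * h * ?n * ?L ^ length a * (\<Sum>i<?n. 3 ^ i * ?L ^ (?n - 1 - i))"
    by (simp add: sum_distrib_left mult_ac)
  also have "\<dots> \<le> 2 * h * ?n * ?L ^ length a * (?L ^ ?n / (?L - 3))"
    using h by (intro mult_left_mono geometric_convolution) auto
  also have "\<dots> \<le> 2 * h * ?n * ?L ^ length a * ?L ^ length (j # w)"
    using h by (intro mult_left_mono) auto
  finally have "cmod (of_real (2 * h) * ?X) \<le> 2 * h * (2 * h * ?n * ?L ^ length a * ?L ^ length (j # w))"
    using h unfolding norm_mult by (intro mult_mono) auto
  moreover have "cmod ?b \<le> (2 * h * ?n)\<^sup>2 * ?L ^ (length (a @ [j]) + ?n)" by (rule Cons.IH)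
  moreover have "noise_term \<psi> f a (j # w) = ssum w (\<lambda>x k y. al k j * \<psi> x * f (a @ y)) + noise_term \<psi> f (a @ [j]) w"
    by (simp add: noise_term_def)
  then have "lin f (mon a * noise al (2 * h) \<psi> (j # w)) - f (a @ j # w) - of_real (2 * h) * noise_term \<psi> f a (j # w)
      = ?b + of_real (2 * h) * ?X"
    unfolding nstep_Cons by (simp add: right_diff_distrib ssum_diff distrib_left)
  ultimately have "cmod (lin f (mon a * noise al (2 * h) \<psi> (j # w)) - f (a @ j # w) - of_real (2 * h) * noise_term \<psi> f a (j # w))
      \<le> (2 * h * ?n)\<^sup>2 * ?L ^ (length (a @ [j]) + ?n) + 2 * h * (2 * h * ?n * ?L ^ length a * ?L ^ length (j # w))"
    by (rule norm_add_bound)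
  also have "\<dots> = (2 * h)\<^sup>2 * (real ?n * real ?n + real ?n) * ?L ^ (length a + length (j # w))"
    by (simp add: power2_eq_square power_add algebra_simps)
  also have "\<dots> \<le> (2 * h)\<^sup>2 * (real (length (j # w)))\<^sup>2 * ?L ^ (length a + length (j # w))"
    by (intro mult_right_mono mult_left_mono) (auto simp: power2_eq_square algebra_simps)
  finally show ?case by (simp add: power_mult_distrib mult.assoc)
qed

end

context
  fixes h :: real
  assumes h: "0 \<le> h" "h \<le> 1/100"
begin

lemma drift_le:
  assumes "\<And>u. u \<in> words_below N \<Longrightarrow> cmod (f u) \<le> C * r ^ length u" "0 \<le> r" "r \<le> 19/5" "C \<ge> 0"
  shows "cmod (\<Sum>u\<in>words_below N. d j u * f u) \<le> C / 20"
  by (rule drift_sum_bound[OF d_small assms(2,3) _ assms(4,1)]) auto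

text \<open>The Euler step lowers the growth rate: \<open>X\<^sub>j\<close> is damped by \<open>1 - h\<close>, and the drift adds only
  \<open>h / 20\<close>. Its effect outweighs that of the noise, see \<open>step_bound\<close>.\<close>

lemma subst_bound:
  assumes g: "\<And>w. cmod (g w) \<le> r ^ length w" and r: "0 \<le> r" "r \<le> 19/5"
  shows "cmod (lin g (mon a * subst (shifted h) w)) \<le> r ^ length a * ((1 - h) * r + h / 20) ^ length w"
proof (induction w arbitrary: a)
  case (Cons j w)
  let ?s = "(1 - h) * r + h / 20"
  have s: "?s \<ge> 0" using h r by simp
  have "cmod (\<Sum>u\<in>words_below N. d j u * lin g (mon (a @ u) * subst (shifted h) w)) \<le> (r ^ length a * ?s ^ length w) / 20"
  proof (rule drift_le[OF _ r])
    fix u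
    show "cmod (lin g (mon (a @ u) * subst (shifted h) w)) \<le> r ^ length a * ?s ^ length w * r ^ length u"
      using Cons.IH[of "a @ u"] by (simp add: power_add mult_ac)
  qed (use r s in auto)
  then have 1: "cmod (of_real h * (\<Sum>u\<in>words_below N. d j u * lin g (mon (a @ u) * subst (shifted h) w)))
      \<le> h * ((r ^ length a * ?s ^ length w) / 20)"
    using h unfolding norm_mult by (intro mult_mono) auto
  have 2: "cmod ((1 - of_real h) * lin g (mon (a @ [j]) * subst (shifted h) w)) \<le> (1 - h) * (r ^ length (a @ [j]) * ?s ^ length w)"
  proof -
    have "cmod (1 - of_real h) = cmod (of_real (1 - h))" by simp
    also have "\<dots> = 1 - h" using h unfolding norm_of_real by simp
    finally have "cmod (1 - of_real h) = 1 - h" .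
    then show ?thesis using h unfolding norm_mult by (intro mult_mono Cons.IH) auto
  qed
  have "cmod (lin g (mon a * subst (shifted h) (j # w))) \<le> (1 - h) * (r ^ length (a @ [j]) * ?s ^ length w)
       + h * ((r ^ length a * ?s ^ length w) / 20)"
    unfolding subst_Cons by (intro order.trans[OF norm_triangle_ineq4] add_mono 1 2)
  also have "\<dots> = r ^ length a * ?s ^ length (j # w)" by (simp add: algebra_simps)
  finally show ?case .
qed (use g in auto)

lemma subst_bound':
  assumes g: "\<And>w. cmod (g w) \<le> (19/5) ^ length w"
  shows "cmod (lin g (mon a * subst (shifted h) w)) \<le> (19/5) ^ (length a + length w)"
proof -
  have "(1 - h) * (19/5) + h / 20 \<le> 19/5" using h unfolding left_diff_distrib by linarith
  then have "((1 - h) * (19/5) + h / 20) ^ length w \<le> (19/5) ^ length w"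
    using h by (intro power_mono) auto
  then have "(19/5) ^ length a * ((1 - h) * (19/5) + h / 20) ^ length w \<le> (19/5) ^ (length a + length w)"
    by (simp add: power_add)
  then show ?thesis using subst_bound[of g "19/5" a w, OF g] by simp
qed

lemma subst_error1:
  assumes g: "\<And>w. cmod (g w) \<le> (19/5) ^ length w"
  shows "cmod (lin g (mon a * subst (shifted h) w) - g (a @ w)) \<le> 2 * h * length w * (19/5) ^ (length a + length w)"
  (is "_ \<le> _ * ?L ^ _")
proof (induction w arbitrary: a)
  case (Cons j w)
  let ?n = "length w" and ?B = "\<lambda>a. lin g (mon a * subst (shifted h) w)"
  let ?X = "?B (a @ [j]) + (\<Sum>u\<in>words_below N. d j u * ?B (a @ u))"
  have "cmod (\<Sum>u\<in>words_below N. d j u * ?B (a @ u)) \<le> ?L ^ (length a + ?n) / 20"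
  proof (rule drift_le[where r = ?L])
    fix u
    show "cmod (?B (a @ u)) \<le> ?L ^ (length a + ?n) * ?L ^ length u"
      using subst_bound'[OF g, of "a @ u" w] by (simp add: power_add mult_ac)
  qed auto
  moreover have "cmod (?B (a @ [j])) \<le> ?L ^ (length (a @ [j]) + ?n)" by (rule subst_bound'[OF g])
  ultimately have "cmod ?X \<le> ?L ^ (length (a @ [j]) + ?n) + ?L ^ (length a + ?n) / 20"
    by (intro order.trans[OF norm_triangle_ineq] add_mono)
  also have "\<dots> \<le> 2 * ?L ^ (length a + length (j # w))" by simp
  finally have "cmod (of_real h * ?X) \<le> h * (2 * ?L ^ (length a + length (j # w)))"
    using h unfolding norm_mult by (intro mult_mono) auto
  moreover have "cmod (?B (a @ [j]) - g ((a @ [j]) @ w)) \<le> 2 * h * ?n * ?L ^ (length (a @ [j]) + ?n)"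
    by (rule Cons.IH)
  moreover have "lin g (mon a * subst (shifted h) (j # w)) - g (a @ j # w) = (?B (a @ [j]) - g ((a @ [j]) @ w)) - of_real h * ?X"
    unfolding subst_Cons by (simp add: algebra_simps)
  ultimately have "cmod (lin g (mon a * subst (shifted h) (j # w)) - g (a @ j # w))
      \<le> 2 * h * ?n * ?L ^ (length (a @ [j]) + ?n) + h * (2 * ?L ^ (length a + length (j # w)))"
    by (rule norm_diff_bound)
  also have "\<dots> = 2 * h * length (j # w) * ?L ^ (length a + length (j # w))" by (simp add: algebra_simps)
  finally show ?case .
qed simp

lemma subst_error2:
  assumes g: "\<And>w. cmod (g w) \<le> (19/5) ^ length w"
  shows "cmod (lin g (mon a * subst (shifted h) w) - g (a @ w) + of_real h * drift_term g a w)
     \<le> (2 * h * length w)\<^sup>2 * (19/5) ^ (length a + length w)"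
  (is "_ \<le> _ * ?L ^ _")
proof (induction w arbitrary: a)
  case Nil
  then show ?case by (simp add: drift_term_def)
next
  case (Cons j w)
  let ?n = "length w" and ?e = "\<lambda>a. lin g (mon a * subst (shifted h) w) - g (a @ w)"
  let ?X = "?e (a @ [j]) + (\<Sum>u\<in>words_below N. d j u * ?e (a @ u))"
  let ?b = "?e (a @ [j]) + of_real h * drift_term g (a @ [j]) w"
  have "cmod (\<Sum>u\<in>words_below N. d j u * ?e (a @ u)) \<le> (2 * h * ?n * ?L ^ (length a + ?n)) / 20"
  proof (rule drift_le[where r = ?L])
    fix u
    show "cmod (?e (a @ u)) \<le> 2 * h * ?n * ?L ^ (length a + ?n) * ?L ^ length u"
      using subst_error1[OF g, of "a @ u" w] by (simp add: power_add mult_ac)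
  qed (use h in auto)
  moreover have "cmod (?e (a @ [j])) \<le> 2 * h * ?n * ?L ^ (length (a @ [j]) + ?n)" by (rule subst_error1[OF g])
  ultimately have "cmod ?X \<le> 2 * h * ?n * ?L ^ (length (a @ [j]) + ?n) + (2 * h * ?n * ?L ^ (length a + ?n)) / 20"
    by (intro order.trans[OF norm_triangle_ineq] add_mono)
  also have "\<dots> = 2 * h * ?n * (?L ^ (length (a @ [j]) + ?n) + ?L ^ (length a + ?n) / 20)"
    by (simp add: algebra_simps)
  also have "\<dots> \<le> 2 * h * ?n * (2 * ?L ^ (length a + length (j # w)))"
    using h by (intro mult_left_mono) auto
  finally have "cmod (of_real h * ?X) \<le> h * (2 * h * ?n * (2 * ?L ^ (length a + length (j # w))))"
    using h unfolding norm_mult by (intro mult_mono) auto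
  moreover have "cmod ?b \<le> (2 * h * ?n)\<^sup>2 * ?L ^ (length (a @ [j]) + ?n)" by (rule Cons.IH)
  moreover have "drift_term g a (j # w) = g (a @ j # w) + (\<Sum>u\<in>words_below N. d j u * g (a @ u @ w)) + drift_term g (a @ [j]) w"
    by (simp add: drift_term_def)
  then have "lin g (mon a * subst (shifted h) (j # w)) - g (a @ j # w) + of_real h * drift_term g a (j # w) = ?b - of_real h * ?X"
    unfolding subst_Cons by (simp add: algebra_simps sum_subtractf sum_distrib_left)
  ultimately have "cmod (lin g (mon a * subst (shifted h) (j # w)) - g (a @ j # w) + of_real h * drift_term g a (j # w))
      \<le> (2 * h * ?n)\<^sup>2 * ?L ^ (length (a @ [j]) + ?n) + h * (2 * h * ?n * (2 * ?L ^ (length a + length (j # w))))"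
    by (rule norm_diff_bound)
  also have "\<dots> = (2 * h)\<^sup>2 * (real ?n * real ?n + real ?n) * ?L ^ (length a + length (j # w))"
    by (simp add: power2_eq_square power_add algebra_simps)
  also have "\<dots> \<le> (2 * h)\<^sup>2 * (real (length (j # w)))\<^sup>2 * ?L ^ (length a + length (j # w))"
    by (intro mult_right_mono mult_left_mono) (auto simp: power2_eq_square algebra_simps)
  finally show ?case by (simp add: power_mult_distrib mult.assoc)
qed

end

end

section \<open>Positive stationary functionals of the linearised dynamics\<close>

lemma positive_evaluation_0: "positive (\<lambda>w. if w = [] then 1 else 0)"
  unfolding positive_def psd_on_def
proof (intro allI impI)
  fix F :: "'a list set" and c assume F: "finite F"
  have "(\<Sum>u\<in>F. \<Sum>v\<in>F. cnj (c u) * c v * (if rev u @ v = [] then 1 else 0))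
      = (if [] \<in> F then cnj (c []) * c [] else 0)"
  proof -
    have "(\<Sum>u\<in>F. \<Sum>v\<in>F. cnj (c u) * c v * (if rev u @ v = [] then 1 else 0))
        = (\<Sum>u\<in>F. if u = [] then (\<Sum>v\<in>F. if v = [] then cnj (c u) * c v else 0) else 0)"
      by (intro sum.cong refl) (auto intro!: sum.cong)
    then show ?thesis using F by simp
  qed
  also have "\<dots> \<in> \<real>\<^sub>\<ge>\<^sub>0" by (auto simp: complex_nonneg_Reals_iff)
  finally show "(\<Sum>u\<in>F. \<Sum>v\<in>F. cnj (c u) * c v * (if rev u @ v = [] then 1 else 0)) \<in> \<real>\<^sub>\<ge>\<^sub>0" .
qed

lemma positive_sum:
  fixes f :: "'m \<Rightarrow> 'n ncps"
  assumes "\<And>m. m \<in> S \<Longrightarrow> positive (f m)" "c \<ge> 0"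
  shows "positive (\<lambda>w. of_real c * (\<Sum>m\<in>S. f m w))"
  unfolding positive_def psd_on_def
proof (intro allI impI)
  fix F :: "'n list set" and z :: "_ \<Rightarrow> complex" assume F: "finite F"
  have "(\<Sum>u\<in>F. \<Sum>v\<in>F. cnj (z u) * z v * (of_real c * (\<Sum>m\<in>S. f m (rev u @ v))))
      = (\<Sum>u\<in>F. \<Sum>v\<in>F. \<Sum>m\<in>S. of_real c * (cnj (z u) * z v * f m (rev u @ v)))"
    by (simp add: sum_distrib_left mult_ac)
  also have "\<dots> = (\<Sum>m\<in>S. \<Sum>u\<in>F. \<Sum>v\<in>F. of_real c * (cnj (z u) * z v * f m (rev u @ v)))"
    by (rule trans[OF sum.cong[OF refl sum.swap] sum.swap])
  also have "\<dots> = of_real c * (\<Sum>m\<in>S. \<Sum>u\<in>F. \<Sum>v\<in>F. cnj (z u) * z v * f m (rev u @ v))"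
    by (simp add: sum_distrib_left)
  also have "\<dots> \<in> \<real>\<^sub>\<ge>\<^sub>0"
    using assms F by (intro nonneg_Reals_mult_I sum_nonneg_Reals psd_onD) (auto simp: positive_def)
  finally show "(\<Sum>u\<in>F. \<Sum>v\<in>F. cnj (z u) * z v * (of_real c * (\<Sum>m\<in>S. f m (rev u @ v)))) \<in> \<real>\<^sub>\<ge>\<^sub>0" .
qed

lemma positive_limit:
  fixes g :: "'n ncps"
  assumes "\<And>k. positive (f k)" "\<And>w. (\<lambda>k. f k w) \<longlonglongrightarrow> g w"
  shows "positive g"
  unfolding positive_def psd_on_def
proof (intro allI impI)
  fix F :: "'n list set" and z :: "_ \<Rightarrow> complex" assume F: "finite F"
  have "(\<lambda>k. \<Sum>u\<in>F. \<Sum>v\<in>F. cnj (z u) * z v * f k (rev u @ v))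
     \<longlonglongrightarrow> (\<Sum>u\<in>F. \<Sum>v\<in>F. cnj (z u) * z v * g (rev u @ v))"
    by (intro tendsto_sum tendsto_mult tendsto_const assms)
  moreover have "(\<Sum>u\<in>F. \<Sum>v\<in>F. cnj (z u) * z v * f k (rev u @ v)) \<in> \<real>\<^sub>\<ge>\<^sub>0" for k
    using assms(1)[of k] F by (intro psd_onD) (auto simp: positive_def)
  ultimately show "(\<Sum>u\<in>F. \<Sum>v\<in>F. cnj (z u) * z v * g (rev u @ v)) \<in> \<real>\<^sub>\<ge>\<^sub>0"
    by (intro Lim_in_closed_set[OF closed_nonneg_Reals_complex]) auto
qed

lemma pointwise_convergent_subsequence:
  fixes f :: "nat \<Rightarrow> 'n::finite list \<Rightarrow> complex"
  assumes "\<And>k w. cmod (f k w) \<le> b w"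
  obtains r g where "strict_mono r" "\<And>w. (\<lambda>k. f (r k) w) \<longlonglongrightarrow> g w"
proof -
  have b: "b w \<ge> 0" for w using order_trans[OF norm_ge_zero assms] .
  have "\<exists>r. strict_mono r \<and> (\<forall>w\<in>UNIV. \<exists>l. (\<lambda>k. f (r k) w / of_real (b w + 1)) \<longlonglongrightarrow> l)"
  proof (rule function_convergent_subsequence[of "UNIV :: 'n list set" "\<lambda>k w. f k w / of_real (b w + 1)" 1])
    show "norm (f n x / of_real (b x + 1)) \<le> 1" for n x
      using assms[of n x] b[of x] by (simp add: norm_divide divide_simps del: of_real_add)
  qed auto
  then obtain r l where r: "strict_mono r" "\<And>w. (\<lambda>k. f (r k) w / of_real (b w + 1)) \<longlonglongrightarrow> l w"
    by (metis UNIV_I)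
  have "(\<lambda>k. f (r k) w) \<longlonglongrightarrow> l w * of_real (b w + 1)" for w
  proof -
    have "(complex_of_real (b w + 1)) \<noteq> 0" using b[of w] by (metis add_nonneg_pos less_irrefl of_real_eq_0_iff zero_less_one)
    then show ?thesis using tendsto_mult[OF r(2)[of w] tendsto_const[of "complex_of_real (b w + 1)"]] by simp
  qed
  then show ?thesis by (rule that[OF r(1)])
qed

context positive_drift
begin

definition step :: "real \<Rightarrow> 'n ncps \<Rightarrow> 'n ncps \<Rightarrow> 'n ncps" where
  "step h \<psi> f = sstep h (nstep h \<psi> f)"

lemma step_Nil: "step h \<psi> f [] = f []"
  using lin_mon[of f "[]"] lin_mon[of "nstep h \<psi> f" "[]"]
  by (simp add: step_def sstep_def mon_Nil) (simp add: nstep_def mon_Nil)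

lemma positive_step:
  assumes "positive \<psi>" "positive f" "h \<ge> 0"
  shows "positive (step h \<psi> f)"
  unfolding step_def sstep_def[abs_def] nstep_def[abs_def]
  by (intro positive_subst star_shifted positive_noise al_herm al_psd assms) (use assms in auto)

lemma step_bound:
  assumes h: "0 \<le> h" "h \<le> 1/100" and \<psi>: "\<And>w. cmod (\<psi> w) \<le> 3 ^ length w"
    and f: "\<And>w. cmod (f w) \<le> (37/10) ^ length w"
  shows "cmod (step h \<psi> f w) \<le> (37/10) ^ length w"
proof -
  let ?r = "37/10 + 20/7 * h"
  have g: "cmod (nstep h \<psi> f v) \<le> ?r ^ length v" for v
    using noise_bound[OF h \<psi> f, of "[]" v] by (simp add: nstep_def mon_Nil)
  have "cmod (step h \<psi> f w) \<le> ((1 - h) * ?r + h / 20) ^ length w"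
    using subst_bound[OF h g, of "[]" w] h by (simp add: step_def sstep_def mon_Nil)
  also have "\<dots> \<le> (37/10) ^ length w"
  proof (rule power_mono)
    have "(1 - h) * ?r + h / 20 = 37/10 - 111/140 * h - 20/7 * (h * h)" by (simp add: field_simps)
    moreover have "h * h \<ge> 0" by simp
    ultimately show "(1 - h) * ?r + h / 20 \<le> 37/10" using h by linarith
  qed (use h in auto)
  finally show ?thesis .
qed

lemma drift_term_diff_le:
  fixes c :: real
  assumes e: "\<And>v. cmod (e v) \<le> c * length v * (19/5) ^ length v" and c: "c \<ge> 0"
  shows "cmod (drift_term e [] w) \<le> c * (2 * length w * (length w + N) * (19/5) ^ length w)"
  (is "_ \<le> _ * (_ * ?L ^ _)")
proof -
  let ?n = "length w"
  have "cmod (drift_term e [] w) \<le> (\<Sum>i<?n. c * (2 * (?n + N) * ?L ^ ?n))"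
    unfolding drift_term_def
  proof (rule norm_ssum_le[where f = "\<lambda>_ _. c * (2 * (?n + N) * ?L ^ ?n)"])
    fix x k y assume w: "w = x @ k # y"
    have p: "?L ^ (length x + length y) \<le> ?L ^ ?n" by (rule power_increasing) (use w in auto)
    have "cmod (\<Sum>u\<in>words_below N. d k u * e ([] @ x @ u @ y)) \<le> (c * (?n + N) * ?L ^ (length x + length y)) / 20"
    proof (rule drift_sum_bound[OF d_small, where r = ?L])
      fix u :: "'n list" assume "u \<in> words_below N"
      then have "real (length (x @ u @ y)) \<le> ?n + N" by (auto simp: words_below_def w)
      then have "c * length (x @ u @ y) * ?L ^ length (x @ u @ y) \<le> c * (?n + N) * ?L ^ length (x @ u @ y)"
        using c by (intro mult_right_mono mult_left_mono) auto
      with e[of "x @ u @ y"] show "cmod (e ([] @ x @ u @ y)) \<le> c * (?n + N) * ?L ^ (length x + length y) * ?L ^ length u"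
        by (simp add: power_add mult_ac)
    qed (use c in auto)
    also have "\<dots> \<le> c * (?n + N) * ?L ^ ?n"
    proof -
      have "c * (?n + N) * ?L ^ (length x + length y) \<le> c * (?n + N) * ?L ^ ?n"
        using c p by (intro mult_left_mono) auto
      moreover have "c * (?n + N) * ?L ^ (length x + length y) \<ge> 0" using c by simp
      ultimately show ?thesis by linarith
    qed
    finally have 1: "cmod (\<Sum>u\<in>words_below N. d k u * e ([] @ x @ u @ y)) \<le> c * (?n + N) * ?L ^ ?n" .
    have "cmod (e ([] @ x @ k # y)) \<le> c * ?n * ?L ^ ?n" using e[of w] w by simp
    also have "\<dots> \<le> c * (?n + N) * ?L ^ ?n" using c by (intro mult_right_mono mult_left_mono) auto
    finally have "cmod (e ([] @ x @ k # y) + (\<Sum>u\<in>words_below N. d k u * e ([] @ x @ u @ y)))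
        \<le> c * (?n + N) * ?L ^ ?n + c * (?n + N) * ?L ^ ?n"
      by (intro order.trans[OF norm_triangle_ineq] add_mono 1)
    then show "cmod (e ([] @ x @ k # y) + (\<Sum>u\<in>words_below N. d k u * e ([] @ x @ u @ y))) \<le> c * (2 * (?n + N) * ?L ^ ?n)"
      by (simp add: algebra_simps)
  qed
  then show ?thesis by (simp add: mult_ac)
qed

lemma drift_term_diff: "drift_term (\<lambda>v. f v - g v) a w = drift_term f a w - drift_term g a w"
  by (simp add: drift_term_def ssum_diff[symmetric] right_diff_distrib sum_subtractf algebra_simps)

text \<open>The noise contributes the contractions and the substitution the drift, each up to an error of
  order \<open>h\<^sup>2\<close>. The constant \<open>C\<close> depends on the word, but not on the functionals.\<close>

lemma step_generator:
  "\<exists>C. \<forall>h \<psi> f. 0 \<le> h \<longrightarrow> h \<le> 1/100 \<longrightarrow> (\<forall>w. cmod (\<psi> w) \<le> 3 ^ length w) \<longrightarrow>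
     (\<forall>w. cmod (f w) \<le> (37/10) ^ length w) \<longrightarrow>
     cmod (step h \<psi> f w - f w + of_real h * gen \<psi> f w) \<le> C * h\<^sup>2"
proof (intro exI allI impI)
  fix h and \<psi> f :: "'n ncps"
  assume h: "0 \<le> h" "h \<le> (1/100 :: real)" and "\<forall>w. cmod (\<psi> w) \<le> 3 ^ length w"
    "\<forall>w. cmod (f w) \<le> (37/10) ^ length w"
  then have \<psi>: "\<And>w. cmod (\<psi> w) \<le> 3 ^ length w" and f: "\<And>w. cmod (f w) \<le> (37/10) ^ length w" by auto
  let ?L = "19/5 :: real" and ?n = "real (length w)"
  define g where "g = nstep h \<psi> f"
  have g: "cmod (g v) \<le> ?L ^ length v" for v
  proof -
    have "(37/10 + 20/7 * h) ^ length v \<le> ?L ^ length v" by (intro power_mono) (use h in auto)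
    then show ?thesis using noise_bound[OF h \<psi> f, of "[]" v] by (simp add: g_def nstep_def mon_Nil)
  qed
  define e where "e v = g v - f v" for v
  have e: "cmod (e v) \<le> 2 * h * length v * ?L ^ length v" for v
    using noise_error1[OF h \<psi> f, of "[]" v] by (simp add: e_def g_def nstep_def mon_Nil)
  let ?a = "step h \<psi> f w - g w + of_real h * drift_term g [] w"
  let ?b = "g w - f w - of_real (2 * h) * noise_term \<psi> f [] w"
  let ?c = "of_real h * drift_term e [] w"
  have 1: "cmod ?a \<le> (2 * h * ?n)\<^sup>2 * ?L ^ length w"
    using subst_error2[OF h g, of "[]" w] by (simp add: step_def sstep_def mon_Nil g_def)
  have 2: "cmod ?b \<le> (2 * h * ?n)\<^sup>2 * ?L ^ length w"
    using noise_error2[OF h \<psi> f, of "[]" w] by (simp add: g_def nstep_def mon_Nil)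
  have "cmod ?c \<le> h * (2 * h * (2 * ?n * (?n + N) * ?L ^ length w))"
    unfolding norm_mult using drift_term_diff_le[OF e] h by (intro mult_mono) auto
  then have 3: "cmod ?c \<le> h * (2 * h * (2 * ?n * (?n + N) * ?L ^ length w))" .
  have eq: "step h \<psi> f w - f w + of_real h * gen \<psi> f w = ?a + ?b - ?c"
    unfolding e_def[abs_def] drift_term_diff gen_def by (simp add: algebra_simps)
  have "cmod (?a + ?b - ?c) \<le> (2 * h * ?n)\<^sup>2 * ?L ^ length w + (2 * h * ?n)\<^sup>2 * ?L ^ length w
      + h * (2 * h * (2 * ?n * (?n + N) * ?L ^ length w))"
    by (intro order.trans[OF norm_triangle_ineq4] add_mono order.trans[OF norm_triangle_ineq] 1 2 3)
  also have "\<dots> = (8 * ?n\<^sup>2 * ?L ^ length w + 4 * ?n * (?n + N) * ?L ^ length w) * h\<^sup>2"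
    by (simp add: power2_eq_square algebra_simps)
  finally show "cmod (step h \<psi> f w - f w + of_real h * gen \<psi> f w)
      \<le> (8 * ?n\<^sup>2 * ?L ^ length w + 4 * ?n * (?n + N) * ?L ^ length w) * h\<^sup>2" unfolding eq .
qed

lemma gen_linear: "gen \<psi> (\<lambda>w. c * (\<Sum>m\<in>S. f m w)) w = c * (\<Sum>m\<in>S. gen \<psi> (f m) w)"
proof -
  have 1: "drift_term (\<lambda>w. c * (\<Sum>m\<in>S. f m w)) [] w = (\<Sum>m\<in>S. c * drift_term (f m) [] w)"
    unfolding drift_term_def ssum_mult_left[symmetric] ssum_sum[symmetric]
    by (intro ssum_cong refl)
       (simp add: distrib_left sum.distrib sum_distrib_left mult_ac, subst sum.swap, simp)
  have 2: "noise_term \<psi> (\<lambda>w. c * (\<Sum>m\<in>S. f m w)) [] w = (\<Sum>m\<in>S. c * noise_term \<psi> (f m) [] w)"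
    unfolding noise_term_def ssum_mult_left[symmetric] ssum_sum[symmetric]
    by (intro ssum_cong refl) (simp add: sum_distrib_left mult_ac)
  show ?thesis unfolding gen_def 1 2 by (simp add: sum_distrib_left sum_subtractf right_diff_distrib mult_ac)
qed

lemma gen_tendsto:
  assumes "\<And>w. (\<lambda>k. f k w) \<longlonglongrightarrow> g w"
  shows "(\<lambda>k. gen \<psi> (f k) w) \<longlonglongrightarrow> gen \<psi> g w"
  unfolding gen_def drift_term_def noise_term_def ssum_conv_sum
  by (intro tendsto_intros assms)

text \<open>Krylov and Bogoliubov: start the dynamics at evaluation at \<open>0\<close> and average over time. Since the
  telescoping sum of the increments stays bounded, the average is nearly annihilated by the
  generator. With steps of length \<open>h = 1/(100 + k)\<close> and \<open>h\<^bsup>-2\<^esup>\<close> of them, the total time \<open>1/h\<close>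
  tends to infinity, while the discretisation error of the average is of order \<open>h\<close>.\<close>

lemma positive_stationary_exists:
  assumes pos: "positive \<psi>" and \<psi>: "\<And>w. cmod (\<psi> w) \<le> 3 ^ length w"
  shows "\<exists>\<xi>. positive \<xi> \<and> \<xi> [] = 1 \<and> (\<forall>w. cmod (\<xi> w) \<le> (37/10) ^ length w) \<and> (\<forall>w. gen \<psi> \<xi> w = 0)"
proof -
  define f where "f k m = ((step (1 / (100 + real k)) \<psi>) ^^ m) (\<lambda>w. if w = [] then 1 else 0)" for k m
  define M where "M k = (100 + k)\<^sup>2" for k :: nat
  define \<xi> where "\<xi> k w = of_real (1 / real (M k)) * (\<Sum>m<M k. f k m w)" for k w
  have h: "0 \<le> 1 / (100 + real k)" "1 / (100 + real k) \<le> 1/100" for k by (auto simp: divide_simps)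
  have M: "M k > 0" for k by (simp add: M_def)
  have f_Suc: "f k (Suc m) = step (1 / (100 + real k)) \<psi> (f k m)" for k m by (simp add: f_def)
  have f_pos: "positive (f k m)" for k m
    by (induction m) (auto simp: f_Suc positive_step[OF pos] h, simp add: f_def positive_evaluation_0)
  have f_Nil: "f k m [] = 1" for k m
    by (induction m) (auto simp: f_Suc step_Nil, simp add: f_def)
  have f_le: "cmod (f k m w) \<le> (37/10) ^ length w" for k m w
  proof (induction m arbitrary: w)
    case (Suc m)
    show ?case unfolding f_Suc by (rule step_bound[OF h \<psi> Suc.IH])
  qed (simp add: f_def)
  have \<xi>_pos: "positive (\<xi> k)" for k
    unfolding \<xi>_def[abs_def] by (rule positive_sum) (auto simp: f_pos)
  have \<xi>_Nil: "\<xi> k [] = 1" for k using M[of k] by (simp add: \<xi>_def f_Nil)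
  have \<xi>_le: "cmod (\<xi> k w) \<le> (37/10) ^ length w" for k w
  proof -
    have "cmod (\<Sum>m<M k. f k m w) \<le> (\<Sum>m<M k. (37/10) ^ length w)"
      by (intro order.trans[OF norm_sum] sum_mono f_le)
    then show ?thesis using M[of k] by (simp add: \<xi>_def norm_mult norm_divide divide_simps mult.commute)
  qed
  have gen0: "(\<lambda>k. gen \<psi> (\<xi> k) w) \<longlonglongrightarrow> 0" for w
  proof -
    obtain C where C: "\<And>h \<psi> f. 0 \<le> h \<Longrightarrow> h \<le> 1/100 \<Longrightarrow> (\<And>w. cmod (\<psi> w) \<le> 3 ^ length w) \<Longrightarrow>
      (\<And>w. cmod (f w) \<le> (37/10) ^ length w) \<Longrightarrow>
      cmod (step h \<psi> f w - f w + of_real h * gen \<psi> f w) \<le> C * h\<^sup>2"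
      using step_generator[of w] by blast
    have bound: "cmod (gen \<psi> (\<xi> k) w) \<le> (2 * (37/10) ^ length w + C) / (100 + real k)" for k
    proof -
      let ?H = "100 + real k" and ?K = "(37/10 :: real) ^ length w"
      have C': "cmod (f k (Suc m) w - f k m w + of_real (1 / ?H) * gen \<psi> (f k m) w) \<le> C * (1 / ?H)\<^sup>2" for m
        unfolding f_Suc by (rule C[OF h \<psi> f_le])
      have "(\<Sum>m<M k. f k (Suc m) w - f k m w + of_real (1 / ?H) * gen \<psi> (f k m) w)
          = f k (M k) w - f k 0 w + of_real (1 / ?H) * (\<Sum>m<M k. gen \<psi> (f k m) w)"
        using sum_lessThan_telescope[of "\<lambda>m. f k m w" "M k"]
        by (simp add: sum.distrib sum_distrib_left)
      then have eq: "of_real (1 / ?H) * (\<Sum>m<M k. gen \<psi> (f k m) w)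
          = (\<Sum>m<M k. f k (Suc m) w - f k m w + of_real (1 / ?H) * gen \<psi> (f k m) w) - (f k (M k) w - f k 0 w)"
        by simp
      have "cmod (of_real (1 / ?H) * (\<Sum>m<M k. gen \<psi> (f k m) w)) \<le> (\<Sum>m<M k. C * (1 / ?H)\<^sup>2) + (?K + ?K)"
        unfolding eq
        by (intro order.trans[OF norm_triangle_ineq4] add_mono order.trans[OF norm_sum] sum_mono C' f_le)
      then have "cmod (\<Sum>m<M k. gen \<psi> (f k m) w) / ?H \<le> M k * (C * (1 / ?H)\<^sup>2) + 2 * ?K"
        by (simp add: norm_divide norm_mult del: of_real_add)
      also have "M k * (C * (1 / ?H)\<^sup>2) = C" by (simp add: M_def power_divide)
      finally have s: "cmod (\<Sum>m<M k. gen \<psi> (f k m) w) \<le> (C + 2 * ?K) * ?H" by (simp add: divide_simps)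
      have "cmod (gen \<psi> (\<xi> k) w) = cmod (\<Sum>m<M k. gen \<psi> (f k m) w) / real (M k)"
        unfolding \<xi>_def[abs_def] gen_linear by (simp add: norm_mult norm_divide)
      also have "\<dots> \<le> (C + 2 * ?K) * ?H / real (M k)" using s by (intro divide_right_mono) auto
      also have "\<dots> = (2 * ?K + C) / ?H" by (simp add: M_def power2_eq_square add.commute)
      finally show ?thesis .
    qed
    have "(\<lambda>k. (2 * (37/10) ^ length w + C) / (100 + real k)) \<longlonglongrightarrow> 0"
      by real_asymp
    then show ?thesis by (rule Lim_null_comparison[rotated]) (use bound in auto)
  qed
  obtain r g where r: "strict_mono r" and g: "\<And>w. (\<lambda>k. \<xi> (r k) w) \<longlonglongrightarrow> g w"
    using pointwise_convergent_subsequence[of \<xi>, OF \<xi>_le] by blast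
  have "positive g" by (rule positive_limit[OF \<xi>_pos g])
  moreover have "g [] = 1" using g[of "[]"] by (simp add: \<xi>_Nil LIMSEQ_const_iff)
  moreover have "cmod (g w) \<le> (37/10) ^ length w" for w
    by (rule Lim_norm_ubound[OF _ g]) (auto simp: \<xi>_le)
  moreover have "gen \<psi> g w = 0" for w
    using LIMSEQ_unique[OF gen_tendsto[OF g] LIMSEQ_subseq_LIMSEQ[OF gen0 r, unfolded o_def]] .
  ultimately show ?thesis by blast
qed

section \<open>Stationary functionals are positive\<close>

text \<open>A linear equation of the shape of \<open>gen_eq_0\<close> bounds the value at a word of length \<open>n + 1\<close> by a
  convolution over the lengths of the inner and outer words, plus \<open>1/20\<close> of the bound in degree
  \<open>n\<close>. It has the same form as the estimate for the recursion on words, although here all pairs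
  of letters contribute.\<close>

lemma stationary_estimate:
  fixes z :: complex and F :: "nat \<Rightarrow> nat \<Rightarrow> real" and E :: "nat \<Rightarrow> real"
  assumes eq: "of_nat (length w) * z = 2 * ssum w (\<lambda>x k y. ssum y (\<lambda>x' k' y'. H x k x' k' y'))
       - ssum w (\<lambda>x k y. \<Sum>u\<in>words_below N. d k u * e (x @ u @ y))"
    and F: "\<And>m l. F m l = F l m"
    and H: "\<And>x k x' k' y'. cmod (H x k x' k' y') \<le> F (length x') (length x + length y')"
    and e: "\<And>v. cmod (e v) \<le> E (length v)" and E: "\<And>l m. E (l + m) \<le> (19/5) ^ l * E m" "\<And>m. E m \<ge> 0"
    and n: "length w = Suc n"
  shows "cmod z \<le> (\<Sum>m<n. F m (n - 1 - m)) + E n / 20"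
proof -
  let ?n = "real (Suc n)"
  have 1: "2 * cmod (ssum w (\<lambda>x k y. ssum y (\<lambda>x' k' y'. H x k x' k' y'))) \<le> ?n * (\<Sum>m<n. F m (n - 1 - m))"
    using norm_ssum_pairs_le[of F H w, OF F H] n by simp
  have "cmod (ssum w (\<lambda>x k y. \<Sum>u\<in>words_below N. d k u * e (x @ u @ y))) \<le> (\<Sum>i<length w. E n / 20)"
  proof (rule norm_ssum_le[where f = "\<lambda>_ _. E n / 20"])
    fix x k y assume w: "w = x @ k # y"
    show "cmod (\<Sum>u\<in>words_below N. d k u * e (x @ u @ y)) \<le> E n / 20"
    proof (rule drift_sum_bound[OF d_small, where r = "19/5"])
      fix u
      have l: "length (x @ u @ y) = length u + n" using w n by simp
      show "cmod (e (x @ u @ y)) \<le> E n * (19/5) ^ length u"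
        using order.trans[OF e[of "x @ u @ y", unfolded l] E(1)] by (simp add: mult.commute)
    qed (use E in auto)
  qed
  then have 2: "cmod (ssum w (\<lambda>x k y. \<Sum>u\<in>words_below N. d k u * e (x @ u @ y))) \<le> ?n * (E n / 20)"
    using n by simp
  have "?n * cmod z = cmod (of_nat (length w) * z)" using n by (simp add: norm_mult del: of_nat_Suc)
  also have "\<dots> \<le> 2 * cmod (ssum w (\<lambda>x k y. ssum y (\<lambda>x' k' y'. H x k x' k' y')))
      + cmod (ssum w (\<lambda>x k y. \<Sum>u\<in>words_below N. d k u * e (x @ u @ y)))"
    unfolding eq by (rule order.trans[OF norm_triangle_ineq4]) (simp add: norm_mult)
  also have "\<dots> \<le> ?n * ((\<Sum>m<n. F m (n - 1 - m)) + E n / 20)" using 1 2 by (simp add: distrib_left)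
  finally show ?thesis by simp
qed

lemma gen_eq_0:
  assumes "gen \<psi> f w = 0"
  shows "of_nat (length w) * f w = 2 * noise_term \<psi> f [] w
     - ssum w (\<lambda>x k y. \<Sum>u\<in>words_below N. d k u * f (x @ u @ y))"
proof -
  have "ssum w (\<lambda>x k y. f (x @ k # y)) = ssum w (\<lambda>x k y. f w)" by (rule ssum_cong) auto
  also have "\<dots> = of_nat (length w) * f w" by (simp add: ssum_conv_sum)
  finally show ?thesis using assms by (simp add: gen_def drift_term_def ssum_add algebra_simps)
qed

lemma mixed_convolution_le:
  "(\<Sum>m<n. 3 ^ m * (37/10) ^ (n - 1 - m) + (37/10) ^ m * 3 ^ (n - 1 - m)) \<le> 20/7 * (37/10 :: real) ^ n"
  using geometric_convolution[of 3 "37/10" n] geometric_convolution'[of 3 "37/10" n]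
  by (simp add: sum.distrib)

text \<open>If \<open>\<psi>\<close> lies below the majorant and \<open>\<xi>\<close> exceeds it by at most \<open>\<delta> (37/10)\<^bsup>|w|\<^esup>\<close>, the stationary
  equation improves \<open>\<delta>\<close> by the factor \<open>9/10\<close>. So \<open>\<xi>\<close> lies below the majorant as well, and the
  construction can be repeated with \<open>\<xi>\<close> in place of \<open>\<psi>\<close>.\<close>

lemma stationary_le_om_step:
  assumes \<psi>: "\<And>w. cmod (\<psi> w) \<le> om (length w)" and gen: "\<And>w. gen \<psi> \<xi> w = 0"
    and Nil: "\<xi> [] = 1" and \<delta>: "\<delta> \<ge> 0"
    and le: "\<And>w. cmod (\<xi> w) \<le> om (length w) + \<delta> * (37/10) ^ length w"
  shows "cmod (\<xi> w) \<le> om (length w) + 9/10 * \<delta> * (37/10) ^ length w"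
proof (cases "length w")
  case 0
  then show ?thesis using Nil \<delta> by simp
next
  case (Suc n)
  let ?K = "37/10 :: real"
  define F where "F m l = om m * om l + \<delta> * (3 ^ m * ?K ^ l + ?K ^ m * 3 ^ l)" for m l
  have "cmod (\<xi> w) \<le> (\<Sum>m<n. F m (n - 1 - m)) + (om n + \<delta> * ?K ^ n) / 20"
  proof (rule stationary_estimate[OF gen_eq_0[OF gen, unfolded noise_term_def] _ _ le _ _ Suc])
    show "F m l = F l m" for m l by (simp add: F_def add.commute mult.commute)
    fix x k x' k' y'
    have "cmod (al k' k * \<psi> x' * \<xi> ([] @ x @ y')) \<le> 1 * om (length x') * (om (length (x @ y')) + \<delta> * ?K ^ length (x @ y'))"
      unfolding norm_mult append_Nil by (intro mult_mono al_le \<psi> le) auto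
    also have "\<dots> = om (length x') * om (length (x @ y')) + \<delta> * (om (length x') * ?K ^ length (x @ y'))"
      by (simp add: algebra_simps)
    also have "\<dots> \<le> F (length x') (length (x @ y'))"
    proof -
      have "om (length x') * ?K ^ length (x @ y') \<le> 3 ^ length x' * ?K ^ length (x @ y')"
        by (intro mult_right_mono om_le) auto
      also have "\<dots> \<le> 3 ^ length x' * ?K ^ length (x @ y') + ?K ^ length x' * 3 ^ length (x @ y')" by simp
      finally show ?thesis unfolding F_def using \<delta> by (intro add_mono mult_left_mono) auto
    qed
    finally show "cmod (al k' k * \<psi> x' * \<xi> ([] @ x @ y')) \<le> F (length x') (length x + length y')" by simp
  next
    fix l m
    have "om (l + m) \<le> (19/5) ^ l * om m"
      by (rule order.trans[OF om_add_le]) (intro mult_right_mono power_mono, auto)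
    moreover have "\<delta> * ?K ^ (l + m) \<le> (19/5) ^ l * (\<delta> * ?K ^ m)"
    proof -
      have "\<delta> * ?K ^ m * ?K ^ l \<le> \<delta> * ?K ^ m * (19/5) ^ l"
        using \<delta> by (intro mult_left_mono power_mono) auto
      then show ?thesis by (simp add: power_add mult_ac)
    qed
    ultimately show "om (l + m) + \<delta> * ?K ^ (l + m) \<le> (19/5) ^ l * (om m + \<delta> * ?K ^ m)"
      by (simp add: distrib_left)
  next
    show "om m + \<delta> * ?K ^ m \<ge> 0" for m using \<delta> by simp
  qed
  also have "(\<Sum>m<n. F m (n - 1 - m)) = (\<Sum>m<n. om m * om (n - 1 - m))
      + \<delta> * (\<Sum>m<n. 3 ^ m * ?K ^ (n - 1 - m) + ?K ^ m * 3 ^ (n - 1 - m))"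
    unfolding F_def sum.distrib sum_distrib_left[symmetric] by simp
  also have "\<dots> \<le> (om (Suc n) - om n / 20) + \<delta> * (20/7 * ?K ^ n)"
    using om_convolution[of n] \<delta> mixed_convolution_le[of n] by (intro add_mono mult_left_mono) auto
  also have "(om (Suc n) - om n / 20) + \<delta> * (20/7 * ?K ^ n) + (om n + \<delta> * ?K ^ n) / 20
      = om (Suc n) + (20/7 + 1/20) * (\<delta> * ?K ^ n)" by (simp add: field_simps)
  also have "\<dots> \<le> om (Suc n) + (9/10 * ?K) * (\<delta> * ?K ^ n)"
    using \<delta> by (intro add_mono mult_right_mono) auto
  finally show ?thesis using Suc by (simp add: mult_ac)
qed

lemma stationary_le_om:
  assumes \<psi>: "\<And>w. cmod (\<psi> w) \<le> om (length w)" and gen: "\<And>w. gen \<psi> \<xi> w = 0"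
    and Nil: "\<xi> [] = 1" and le: "\<And>w. cmod (\<xi> w) \<le> (37/10) ^ length w"
  shows "cmod (\<xi> w) \<le> om (length w)"
proof -
  have "cmod (\<xi> w) \<le> om (length w) + (9/10) ^ m * (37/10) ^ length w" for m w
  proof (induction m arbitrary: w)
    case 0
    show ?case using le[of w] add_mono[OF om_nonneg[of "length w"] le[of w]] by simp
  next
    case (Suc m)
    show ?case using stationary_le_om_step[OF \<psi> gen Nil _ Suc.IH, of w] by simp
  qed
  then have "cmod (\<xi> w) - om (length w) \<le> (37/10) ^ length w * (9/10) ^ m" for m
    by (simp add: algebra_simps)
  then have "cmod (\<xi> w) - om (length w) \<le> 0" by (rule le_zero_of_geometric) auto
  then show ?thesis by simp
qed

lemma stationary_contraction_step:
  assumes gen: "\<And>w. gen \<psi> \<xi> w = 0" "\<And>w. gen \<phi> \<phi> w = 0" and Nil: "\<xi> [] = 1" "\<phi> [] = 1"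
    and om: "\<And>w. cmod (\<psi> w) \<le> om (length w)" "\<And>w. cmod (\<phi> w) \<le> om (length w)"
    and \<delta>: "\<And>w. cmod (\<psi> w - \<phi> w) \<le> \<delta> * (37/10) ^ length w"
    and \<delta>': "\<And>w. cmod (\<xi> w - \<phi> w) \<le> \<delta> * (37/10) ^ length w"
  shows "cmod (\<xi> w - \<phi> w) \<le> 9/10 * \<delta> * (37/10) ^ length w"
proof (cases "length w")
  case 0
  have "\<delta> \<ge> 0" using order_trans[OF norm_ge_zero \<delta>[of "[]"]] by simp
  then show ?thesis using 0 Nil by simp
next
  case (Suc n)
  let ?K = "37/10 :: real"
  have \<delta>0: "\<delta> \<ge> 0" using order_trans[OF norm_ge_zero \<delta>[of "[]"]] by simp
  have b3: "cmod (\<psi> v) \<le> 3 ^ length v" "cmod (\<phi> v) \<le> 3 ^ length v" for v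
    using om[of v] om_le[of "length v"] by linarith+
  define F where "F m l = \<delta> * (3 ^ m * ?K ^ l + ?K ^ m * 3 ^ l)" for m l
  define e where "e v = \<xi> v - \<phi> v" for v
  define H where "H x k x' k' y' = al k' k * (\<psi> x' * e (x @ y') + (\<psi> x' - \<phi> x') * \<phi> (x @ y'))"
    for x k x' k' y'
  have eq: "of_nat (length w) * e w = 2 * ssum w (\<lambda>x k y. ssum y (\<lambda>x' k' y'. H x k x' k' y'))
      - ssum w (\<lambda>x k y. \<Sum>u\<in>words_below N. d k u * e (x @ u @ y))"
  proof -
    let ?S = "\<lambda>f. ssum w (\<lambda>x k y. \<Sum>u\<in>words_below N. d k u * f (x @ u @ y))"
    have A: "noise_term \<psi> \<xi> [] w - noise_term \<phi> \<phi> [] w = ssum w (\<lambda>x k y. ssum y (\<lambda>x' k' y'. H x k x' k' y'))"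
      unfolding noise_term_def ssum_diff[symmetric] by (simp add: H_def e_def algebra_simps)
    have B: "?S \<xi> - ?S \<phi> = ?S e"
      unfolding ssum_diff[symmetric] sum_subtractf[symmetric] by (simp add: e_def algebra_simps)
    have "of_nat (length w) * e w = (2 * noise_term \<psi> \<xi> [] w - ?S \<xi>) - (2 * noise_term \<phi> \<phi> [] w - ?S \<phi>)"
      unfolding e_def right_diff_distrib gen_eq_0[OF gen(1)] gen_eq_0[OF gen(2)] ..
    also have "\<dots> = 2 * (noise_term \<psi> \<xi> [] w - noise_term \<phi> \<phi> [] w) - (?S \<xi> - ?S \<phi>)"
      by (simp add: algebra_simps)
    finally show ?thesis unfolding A B .
  qed
  have "cmod (e w) \<le> (\<Sum>m<n. F m (n - 1 - m)) + (\<delta> * ?K ^ n) / 20"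
  proof (rule stationary_estimate[OF eq _ _ _ _ _ Suc])
    show "F m l = F l m" for m l by (simp add: F_def add.commute mult.commute)
    show "cmod (e v) \<le> \<delta> * ?K ^ length v" for v using \<delta>' by (simp add: e_def)
    show "\<delta> * ?K ^ m \<ge> 0" for m using \<delta>0 by simp
    fix x k x' k' y'
    have "cmod (H x k x' k' y') \<le> 1 * cmod (\<psi> x' * e (x @ y') + (\<psi> x' - \<phi> x') * \<phi> (x @ y'))"
      unfolding H_def norm_mult by (intro mult_right_mono al_le) auto
    also have "\<dots> \<le> cmod (\<psi> x') * cmod (e (x @ y')) + cmod (\<psi> x' - \<phi> x') * cmod (\<phi> (x @ y'))"
      using norm_triangle_ineq[of "\<psi> x' * e (x @ y')" "(\<psi> x' - \<phi> x') * \<phi> (x @ y')"] by (simp add: norm_mult)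
    also have "\<dots> \<le> 3 ^ length x' * (\<delta> * ?K ^ length (x @ y')) + (\<delta> * ?K ^ length x') * 3 ^ length (x @ y')"
      unfolding e_def by (intro add_mono mult_mono b3 \<delta> \<delta>') (use \<delta>0 in auto)
    also have "\<dots> = F (length x') (length x + length y')" by (simp add: F_def algebra_simps)
    finally show "cmod (H x k x' k' y') \<le> F (length x') (length x + length y')" .
  next
    fix l m
    have "\<delta> * ?K ^ m * ?K ^ l \<le> \<delta> * ?K ^ m * (19/5) ^ l"
      using \<delta>0 by (intro mult_left_mono power_mono) auto
    then show "\<delta> * ?K ^ (l + m) \<le> (19/5) ^ l * (\<delta> * ?K ^ m)" by (simp add: power_add mult_ac)
  qed
  also have "(\<Sum>m<n. F m (n - 1 - m)) = \<delta> * (\<Sum>m<n. 3 ^ m * ?K ^ (n - 1 - m) + ?K ^ m * 3 ^ (n - 1 - m))"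
    by (simp add: F_def sum_distrib_left)
  also have "\<dots> \<le> \<delta> * (20/7 * ?K ^ n)"
    using \<delta>0 mixed_convolution_le[of n] by (intro mult_left_mono) auto
  also have "\<delta> * (20/7 * ?K ^ n) + (\<delta> * ?K ^ n) / 20 = (20/7 + 1/20) * (\<delta> * ?K ^ n)" by (simp add: algebra_simps)
  also have "\<dots> \<le> (9/10 * ?K) * (\<delta> * ?K ^ n)" using \<delta>0 by (intro mult_right_mono) auto
  finally show ?thesis using Suc by (simp add: e_def mult_ac)
qed

text \<open>\<open>\<xi>\<close> occurs on both sides of its equation, so the estimate first yields \<open>9/10\<close> times the maximum
  of the distances of \<open>\<psi>\<close> and of \<open>\<xi>\<close> from \<open>\<phi>\<close>; iterating it \<open>m\<close> times makes the contribution of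
  \<open>\<xi>\<close> negligible.\<close>

lemma stationary_contraction:
  assumes gen: "\<And>w. gen \<psi> \<xi> w = 0" "\<And>w. gen \<phi> \<phi> w = 0" and Nil: "\<xi> [] = 1" "\<phi> [] = 1"
    and om: "\<And>w. cmod (\<psi> w) \<le> om (length w)" "\<And>w. cmod (\<phi> w) \<le> om (length w)" "\<And>w. cmod (\<xi> w) \<le> om (length w)"
    and \<delta>: "\<And>w. cmod (\<psi> w - \<phi> w) \<le> \<delta> * (37/10) ^ length w"
  shows "cmod (\<xi> w - \<phi> w) \<le> max (9/10 * \<delta>) (2 * (9/10) ^ m) * (37/10) ^ length w"
proof (induction m arbitrary: w)
  case 0
  have "cmod (\<xi> w - \<phi> w) \<le> om (length w) + om (length w)"
    by (intro order.trans[OF norm_triangle_ineq4] add_mono om)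
  also have "\<dots> \<le> 2 * 3 ^ length w" using om_le[of "length w"] by simp
  also have "\<dots> \<le> max (9/10 * \<delta>) 2 * (37/10) ^ length w" by (intro mult_mono power_mono) auto
  finally show ?case by simp
next
  case (Suc m)
  define \<epsilon> where "\<epsilon> = max \<delta> (2 * (9/10) ^ m)"
  have \<delta>0: "\<delta> \<ge> 0" using order_trans[OF norm_ge_zero \<delta>[of "[]"]] by simp
  have "cmod (\<xi> w - \<phi> w) \<le> 9/10 * \<epsilon> * (37/10) ^ length w"
  proof (rule stationary_contraction_step[OF gen Nil om(1,2)])
    show "cmod (\<psi> v - \<phi> v) \<le> \<epsilon> * (37/10) ^ length v" for v
      by (rule order.trans[OF \<delta>]) (auto simp: \<epsilon>_def intro!: mult_right_mono)
    show "cmod (\<xi> v - \<phi> v) \<le> \<epsilon> * (37/10) ^ length v" for v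
      by (rule order.trans[OF Suc.IH]) (use \<delta>0 in \<open>auto simp: \<epsilon>_def intro!: mult_right_mono\<close>)
  qed
  also have "9/10 * \<epsilon> = max (9/10 * \<delta>) (2 * (9/10) ^ Suc m)" by (simp add: \<epsilon>_def max_def)
  finally show ?case .
qed

text \<open>The iteration \<open>\<psi> \<mapsto> \<xi>\<close> stays within the positive functionals below the majorant and approaches
  \<open>\<phi>\<close> geometrically.\<close>

theorem stationary_positive:
  assumes gen: "\<And>w. gen \<phi> \<phi> w = 0" and Nil: "\<phi> [] = 1" and om: "\<And>w. cmod (\<phi> w) \<le> om (length w)"
  shows "positive \<phi>"
proof -
  have ex: "\<exists>\<psi>. positive \<psi> \<and> (\<forall>w. cmod (\<psi> w) \<le> om (length w)) \<and> (\<forall>w. cmod (\<psi> w - \<phi> w) \<le> 2 * (9/10) ^ m * (37/10) ^ length w)" for m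
  proof (induction m)
    case 0
    let ?\<psi> = "\<lambda>w. if w = [] then 1 else (0 :: complex)"
    have b: "cmod (?\<psi> w) \<le> om (length w)" for w by auto
    have "cmod (?\<psi> w - \<phi> w) \<le> 2 * (37/10) ^ length w" for w
    proof -
      have "cmod (?\<psi> w - \<phi> w) \<le> om (length w) + om (length w)"
        by (intro order.trans[OF norm_triangle_ineq4] add_mono om b)
      also have "\<dots> \<le> 2 * 3 ^ length w" using om_le[of "length w"] by simp
      also have "\<dots> \<le> 2 * (37/10) ^ length w" by (intro mult_left_mono power_mono) auto
      finally show ?thesis .
    qed
    then show ?case using positive_evaluation_0 b by (intro exI[of _ ?\<psi>]) auto
  next
    case (Suc m)
    then obtain \<psi> where \<psi>: "positive \<psi>" "\<And>w. cmod (\<psi> w) \<le> om (length w)"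
      "\<And>w. cmod (\<psi> w - \<phi> w) \<le> 2 * (9/10) ^ m * (37/10) ^ length w" by blast
    have \<psi>3: "cmod (\<psi> w) \<le> 3 ^ length w" for w using \<psi>(2)[of w] om_le[of "length w"] by linarith
    obtain \<xi> where \<xi>: "positive \<xi>" "\<xi> [] = 1" "\<And>w. cmod (\<xi> w) \<le> (37/10) ^ length w" "\<And>w. gen \<psi> \<xi> w = 0"
      using positive_stationary_exists[OF \<psi>(1) \<psi>3] by blast
    have \<xi>om: "cmod (\<xi> w) \<le> om (length w)" for w by (rule stationary_le_om[OF \<psi>(2) \<xi>(4,2,3)])
    have "cmod (\<xi> w - \<phi> w) \<le> max (9/10 * (2 * (9/10) ^ m)) (2 * (9/10) ^ Suc m) * (37/10) ^ length w" for w
      by (rule stationary_contraction[OF \<xi>(4) gen \<xi>(2) Nil \<psi>(2) om \<xi>om \<psi>(3)])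
    then have "cmod (\<xi> w - \<phi> w) \<le> 2 * (9/10) ^ Suc m * (37/10) ^ length w" for w by simp
    with \<xi>(1) \<xi>om show ?case by blast
  qed
  then obtain \<psi> where \<psi>: "\<And>m. positive (\<psi> m)"
    "\<And>m w. cmod (\<psi> m w - \<phi> w) \<le> 2 * (9/10) ^ m * (37/10) ^ length w" by metis
  show ?thesis
  proof (rule positive_limit[OF \<psi>(1)])
    fix w :: "'n list"
    have "(\<lambda>m. 2 * (9/10) ^ m * (37/10 :: real) ^ length w) \<longlonglongrightarrow> 2 * 0 * (37/10) ^ length w"
      by (intro tendsto_intros LIMSEQ_realpow_zero) auto
    then have lim: "(\<lambda>m. 2 * (9/10) ^ m * (37/10 :: real) ^ length w) \<longlonglongrightarrow> 0" by simp
    have "(\<lambda>m. \<psi> m w - \<phi> w) \<longlonglongrightarrow> 0"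
      by (rule Lim_null_comparison[OF always_eventually lim]) (rule allI, rule \<psi>(2))
    then show "(\<lambda>m. \<psi> m w) \<longlonglongrightarrow> \<phi> w" by (simp add: LIM_zero_iff)
  qed
qed

end

locale gibbs_drift = kms_drift al A d N + positive_drift al d N
  for al A :: "'n::finite \<Rightarrow> 'n \<Rightarrow> complex" and d N
begin

lemma positive_sol: "positive sol"
proof (rule stationary_positive[OF _ sol_Nil sol_le_om])
  show "gen sol sol w = 0" for w
    using sol_stationary[of w] by (simp add: gen_def drift_term_def noise_term_def mult.assoc)
qed

end

section \<open>Invariant potentials\<close>

lemma rotate_block:
  fixes A :: "'n::finite \<Rightarrow> 'n \<Rightarrow> complex"
  assumes "\<And>m u. W (m # u) = (\<Sum>k\<in>UNIV. A k m * W (u @ [k]))"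
  shows "W (x @ z) = (\<Sum>y\<in>words (length x). tw A x y * W (z @ y))"
proof (induction x arbitrary: z)
  case (Cons m x)
  have "W ((m # x) @ z) = (\<Sum>k\<in>UNIV. A k m * W (x @ (z @ [k])))" using assms[of m "x @ z"] by simp
  also have "\<dots> = (\<Sum>k\<in>UNIV. \<Sum>y\<in>words (length x). tw A (m # x) (k # y) * W (z @ k # y))"
    unfolding Cons.IH by (simp add: sum_distrib_left mult_ac)
  finally show ?case by (simp add: sum_words_Suc)
qed simp

locale kms_covariance =
  fixes al A :: "'n::finite \<Rightarrow> 'n \<Rightarrow> complex"
  assumes A_orth: "(\<Sum>x\<in>UNIV. A b x * A y x) = (if b = y then 1 else 0)"
    and al_flip: "al j k = (\<Sum>m\<in>UNIV. al k m * A m j)"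
    and al_flip': "al j k = (\<Sum>m\<in>UNIV. A k m * al m j)"
    and al_comm: "(\<Sum>k\<in>UNIV. al j k * A m k) = (\<Sum>k\<in>UNIV. A k j * al k m)"
    and al_le: "cmod (al j k) \<le> 1"
    and al_herm: "cnj (al j k) = al k j"
    and al_psd: "psd_on UNIV (\<lambda>k l. al l k)"

text \<open>\<open>W_rot\<close> is the invariance \<open>\<rho>(W) = W\<close>, and \<open>d\<close> is the cyclic gradient of \<open>W\<close>.\<close>

locale kms_potential = kms_covariance al A
  for al A :: "'n::finite \<Rightarrow> 'n \<Rightarrow> complex" +
  fixes W :: "'n ncps" and d :: "'n \<Rightarrow> 'n ncps"
  assumes W_rot: "W (m # u) = (\<Sum>k\<in>UNIV. A k m * W (u @ [k]))"
    and W_sa: "W (rev w) = cnj (W w)"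
    and d_def: "d j u = of_nat (Suc (length u)) * (\<Sum>k\<in>UNIV. al j k * W (u @ [k]))"
    and d_small: "small_drift d"
begin

lemma tw_orth:
  "length b = n \<Longrightarrow> length y = n \<Longrightarrow> (\<Sum>x\<in>words n. tw A x b * tw A x y) = (if b = y then 1 else 0)"
proof (induction n arbitrary: b y)
  case (Suc n)
  obtain b0 b' y0 y' where bb: "b = b0 # b'" "y = y0 # y'" "length b' = n" "length y' = n"
    using Suc.prems by (metis length_Suc_conv)
  have "(\<Sum>x\<in>words (Suc n). tw A x b * tw A x y)
      = (\<Sum>j\<in>UNIV. A b0 j * A y0 j) * (\<Sum>x\<in>words n. tw A x b' * tw A x y')"
    by (simp add: sum_words_Suc bb sum_product mult_ac)
  also have "\<dots> = (if b = y then 1 else 0)" using Suc.IH[OF bb(3,4)] by (simp add: A_orth bb)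
  finally show ?case .
qed simp

lemmas W_rotate = rotate_block[of W, OF W_rot]

lemma W_rotate_back: "(\<Sum>x\<in>words (length b). tw A x b * W (x @ z)) = W (z @ b)"
proof -
  have "(\<Sum>x\<in>words (length b). tw A x b * W (x @ z))
      = (\<Sum>x\<in>words (length b). \<Sum>y\<in>words (length b). tw A x b * tw A x y * W (z @ y))"
    by (intro sum.cong refl, subst W_rotate) (simp add: words_def sum_distrib_left mult_ac)
  also have "\<dots> = (\<Sum>y\<in>words (length b). (\<Sum>x\<in>words (length b). tw A x b * tw A x y) * W (z @ y))"
    by (subst sum.swap) (simp add: sum_distrib_right)
  also have "\<dots> = (\<Sum>y\<in>words (length b). if b = y then W (z @ y) else 0)"
    by (intro sum.cong refl, subst tw_orth) (auto simp: words_def)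
  also have "\<dots> = (if b \<in> words (length b) then W (z @ b) else 0)"
    by (rule sum.delta') simp
  also have "\<dots> = W (z @ b)" by (simp add: words_def)
  finally show ?thesis .
qed

lemma drift_cov: "(\<Sum>m\<in>UNIV. A m j * d m u) = (\<Sum>v\<in>words (length u). d j v * tw A v u)"
proof -
  let ?n = "of_nat (Suc (length u)) :: complex"
  have "(\<Sum>v\<in>words (length u). d j v * tw A v u)
      = (\<Sum>v\<in>words (length u). \<Sum>k\<in>UNIV. ?n * al j k * (tw A v u * W (v @ [k])))"
    by (intro sum.cong refl) (simp add: d_def words_def sum_distrib_left sum_distrib_right mult_ac del: of_nat_Suc)
  also have "\<dots> = (\<Sum>k\<in>UNIV. ?n * al j k * (\<Sum>v\<in>words (length u). tw A v u * W (v @ [k])))"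
    by (subst sum.swap) (simp add: sum_distrib_left)
  also have "\<dots> = (\<Sum>k\<in>UNIV. \<Sum>m\<in>UNIV. ?n * (al j k * A m k) * W (u @ [m]))"
    unfolding W_rotate_back by (simp add: W_rot sum_distrib_left mult_ac del: of_nat_Suc)
  also have "\<dots> = (\<Sum>m\<in>UNIV. ?n * (\<Sum>k\<in>UNIV. al j k * A m k) * W (u @ [m]))"
    by (subst sum.swap) (simp add: sum_distrib_left sum_distrib_right del: of_nat_Suc)
  also have "\<dots> = (\<Sum>m\<in>UNIV. \<Sum>k\<in>UNIV. A k j * (?n * (al k m * W (u @ [m]))))"
    unfolding al_comm by (simp add: sum_distrib_left sum_distrib_right mult_ac del: of_nat_Suc)
  also have "\<dots> = (\<Sum>k\<in>UNIV. A k j * d k u)"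
    by (subst sum.swap) (simp add: d_def sum_distrib_left del: of_nat_Suc)
  finally show ?thesis ..
qed

text \<open>Both sides are second derivatives of \<open>W\<close>, evaluated at the word \<open>a k b l\<close> and at its rotation
  \<open>c l a k\<close>. The rotation moves \<open>b l\<close> to the front; the twist of \<open>l\<close> is absorbed into the
  covariance by \<open>al_flip\<close>.\<close>

lemma drift_hess:
  "(\<Sum>k\<in>UNIV. al j k * d i (a @ k # b))
     = (\<Sum>c\<in>words (length b). tw A c b * (\<Sum>k\<in>UNIV. al k i * d j (c @ k # a)))"
proof -
  let ?n = "of_nat (Suc (length a + Suc (length b))) :: complex"
  have 1: "(\<Sum>l\<in>UNIV. al i l * W (a @ k # b @ [l]))
      = (\<Sum>l\<in>UNIV. al l i * (\<Sum>c\<in>words (length b). tw A c b * W (c @ l # a @ [k])))" for k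
  proof -
    have "W (a @ k # b @ [l]) = (\<Sum>m\<in>UNIV. A l m * (\<Sum>c\<in>words (length b). tw A c b * W (c @ m # a @ [k])))" for l
    proof -
      have "W ((a @ [k]) @ (b @ [l])) = (\<Sum>x\<in>words (length (b @ [l])). tw A x (b @ [l]) * W (x @ (a @ [k])))"
        by (rule W_rotate_back[symmetric])
      also have "\<dots> = (\<Sum>c\<in>words (length b). \<Sum>m\<in>UNIV. A l m * (tw A c b * W (c @ m # a @ [k])))"
        by (simp add: sum_words_Suc') (intro sum.cong refl, simp add: words_def tw_snoc)
      finally show ?thesis by (subst (asm) sum.swap) (simp add: sum_distrib_left)
    qed
    then have "(\<Sum>l\<in>UNIV. al i l * W (a @ k # b @ [l]))
        = (\<Sum>l\<in>UNIV. \<Sum>m\<in>UNIV. al i l * A l m * (\<Sum>c\<in>words (length b). tw A c b * W (c @ m # a @ [k])))"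
      by (simp add: sum_distrib_left mult.assoc)
    also have "\<dots> = (\<Sum>m\<in>UNIV. (\<Sum>l\<in>UNIV. al i l * A l m) * (\<Sum>c\<in>words (length b). tw A c b * W (c @ m # a @ [k])))"
      by (subst sum.swap) (simp add: sum_distrib_right)
    finally show ?thesis by (simp add: al_flip[symmetric])
  qed
  have "(\<Sum>k\<in>UNIV. al j k * d i (a @ k # b))
      = (\<Sum>k\<in>UNIV. ?n * al j k * (\<Sum>l\<in>UNIV. al i l * W (a @ k # b @ [l])))"
    by (simp add: d_def mult_ac del: of_nat_Suc)
  also have "\<dots> = (\<Sum>k\<in>UNIV. \<Sum>l\<in>UNIV. \<Sum>c\<in>words (length b). ?n * al j k * al l i * tw A c b * W (c @ l # a @ [k]))"
    unfolding 1 by (simp add: sum_distrib_left mult_ac del: of_nat_Suc)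
  also have "\<dots> = (\<Sum>l\<in>UNIV. \<Sum>c\<in>words (length b). \<Sum>k\<in>UNIV. ?n * al j k * al l i * tw A c b * W (c @ l # a @ [k]))"
    by (rule trans[OF sum.swap]) (intro sum.cong refl sum.swap)
  also have "\<dots> = (\<Sum>c\<in>words (length b). \<Sum>l\<in>UNIV. \<Sum>k\<in>UNIV. ?n * al j k * al l i * tw A c b * W (c @ l # a @ [k]))"
    by (rule sum.swap)
  also have "\<dots> = (\<Sum>c\<in>words (length b). tw A c b * (\<Sum>k\<in>UNIV. al k i * d j (c @ k # a)))"
    by (intro sum.cong refl)
       (simp add: d_def words_def sum_distrib_left mult_ac add.commute del: of_nat_Suc)
  finally show ?thesis .
qed

lemma drift_sa: "d j (rev u) = cnj (d j u)"
proof -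
  have "cnj (\<Sum>k\<in>UNIV. al j k * W (u @ [k])) = (\<Sum>k\<in>UNIV. al k j * W (k # rev u))"
    by (simp add: al_herm flip: W_sa)
  also have "\<dots> = (\<Sum>k\<in>UNIV. \<Sum>m\<in>UNIV. A m k * al k j * W (rev u @ [m]))"
    by (simp add: W_rot sum_distrib_left mult_ac)
  also have "\<dots> = (\<Sum>m\<in>UNIV. al j m * W (rev u @ [m]))"
    by (subst sum.swap) (simp add: al_flip'[of j] sum_distrib_right)
  finally show ?thesis by (simp add: d_def del: of_nat_Suc)
qed

text \<open>Truncation by degree keeps the covariance and the symmetry of the drift, since these relate
  words of the same length.\<close>

definition drift_below :: "nat \<Rightarrow> 'n \<Rightarrow> 'n ncps" where
  "drift_below N j u = (if length u < N then d j u else 0)"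

lemma drift_below_small: "small_drift (drift_below N)"
  unfolding small_drift_def
proof (intro allI conjI)
  fix j
  have le: "cmod (drift_below N j u) * (19/5) ^ length u \<le> cmod (d j u) * (19/5) ^ length u" for u by (simp add: drift_below_def)
  have s: "(\<lambda>u. cmod (d j u) * (19/5) ^ length u) summable_on UNIV"
    and b: "(\<Sum>\<^sub>\<infinity>u. cmod (d j u) * (19/5) ^ length u) \<le> 1/20" using d_small by (auto simp: small_drift_def)
  show s': "(\<lambda>u. cmod (drift_below N j u) * (19/5) ^ length u) summable_on UNIV"
    by (rule summable_on_comparison_test[OF s]) (use le in auto)
  have "(\<Sum>\<^sub>\<infinity>u. cmod (drift_below N j u) * (19/5) ^ length u) \<le> (\<Sum>\<^sub>\<infinity>u. cmod (d j u) * (19/5) ^ length u)"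
    by (intro infsum_mono s s' le)
  then show "(\<Sum>\<^sub>\<infinity>u. cmod (drift_below N j u) * (19/5) ^ length u) \<le> 1/20" using b by simp
qed

lemma gibbs_drift_below: "gibbs_drift al A (drift_below N) N"
proof
  show "(\<Sum>m\<in>UNIV. A m j * drift_below N m u) = (\<Sum>v\<in>words (length u). drift_below N j v * tw A v u)" for j u
  proof -
    have "(\<Sum>v\<in>words (length u). drift_below N j v * tw A v u) = (\<Sum>v\<in>words (length u). if length u < N then d j v * tw A v u else 0)"
      by (intro sum.cong refl) (auto simp: words_def drift_below_def)
    also have "\<dots> = (if length u < N then \<Sum>m\<in>UNIV. A m j * d m u else 0)"
      by (simp add: drift_cov)
    finally show ?thesis by (simp add: drift_below_def)
  qed
  show "(\<Sum>k\<in>UNIV. al j k * drift_below N i (a @ k # b))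
     = (\<Sum>c\<in>words (length b). tw A c b * (\<Sum>k\<in>UNIV. al k i * drift_below N j (c @ k # a)))" for j i a b
  proof -
    have "(\<Sum>c\<in>words (length b). tw A c b * (\<Sum>k\<in>UNIV. al k i * drift_below N j (c @ k # a)))
        = (\<Sum>c\<in>words (length b). if Suc (length a + length b) < N then tw A c b * (\<Sum>k\<in>UNIV. al k i * d j (c @ k # a)) else 0)"
      by (intro sum.cong refl) (auto simp: words_def drift_below_def add.commute)
    also have "\<dots> = (if Suc (length a + length b) < N then \<Sum>k\<in>UNIV. al j k * d i (a @ k # b) else 0)"
      by (simp add: drift_hess)
    finally show ?thesis by (simp add: drift_below_def)
  qed
qed (simp_all add: al_le al_herm al_psd drift_below_small al_flip[symmetric] drift_below_def drift_sa)

text \<open>A limit point of the solutions for the truncated drifts. The limit may be taken inside the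
  infinite sum over the drift because the values grow like \<open>3\<^bsup>|u|\<^esup>\<close> and \<open>d\<close> is summable with the
  weights \<open>(19/5)\<^bsup>|u|\<^esup>\<close>, so that the tail beyond length \<open>M\<close> is at most of order \<open>(15/19)\<^bsup>M\<^esup>\<close>,
  uniformly in the truncation.\<close>

theorem gibbs_state_exists: "\<exists>\<phi>. sd_word al d \<phi> \<and> positive \<phi> \<and> (\<forall>w. cmod (\<phi> w) \<le> 3 ^ length w)"
proof -
  have "\<exists>\<phi>. sd_word al (drift_below N) \<phi> \<and> positive \<phi> \<and> (\<forall>w. cmod (\<phi> w) \<le> 3 ^ length w)" for N
  proof -
    interpret G: gibbs_drift al A "drift_below N" N by (rule gibbs_drift_below)
    have "cmod (G.sol w) \<le> 3 ^ length w" for w using G.sol_le_om[of w] om_le[of "length w"] by linarith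
    then show ?thesis using G.sd_word_sol G.positive_sol by blast
  qed
  then obtain \<psi> where \<psi>: "\<And>N. sd_word al (drift_below N) (\<psi> N)" "\<And>N. positive (\<psi> N)"
    "\<And>N w. cmod (\<psi> N w) \<le> 3 ^ length w" by metis
  obtain r \<phi> where r: "strict_mono r" and lim: "\<And>w. (\<lambda>k. \<psi> (r k) w) \<longlonglongrightarrow> \<phi> w"
    using pointwise_convergent_subsequence[of \<psi>, OF \<psi>(3)] by blast
  have pos: "positive \<phi>" by (rule positive_limit[OF \<psi>(2) lim])
  have b: "cmod (\<phi> w) \<le> 3 ^ length w" for w
    by (rule Lim_norm_ubound[OF _ lim]) (auto simp: \<psi>(3))
  have "sd_word al d \<phi>" unfolding sd_word_def
  proof (intro conjI allI)
    show "\<phi> [] = 1" using lim[of "[]"] \<psi>(1) by (simp add: sd_word_def LIMSEQ_const_iff)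
    fix j w
    define S where "S f = ssum w (\<lambda>a k b. al k j * f a * f b) - f (j # w)" for f
    have tail: "cmod (s - (\<Sum>u\<in>words_below M. dd j u * f (u @ w))) \<le> 3 ^ length w * (15/19) ^ M / 20"
      if dd: "small_drift dd" and f: "\<And>v. cmod (f v) \<le> 3 ^ length v"
        and s: "((\<lambda>u. dd j u * f (u @ w)) has_sum s) UNIV" for M s f and dd :: "'n \<Rightarrow> 'n ncps"
    proof (rule small_drift_has_sum_bound[OF dd, where r = "19/5"])
      have "((\<lambda>u. if length u < M then dd j u * f (u @ w) else 0) has_sum
          (\<Sum>u\<in>words_below M. dd j u * f (u @ w))) UNIV"
        by (rule has_sum_cong_neutral[THEN iffD1, OF _ _ _ has_sum_finite[OF finite_words_below]])
           (auto simp: words_below_def)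
      from has_sum_diff[OF s this]
      show "((\<lambda>u. dd j u * (if length u < M then 0 else f (u @ w))) has_sum
          (s - (\<Sum>u\<in>words_below M. dd j u * f (u @ w)))) UNIV"
        by (rule has_sum_cong[THEN iffD1, rotated]) auto
      fix u :: "'n list"
      have "(15/19 :: real) ^ length u \<le> (15/19) ^ M" if "length u \<ge> M" using that by (intro power_decreasing) auto
      then have "3 ^ length w * ((15/19) ^ length u * (19/5) ^ length u) \<le> 3 ^ length w * ((15/19 :: real) ^ M * (19/5) ^ length u)"
        if "length u \<ge> M" using that by (intro mult_left_mono mult_right_mono) auto
      moreover have "3 ^ length w * ((15/19) ^ length u * (19/5) ^ length u) = (3 :: real) ^ length (u @ w)"
        by (simp add: power_add flip: power_mult_distrib)
      ultimately show "cmod (if length u < M then 0 else f (u @ w)) \<le> 3 ^ length w * (15/19) ^ M * (19/5) ^ length u"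
        using f[of "u @ w"] by (auto simp: mult.assoc intro: order.trans)
    qed auto
    have sm: "(\<lambda>u. d j u * \<phi> (u @ w)) summable_on UNIV"
    proof (rule abs_summable_summable)
      have "(\<lambda>u. 3 ^ length w * (cmod (d j u) * 3 ^ length u)) summable_on UNIV"
        by (intro summable_on_cmult_right small_drift_sum[OF d_small]) auto
      then show "(\<lambda>u. cmod (d j u * \<phi> (u @ w))) summable_on UNIV"
      proof (rule summable_on_comparison_test)
        show "cmod (d j u * \<phi> (u @ w)) \<le> 3 ^ length w * (cmod (d j u) * 3 ^ length u)" for u
          using mult_left_mono[OF b[of "u @ w"], of "cmod (d j u)"] by (simp add: norm_mult power_add mult_ac)
      qed auto
    qed
    then obtain s where s: "((\<lambda>u. d j u * \<phi> (u @ w)) has_sum s) UNIV" by (auto simp: summable_on_def)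
    have "cmod (S \<phi> - (\<Sum>u\<in>words_below M. d j u * \<phi> (u @ w))) \<le> 3 ^ length w * (15/19) ^ M / 20" for M
    proof (rule Lim_norm_ubound[of sequentially])
      show "(\<lambda>k. S (\<psi> (r k)) - (\<Sum>u\<in>words_below M. d j u * \<psi> (r k) (u @ w)))
           \<longlonglongrightarrow> S \<phi> - (\<Sum>u\<in>words_below M. d j u * \<phi> (u @ w))"
        unfolding S_def ssum_conv_sum by (intro tendsto_intros lim)
      show "\<forall>\<^sub>F k in sequentially. cmod (S (\<psi> (r k)) - (\<Sum>u\<in>words_below M. d j u * \<psi> (r k) (u @ w)))
          \<le> 3 ^ length w * (15/19) ^ M / 20"
        using eventually_ge_at_top[of M]
      proof eventually_elim
        case (elim k)
        then have "M \<le> r k" using seq_suble[OF r, of k] by linarith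
        then have "(\<Sum>u\<in>words_below M. drift_below (r k) j u * \<psi> (r k) (u @ w)) = (\<Sum>u\<in>words_below M. d j u * \<psi> (r k) (u @ w))"
          by (intro sum.cong refl) (auto simp: drift_below_def words_below_def)
        then show ?case
          using tail[where dd = "drift_below (r k)" and f = "\<psi> (r k)" and s = "S (\<psi> (r k))" and M = M, OF drift_below_small \<psi>(3)] \<psi>(1)[of "r k"]
          by (simp add: S_def sd_word_def)
      qed
    qed simp
    then have "cmod (S \<phi> - s) \<le> 3 ^ length w * (15/19) ^ M / 20 + 3 ^ length w * (15/19) ^ M / 20" for M
      by (rule norm_diff_bound[OF tail[OF d_small b s, of M]]) simp
    then have "cmod (S \<phi> - s) \<le> 3 ^ length w / 10 * (15/19) ^ M" for M
      by (simp add: field_simps)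
    then have "cmod (S \<phi> - s) \<le> 0" by (rule le_zero_of_geometric) auto
    then have "S \<phi> = s" by simp
    with s show "((\<lambda>u. d j u * \<phi> (u @ w)) has_sum (ssum w (\<lambda>a k b. al k j * \<phi> a * \<phi> b) - \<phi> (j # w))) UNIV"
      by (simp add: S_def)
  qed
  with pos b show ?thesis by blast
qed

end

section \<open>The matrix and its covariance\<close>

text \<open>The entries of \<open>A\<close> for integer indices. Here the dependence on \<open>\<lambda>\<close> is multiplicative: the blocks
  are rotations by the imaginary angle \<open>i log \<lambda>\<close>, so products, inverses, transposes and square
  roots of such matrices are of the same form.\<close>

definition block_entry :: "nat \<Rightarrow> (nat \<Rightarrow> real) \<Rightarrow> nat \<Rightarrow> nat \<Rightarrow> complex" where
  "block_entry L lam p q =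
     (let k = p div 2; l = complex_of_real (lam k) in
     if k < L \<and> q div 2 = k then
       (if p = q then (l + inverse l) / 2
        else if p < q then - \<i> * (l - inverse l) / 2
        else \<i> * (l - inverse l) / 2)
     else if p = q then 1 else 0)"

lemma modular_matrix_entry: "modular_matrix idx L lam $ a $ b = block_entry L lam (idx a) (idx b)"
  by (simp add: modular_matrix_def block_entry_def Let_def)

lemma block_entry_outside: "\<not> p div 2 < L \<Longrightarrow> block_entry L lam p q = (if p = q then 1 else 0)"
  by (simp add: block_entry_def)

lemma block_entry_inside:
  fixes lam :: "nat \<Rightarrow> real"
  assumes "k < L"
  defines "l \<equiv> complex_of_real (lam k)"
  shows "block_entry L lam (2 * k) (2 * k) = (l + inverse l) / 2"
    "block_entry L lam (Suc (2 * k)) (Suc (2 * k)) = (l + inverse l) / 2"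
    "block_entry L lam (2 * k) (Suc (2 * k)) = - \<i> * (l - inverse l) / 2"
    "block_entry L lam (Suc (2 * k)) (2 * k) = \<i> * (l - inverse l) / 2"
  using assms by (simp_all add: block_entry_def Let_def)

lemma block_entry_different: "p div 2 \<noteq> q div 2 \<Longrightarrow> block_entry L lam p q = 0"
  by (auto simp: block_entry_def Let_def)

definition pair_entry :: "complex \<Rightarrow> nat \<Rightarrow> nat \<Rightarrow> complex" where
  "pair_entry l p q = (if p = q then (l + inverse l) / 2
     else if p < q then - \<i> * (l - inverse l) / 2 else \<i> * (l - inverse l) / 2)"

lemma block_entry_eq:
  "block_entry L lam p q = (if p div 2 < L \<and> q div 2 = p div 2 then pair_entry (of_real (lam (p div 2))) p q
     else if p = q then 1 else 0)"
  unfolding block_entry_def pair_entry_def Let_def ..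

lemma pair_entry_swap: "pair_entry l q p = pair_entry (inverse l) p q"
  by (rule linorder_cases[of p q]) (simp_all add: pair_entry_def add.commute algebra_simps)

lemma pair_entry_cnj: "pair_entry (of_real x) q p = cnj (pair_entry (of_real x) p q)"
  by (rule linorder_cases[of p q]) (simp_all add: pair_entry_def)

lemma pair_entry_1: "pair_entry 1 p q = (if p = q then 1 else 0)"
  by (simp add: pair_entry_def)

lemma pair_entry_add: "pair_entry l p q + pair_entry l q p = (if p = q then l + inverse l else 0)"
  by (rule linorder_cases[of p q]) (simp_all add: pair_entry_def)

lemma block_entry_swap:
  "block_entry L lam q p = block_entry L (\<lambda>k. inverse (lam k)) p q"
  "block_entry L lam q p = cnj (block_entry L lam p q)"
proof -
  have "block_entry L lam q p = block_entry L (\<lambda>k. inverse (lam k)) p q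
      \<and> block_entry L lam q p = cnj (block_entry L lam p q)"
  proof (cases "q div 2 = p div 2 \<and> p div 2 < L")
    case True
    then show ?thesis
      using pair_entry_swap[of "of_real (lam (p div 2))" q p] pair_entry_cnj[of "lam (p div 2)" q p]
      by (simp only: block_entry_eq simp_thms if_True of_real_inverse)
  next
    case False
    then have "\<not> (p div 2 < L \<and> q div 2 = p div 2)" "\<not> (q div 2 < L \<and> p div 2 = q div 2)" by metis+
    then show ?thesis unfolding block_entry_eq by (simp only: if_False eq_commute[of q p]) (cases "p = q", simp_all)
  qed
  then show "block_entry L lam q p = block_entry L (\<lambda>k. inverse (lam k)) p q"
    "block_entry L lam q p = cnj (block_entry L lam p q)" by blast+
qed

lemma block_entry_cong: "(\<And>k. k < L \<Longrightarrow> l k = m k) \<Longrightarrow> block_entry L l p q = block_entry L m p q"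
  unfolding block_entry_eq by (rule if_cong) auto

lemma block_entry_1: "block_entry L (\<lambda>k. 1) p q = (if p = q then 1 else 0)"
  unfolding block_entry_eq of_real_1 pair_entry_1 by (rule if_cancel)

lemma div_2_cases: "p div 2 = k \<Longrightarrow> p = 2 * k \<or> p = Suc (2 * k)" for p k :: nat
  by presburger

lemma hyperbolic_rotation:
  fixes x x' y y' :: complex
  shows "(x + x') / 2 * ((y + y') / 2) + (- \<i> * (x - x') / 2) * (\<i> * (y - y') / 2) = (x * y + x' * y') / 2"
    and "(x + x') / 2 * (- \<i> * (y - y') / 2) + (- \<i> * (x - x') / 2) * ((y + y') / 2) = - \<i> * (x * y - x' * y') / 2"
    and "(\<i> * (x - x') / 2) * ((y + y') / 2) + (x + x') / 2 * (\<i> * (y - y') / 2) = \<i> * (x * y - x' * y') / 2"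
    and "(\<i> * (x - x') / 2) * (- \<i> * (y - y') / 2) + (x + x') / 2 * ((y + y') / 2) = (x * y + x' * y') / 2"
  by (simp_all add: complex_eq_iff field_simps)

lemma block_entry_product:
  assumes "2 * L \<le> N" "p < N"
  shows "(\<Sum>q<N. block_entry L lam p q * block_entry L mu q r) = block_entry L (\<lambda>k. lam k * mu k) p r"
proof (cases "p div 2 < L")
  case False
  have "(\<Sum>q<N. block_entry L lam p q * block_entry L mu q r) = (\<Sum>q<N. if p = q then block_entry L mu q r else 0)"
    using False by (intro sum.cong refl) (simp add: block_entry_outside)
  also have "\<dots> = block_entry L (\<lambda>k. lam k * mu k) p r"
    using False assms by (simp add: block_entry_outside)
  finally show ?thesis .
next
  case True
  define k where "k = p div 2"
  have k: "k < L" using True by (simp add: k_def)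
  have sub: "{2 * k, Suc (2 * k)} \<subseteq> {..<N}" using k assms(1) by auto
  have "(\<Sum>q<N. block_entry L lam p q * block_entry L mu q r)
      = (\<Sum>q\<in>{2 * k, Suc (2 * k)}. block_entry L lam p q * block_entry L mu q r)"
  proof (rule sum.mono_neutral_right[OF _ sub])
    show "\<forall>q\<in>{..<N} - {2 * k, Suc (2 * k)}. block_entry L lam p q * block_entry L mu q r = 0"
    proof
      fix q assume "q \<in> {..<N} - {2 * k, Suc (2 * k)}"
      then have "p div 2 \<noteq> q div 2" using div_2_cases[of q k] by (auto simp: k_def)
      then show "block_entry L lam p q * block_entry L mu q r = 0" by (simp add: block_entry_different)
    qed
  qed auto
  also have "\<dots> = block_entry L lam p (2 * k) * block_entry L mu (2 * k) r
      + block_entry L lam p (Suc (2 * k)) * block_entry L mu (Suc (2 * k)) r" by simp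
  also have "\<dots> = block_entry L (\<lambda>k. lam k * mu k) p r"
  proof (cases "r div 2 = k")
    case False
    then show ?thesis by (simp add: block_entry_different k_def)
  next
    case r: True
    have p: "p = 2 * k \<or> p = Suc (2 * k)" using div_2_cases[of p k] by (simp add: k_def)
    have "block_entry L lam p (2 * k) * block_entry L mu (2 * k) r
      + block_entry L lam p (Suc (2 * k)) * block_entry L mu (Suc (2 * k)) r
      = block_entry L (\<lambda>k. lam k * mu k) p r"
      using p div_2_cases[OF r]
      by (elim disjE)
         (simp_all only: block_entry_inside[OF k] of_real_mult inverse_mult_distrib hyperbolic_rotation)
    then show ?thesis .
  qed
  finally show ?thesis .
qed

lemma mat_add_mult: "(X + Y) ** Z = X ** Z + Y ** (Z :: complex^'n^'n)"
  by (simp add: vec_eq_iff matrix_matrix_mult_def distrib_right sum.distrib)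

lemma mat_mult_add: "X ** (Y + Z) = X ** Y + X ** (Z :: complex^'n^'n)"
  by (simp add: vec_eq_iff matrix_matrix_mult_def distrib_left sum.distrib)

locale modular =
  fixes idx :: "'n::finite \<Rightarrow> nat" and L :: nat and lam :: "nat \<Rightarrow> real" and A :: "complex^'n^'n"
  assumes idx: "bij_betw idx UNIV {..<CARD('n)}"
    and L: "2 * L \<le> CARD('n)"
    and lam_pos: "\<And>k. k < L \<Longrightarrow> lam k > 0"
    and A_def: "A = modular_matrix idx L lam"
begin

lemma lam_nz: "k < L \<Longrightarrow> lam k \<noteq> 0"
  using lam_pos by force

lemma modular_matrix_mult:
  "modular_matrix idx L l ** modular_matrix idx L m = modular_matrix idx L (\<lambda>k. l k * m k)"
proof -
  have "(\<Sum>c\<in>UNIV. block_entry L l (idx a) (idx c) * block_entry L m (idx c) (idx b))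
     = block_entry L (\<lambda>k. l k * m k) (idx a) (idx b)" for a b
  proof -
    have "idx a < CARD('n)" using bij_betw_apply[OF idx, of a] by simp
    from block_entry_product[OF L this, where r = "idx b"] show ?thesis
      using sum.reindex_bij_betw[OF idx, of "\<lambda>q. block_entry L l (idx a) q * block_entry L m q (idx b)"] by simp
  qed
  then show ?thesis by (simp add: matrix_matrix_mult_def vec_eq_iff modular_matrix_entry)
qed

lemma idx_eq_iff: "idx a = idx b \<longleftrightarrow> a = b"
  using idx by (auto simp: bij_betw_def inj_on_def)

lemma modular_matrix_cong: "(\<And>k. k < L \<Longrightarrow> l k = m k) \<Longrightarrow> modular_matrix idx L l = modular_matrix idx L m"
  unfolding vec_eq_iff modular_matrix_entry by (intro allI block_entry_cong)

lemma modular_matrix_1: "modular_matrix idx L (\<lambda>k. 1) = mat 1"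
  by (simp add: vec_eq_iff modular_matrix_entry block_entry_1 mat_def idx_eq_iff)

lemma transpose_modular: "transpose (modular_matrix idx L l) = modular_matrix idx L (\<lambda>k. inverse (l k))"
  by (simp add: vec_eq_iff transpose_def modular_matrix_entry flip: block_entry_swap(1))

lemma cnj_modular_entry: "cnj (modular_matrix idx L l $ a $ b) = modular_matrix idx L l $ b $ a"
  by (simp add: modular_matrix_entry flip: block_entry_swap(2))

lemma A_transpose: "A ** transpose A = mat 1"
proof -
  have "A ** transpose A = modular_matrix idx L (\<lambda>k. lam k * inverse (lam k))"
    unfolding A_def transpose_modular by (rule modular_matrix_mult)
  also have "\<dots> = modular_matrix idx L (\<lambda>k. 1)" by (rule modular_matrix_cong) (simp add: lam_nz)
  also have "\<dots> = mat 1" by (rule modular_matrix_1)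
  finally show ?thesis .
qed

lemma transpose_A: "transpose A ** A = mat 1"
  using A_transpose by (simp add: matrix_left_right_inverse)

lemma cnj_A: "cnj (A $ a $ b) = A $ b $ a"
  unfolding A_def by (rule cnj_modular_entry)

lemma A_nonneg: "(\<Sum>a\<in>UNIV. cnj (v $ a) * (A *v v) $ a) \<in> \<real>\<^sub>\<ge>\<^sub>0"
proof -
  define S where "S = modular_matrix idx L (\<lambda>k. sqrt (lam k))"
  have SS: "A = S ** S"
  proof -
    have "S ** S = modular_matrix idx L (\<lambda>k. sqrt (lam k) * sqrt (lam k))"
      unfolding S_def by (rule modular_matrix_mult)
    also have "\<dots> = A" unfolding A_def by (rule modular_matrix_cong) (use lam_pos in \<open>simp add: less_imp_le\<close>)
    finally show ?thesis ..
  qed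
  have "(\<Sum>a\<in>UNIV. cnj (v $ a) * (A *v v) $ a) = (\<Sum>a\<in>UNIV. \<Sum>b\<in>UNIV. cnj (v $ a) * S $ a $ b * (S *v v) $ b)"
    unfolding SS matrix_vector_mul_assoc[symmetric]
    by (subst (1) matrix_vector_mult_def) (simp add: sum_distrib_left mult.assoc)
  also have "\<dots> = (\<Sum>b\<in>UNIV. cnj ((S *v v) $ b) * (S *v v) $ b)"
  proof -
    have "cnj ((S *v v) $ b) = (\<Sum>a\<in>UNIV. cnj (v $ a) * S $ a $ b)" for b
      by (simp add: matrix_vector_mult_def S_def cnj_modular_entry mult.commute)
    then show ?thesis by (subst sum.swap) (simp add: sum_distrib_right)
  qed
  also have "\<dots> \<in> \<real>\<^sub>\<ge>\<^sub>0"
    by (intro sum_nonneg_Reals) (auto simp: complex_nonneg_Reals_iff)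
  finally show ?thesis .
qed

lemma ker_1_plus_A: "(mat 1 + A) *v v = 0 \<Longrightarrow> v = 0"
proof -
  assume "(mat 1 + A) *v v = 0"
  then have "v + A *v v = 0" by (simp add: matrix_vector_mult_add_rdistrib)
  then have "(\<Sum>a\<in>UNIV. cnj (v $ a) * v $ a) + (\<Sum>a\<in>UNIV. cnj (v $ a) * (A *v v) $ a) = 0"
    by (simp add: sum.distrib[symmetric] distrib_left[symmetric] vector_add_component[symmetric])
  then have "Re (\<Sum>a\<in>UNIV. cnj (v $ a) * v $ a) \<le> 0"
    using A_nonneg[of v] by (auto simp: complex_nonneg_Reals_iff complex_eq_iff)
  moreover have "cnj z * z = of_real ((cmod z)\<^sup>2)" for z
    by (simp only: complex_norm_square mult.commute)
  ultimately have "(\<Sum>a\<in>UNIV. (cmod (v $ a))\<^sup>2) \<le> 0"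
    by (simp only: of_real_sum[symmetric] Re_complex_of_real)
  then have "(\<Sum>a\<in>UNIV. (cmod (v $ a))\<^sup>2) = 0"
    by (intro antisym sum_nonneg) auto
  then show "v = 0" by (auto simp: sum_nonneg_eq_0_iff vec_eq_iff)
qed

text \<open>The covariance is \<open>\<alpha> = 2 G\<close>. All its properties follow from \<open>G (1 + A) = 1\<close>, from \<open>A\<^sup>T = A\<^bsup>-1\<^esup>\<close>
  and from the positivity of \<open>A\<close>.\<close>

definition G where "G = matrix_inv (mat 1 + A)"

lemma G: "(mat 1 + A) ** G = mat 1" "G ** (mat 1 + A) = mat 1"
proof -
  have "invertible (mat 1 + A)"
    unfolding invertible_left_inverse matrix_left_invertible_ker using ker_1_plus_A by blast
  then have "\<exists>B. (mat 1 + A) ** B = mat 1 \<and> B ** (mat 1 + A) = mat 1" by (simp add: invertible_def)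
  from someI_ex[OF this] show "(mat 1 + A) ** G = mat 1" "G ** (mat 1 + A) = mat 1"
    unfolding G_def matrix_inv_def by auto
qed

lemma inverse_unique: "X ** (mat 1 + A) = mat 1 \<Longrightarrow> X = G" for X :: "complex^'n^'n"
  by (metis G(1) matrix_mul_assoc matrix_mul_lid matrix_mul_rid)

lemma AG: "A ** G = G ** A"
proof -
  have "G + A ** G = G + G ** A"
    using G by (simp add: mat_add_mult mat_mult_add)
  then show ?thesis by simp
qed

lemma transpose_G: "transpose G = G ** A"
proof -
  have "transpose G ** transpose (mat 1 + A) = mat 1"
    using arg_cong[OF G(1), of transpose] by (simp add: matrix_transpose_mul)
  moreover have tp: "transpose (mat 1 + A) = mat 1 + transpose A"
    by (auto simp: transpose_def vec_eq_iff mat_def)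
  ultimately have 1: "transpose G ** (mat 1 + transpose A) = mat 1" by simp
  have "(mat 1 + transpose A) ** (G ** A) = (mat 1 + transpose A) ** A ** G"
    using AG by (simp add: matrix_mul_assoc[symmetric])
  also have "(mat 1 + transpose A) ** A = mat 1 + A"
    using transpose_A by (simp add: mat_add_mult add.commute)
  also have "(mat 1 + A) ** G = mat 1" by (rule G)
  finally show ?thesis using 1 by (metis matrix_mul_assoc matrix_mul_lid matrix_mul_rid)
qed

lemma AtG: "transpose A ** G = G ** transpose A"
proof -
  have "transpose A ** G = transpose A ** (G ** A) ** transpose A"
    using A_transpose by (simp add: matrix_mul_assoc[symmetric])
  also have "\<dots> = (transpose A ** A) ** G ** transpose A"
    using AG by (metis matrix_mul_assoc)
  finally show ?thesis using transpose_A by simp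
qed

definition hconj :: "complex^'n^'n \<Rightarrow> complex^'n^'n" where "hconj M = (\<chi> i j. cnj (M $ j $ i))"

lemma hconj_mult: "hconj (M ** P) = hconj P ** hconj M"
  by (simp add: hconj_def vec_eq_iff matrix_matrix_mult_def mult.commute)

lemma cnj_G: "cnj (G $ a $ b) = G $ b $ a"
proof -
  have 1: "hconj (mat 1 + A) = mat 1 + A" "hconj (mat 1) = (mat 1 :: complex^'n^'n)"
    by (auto simp: hconj_def vec_eq_iff mat_def cnj_A)
  have "hconj G ** (mat 1 + A) = mat 1"
    using hconj_mult[of "mat 1 + A" G] unfolding 1 G by simp
  then have "hconj G = G" by (rule inverse_unique)
  then have "hconj G $ b $ a = G $ b $ a" by simp
  then show ?thesis by (simp add: hconj_def)
qed

abbreviation "al \<equiv> alpha A"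

lemma al_eq: "al j k = 2 * G $ j $ k"
  by (simp add: alpha_def G_def scaleR_conv_of_real[where 'a = complex])

lemma al_flip: "al j k = (\<Sum>m\<in>UNIV. al k m * A $ m $ j)"
  using arg_cong[OF transpose_G, of "\<lambda>M. M $ k $ j"]
  by (simp add: al_eq transpose_def matrix_matrix_mult_def sum_distrib_left mult.assoc)

lemma al_flip': "al j k = (\<Sum>m\<in>UNIV. A $ k $ m * al m j)"
  using arg_cong[OF transpose_G, of "\<lambda>M. M $ k $ j"] unfolding AG[symmetric]
  by (simp add: al_eq transpose_def matrix_matrix_mult_def sum_distrib_left mult_ac)

lemma al_comm: "(\<Sum>k\<in>UNIV. al j k * A $ m $ k) = (\<Sum>k\<in>UNIV. A $ k $ j * al k m)"
  using arg_cong[OF AtG, of "\<lambda>M. M $ j $ m"]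
  by (simp add: al_eq transpose_def matrix_matrix_mult_def mult.assoc mult.left_commute[of _ 2]
      flip: sum_distrib_left)

lemma al_herm: "cnj (al j k) = al k j" by (simp add: al_eq cnj_G)

lemma al_inverse: "(\<Sum>k\<in>UNIV. al j k * ((1/2) *\<^sub>R (mat 1 + A)) $ k $ m) = (if j = m then 1 else 0)"
  using arg_cong[OF G(2), of "\<lambda>M. M $ j $ m"]
  by (simp add: al_eq matrix_matrix_mult_def mat_def scaleR_conv_of_real[where 'a = complex])

lemma al_psd: "psd_on UNIV (\<lambda>k l. al l k)"
  unfolding psd_on_def
proof
  fix c :: "'n \<Rightarrow> complex"
  define b :: "complex^'n" where "b = (\<chi> a. cnj (c a))"
  define u where "u = G *v b"
  have b: "b = u + A *v u"
    using arg_cong[OF G(1), of "\<lambda>M. M *v b"]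
    by (simp add: u_def matrix_vector_mul_assoc[symmetric] matrix_vector_mult_add_rdistrib)
  have "(\<Sum>k\<in>UNIV. \<Sum>l\<in>UNIV. cnj (c k) * c l * al l k) = 2 * (\<Sum>l\<in>UNIV. cnj (b $ l) * u $ l)"
    unfolding u_def matrix_vector_mult_def
    by (subst sum.swap) (simp add: b_def al_eq sum_distrib_left mult_ac)
  also have "(\<Sum>l\<in>UNIV. cnj (b $ l) * u $ l) = (\<Sum>l\<in>UNIV. cnj (u $ l) * u $ l) + cnj (\<Sum>l\<in>UNIV. cnj (u $ l) * (A *v u) $ l)"
    unfolding b by (simp add: sum.distrib[symmetric] algebra_simps)
  also have "2 * \<dots> \<in> \<real>\<^sub>\<ge>\<^sub>0"
  proof -
    have "(\<Sum>l\<in>UNIV. cnj (u $ l) * u $ l) \<in> \<real>\<^sub>\<ge>\<^sub>0"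
      by (intro sum_nonneg_Reals) (auto simp: complex_nonneg_Reals_iff)
    moreover have "cnj (\<Sum>l\<in>UNIV. cnj (u $ l) * (A *v u) $ l) \<in> \<real>\<^sub>\<ge>\<^sub>0"
      using A_nonneg[of u] by (simp add: complex_nonneg_Reals_iff del: cnj_sum)
    ultimately show ?thesis by (intro nonneg_Reals_mult_I nonneg_Reals_add_I) auto
  qed
  finally show "(\<Sum>k\<in>UNIV. \<Sum>l\<in>UNIV. cnj (c k) * c l * al l k) \<in> \<real>\<^sub>\<ge>\<^sub>0" .
qed

text \<open>The diagonal of \<open>G + G A = 1\<close>, since \<open>G A\<close> is the transpose of \<open>G\<close> and has the same diagonal.\<close>

lemma al_diag: "al j j = 1"
proof -
  have "al j j + al j j = (\<Sum>k\<in>UNIV. al j k * (mat 1 + A) $ k $ j)"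
    by (subst (2) al_flip)
       (simp add: distrib_left sum.distrib mat_def if_distrib[where f = "\<lambda>x. _ * x"] cong: if_cong)
  also have "\<dots> = 2"
    using arg_cong[OF G(2), of "\<lambda>M. M $ j $ j"]
    by (simp add: al_eq matrix_matrix_mult_def mat_def mult.assoc flip: sum_distrib_left)
  finally show ?thesis by simp
qed

text \<open>The Cauchy-Schwarz inequality for the positive matrix \<open>\<alpha>\<close>, whose diagonal is 1.\<close>

lemma al_le: "cmod (al j k) \<le> 1"
proof (cases "j = k \<or> al j k = 0")
  case False
  define z where "z = al k j"
  have z: "al j k = cnj z" "z \<noteq> 0" using al_herm[of k j] False by (auto simp: z_def)
  have p: "psd_on {j, k} (\<lambda>k l. al l k)" by (rule psd_on_subset[OF al_psd]) auto
  define c where "c x = (if x = j then 1 else - cnj z / cmod z)" for x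
  have s: "cnj z * z = (of_real (cmod z))\<^sup>2" "z * cnj z = (of_real (cmod z))\<^sup>2"
    using complex_norm_square[of z] by (simp_all add: mult.commute)
  have "(\<Sum>u\<in>{j, k}. \<Sum>v\<in>{j, k}. cnj (c u) * c v * al v u) = of_real (2 - 2 * cmod z)"
    using False z by (simp add: c_def al_diag z_def[symmetric] s power2_eq_square)
  with psd_onD[OF p, of c] have "complex_of_real (2 - 2 * cmod z) \<in> \<real>\<^sub>\<ge>\<^sub>0" by metis
  then have "2 - 2 * cmod z \<ge> 0" unfolding nonneg_Reals_of_real_iff .
  then show ?thesis using z by simp
qed (auto simp: al_diag)

lemma A_vec_axis: "(M *v axis a 1) $ i = (M :: complex^'n^'n) $ i $ a"
  by (simp add: matrix_vector_mult_def axis_def if_distrib[where f = "\<lambda>x. _ * x"] cong: if_cong)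

lemma mat_norm_A: "mat_norm A \<ge> 1"
proof -
  obtain a :: 'n where True by simp
  have "1 \<le> Re (A $ a $ a)"
  proof (cases "idx a div 2 < L")
    case True
    define l where "l = lam (idx a div 2)"
    have l: "l > 0" using lam_pos True by (simp add: l_def)
    have "0 \<le> (l - 1)\<^sup>2 / l" using l by simp
    then have "2 \<le> l + inverse l" using l by (simp add: field_simps power2_eq_square)
    moreover have "A $ a $ a = of_real ((l + inverse l) / 2)"
      using True by (simp add: A_def modular_matrix_entry block_entry_def l_def Let_def)
    ultimately show ?thesis by (simp del: of_real_add of_real_divide)
  qed (simp add: A_def modular_matrix_entry block_entry_outside)
  also have "\<dots> \<le> cmod (A $ a $ a)" by (rule complex_Re_le_cmod)
  also have "\<dots> = cmod ((A *v axis a 1) $ a)" by (simp only: A_vec_axis)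
  also have "\<dots> \<le> norm (A *v axis a 1)" by (rule Finite_Cartesian_Product.norm_nth_le)
  also have "\<dots> \<le> onorm ((*v) A) * norm (axis a (1 :: complex))" by (rule onorm) simp
  also have "\<dots> = mat_norm A" 
  proof -
    have "(norm (axis a (1 :: complex) $ i))\<^sup>2 = (if i = a then 1 else 0)" for i by (simp add: axis_def)
    then show ?thesis by (simp add: mat_norm_def norm_vec_def L2_set_def)
  qed
  finally show ?thesis .
qed

text \<open>The automorphism \<open>\<sigma>\<close> at \<open>z = - i\<close> involves the power of \<open>A\<close> with exponent \<open>i z = 1\<close>. By
  definition this is the only matrix that agrees with \<open>A\<close> on all eigenvectors; uniqueness holds
  because the eigenvectors span: if \<open>e\<close> is a basis vector of a block with \<open>\<lambda> \<noteq> 1\<close>, then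
  \<open>A e - \<lambda>\<^bsup>-1\<^esup> e\<close> and \<open>A e - \<lambda> e\<close> are eigenvectors for \<open>\<lambda>\<close> and \<open>\<lambda>\<^bsup>-1\<^esup>\<close>, and \<open>e\<close> is a combination
  of them.\<close>

lemma mat_powr_A: "mat_powr A 1 = A"
  unfolding mat_powr_def
proof (rule the_equality)
  show "\<forall>x v. A *v v = complex_of_real x *s v \<longrightarrow> A *v v = (complex_of_real x powr 1) *s v" by simp
next
  fix B
  assume B: "\<forall>x v. A *v v = complex_of_real x *s v \<longrightarrow> B *v v = (complex_of_real x powr 1) *s v"
  have eig: "B *v v = A *v v" if "A *v v = complex_of_real x *s v" for x v using B that by simp
  have "B *v axis a 1 = A *v axis a 1" for a
  proof (cases "idx a div 2 < L \<and> lam (idx a div 2) \<noteq> 1")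
    case False
    then have "block_entry L lam p (idx a) = (if p = idx a then 1 else 0)" for p
    proof (cases "p div 2 < L \<and> idx a div 2 = p div 2")
      case True
      with False have "lam (p div 2) = 1" by metis
      then show ?thesis by (simp only: block_entry_eq of_real_1 pair_entry_1 if_cancel)
    next
      case False
      then show ?thesis by (simp only: block_entry_eq if_False)
    qed
    then have "A *v axis a 1 = complex_of_real 1 *s axis a 1"
      unfolding vec_eq_iff A_vec_axis A_def modular_matrix_entry by (simp add: axis_def idx_eq_iff)
    then show ?thesis by (rule eig)
  next
    case True
    define l where "l = lam (idx a div 2)"
    have l: "l > 0" "l \<noteq> 1" using lam_pos True by (auto simp: l_def)
    let ?e = "axis a 1 :: complex^'n" and ?c = "complex_of_real (l + inverse l)"
    have "block_entry L lam p (idx a) + block_entry L lam (idx a) p = (if p = idx a then ?c else 0)" for p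
    proof (cases "p div 2 = idx a div 2")
      case False
      then have "p \<noteq> idx a" by metis
      then show ?thesis using False by (simp add: block_entry_different)
    next
      case p: True
      then have "block_entry L lam p (idx a) + block_entry L lam (idx a) p
          = pair_entry (of_real l) p (idx a) + pair_entry (of_real l) (idx a) p"
        using True by (simp only: block_entry_eq l_def simp_thms if_True)
      then show ?thesis by (simp add: pair_entry_add)
    qed
    then have "A *v ?e + transpose A *v ?e = ?c *s ?e"
      unfolding vec_eq_iff vector_add_component A_vec_axis
      by (simp add: transpose_def A_def modular_matrix_entry axis_def idx_eq_iff)
    then have "A *v (A *v ?e) + A *v (transpose A *v ?e) = A *v (?c *s ?e)"
      by (metis matrix_vector_right_distrib)
    then have AA: "A *v (A *v ?e) = ?c *s (A *v ?e) - ?e"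
    proof -
      assume "A *v (A *v ?e) + A *v (transpose A *v ?e) = A *v (?c *s ?e)"
      moreover have "A *v (transpose A *v ?e) = ?e"
        by (simp only: matrix_vector_mul_assoc A_transpose matrix_vector_mul_lid)
      ultimately show ?thesis by (simp only: vector_scalar_commute) (metis add_diff_cancel_right')
    qed
    have ev: "A *v (A *v ?e - complex_of_real (inverse x) *s ?e) = complex_of_real x *s (A *v ?e - complex_of_real (inverse x) *s ?e)"
      if "x = l \<or> x = inverse l" for x
    proof -
      define X X' where "X = complex_of_real x" and "X' = complex_of_real (inverse x)"
      have c: "?c = X + X'" using that by (auto simp: X_def X'_def)
      have XX: "X * X' = 1" using that l by (auto simp: X_def X'_def simp flip: of_real_mult)
      have comp: "(X + X') * y - z - X' * y = X * (y - X' * z)" for y z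
      proof -
        have "X * (y - X' * z) = X * y - (X * X') * z" by (simp only: right_diff_distrib mult.assoc)
        also have "\<dots> = (X + X') * y - z - X' * y" by (simp only: XX distrib_right) simp
        finally show ?thesis ..
      qed
      show ?thesis
        unfolding matrix_vector_mult_diff_distrib vector_scalar_commute AA c
        unfolding X_def[symmetric] X'_def[symmetric] vec_eq_iff
          vector_minus_component vector_smult_component comp by (rule allI, rule refl)
    qed
    define d where "d = complex_of_real (l - inverse l)"
    have d: "d \<noteq> 0"
    proof
      assume "d = 0"
      then have "l = inverse l" by (simp only: d_def of_real_eq_0_iff right_minus_eq)
      then have "l * l = l * inverse l" by simp
      also have "\<dots> = 1" using l by simp
      finally have "(l - 1) * (l + 1) = 0" by (simp add: algebra_simps)
      then show False using l by simp
    qed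
    define p where "p = A *v ?e - complex_of_real (inverse l) *s ?e"
    define q where "q = A *v ?e - complex_of_real (inverse (inverse l)) *s ?e"
    have "p - q = d *s ?e" by (simp add: p_def q_def d_def vec_eq_iff left_diff_distrib)
    then have e: "?e = inverse d *s (p - q)" using d by (simp add: vector_smult_assoc)
    have Me: "M *v ?e = inverse d *s (M *v p - M *v q)" for M :: "complex^'n^'n"
      by (subst e) (simp only: vector_scalar_commute matrix_vector_mult_diff_distrib)
    have "A *v p = complex_of_real l *s p" "A *v q = complex_of_real (inverse l) *s q"
      unfolding p_def q_def by (rule ev, blast)+
    then have "B *v p = A *v p" "B *v q = A *v q" by (blast intro: eig)+
    then have "B *v ?e = A *v ?e" unfolding Me by simp
    then show ?thesis .
  qed
  then have "B $ i $ a = A $ i $ a" for i a by (metis A_vec_axis)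
  then show "B = A" by (simp add: vec_eq_iff)
qed

sublocale cov: kms_covariance al "\<lambda>j k. A $ j $ k"
proof
  show "(\<Sum>x\<in>UNIV. A $ b $ x * A $ y $ x) = (if b = y then 1 else 0)" for b y
    using arg_cong[OF A_transpose, of "\<lambda>M. M $ b $ y"]
    by (simp add: matrix_matrix_mult_def transpose_def mat_def)
qed (fact al_flip al_flip' al_comm al_le al_herm al_psd)+

end

section \<open>The cyclic gradient of an invariant potential\<close>

lemma nc_mult_mon_right:
  "nc_mult P (nc_mon v) w = (if drop (length w - length v) w = v \<and> length v \<le> length w
      then P (take (length w - length v) w) else 0)"
proof -
  have "nc_mult P (nc_mon v) w = (\<Sum>m\<le>length w. if drop m w = v then P (take m w) else 0)"
    unfolding nc_mult_def nc_mon_def by (intro sum.cong) auto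
  also have "\<dots> = (\<Sum>m\<le>length w. if m = length w - length v \<and> drop (length w - length v) w = v \<and> length v \<le> length w
      then P (take (length w - length v) w) else 0)"
    by (intro sum.cong refl) auto
  also have "\<dots> = (if drop (length w - length v) w = v \<and> length v \<le> length w
      then P (take (length w - length v) w) else 0)"
    by (cases "drop (length w - length v) w = v \<and> length v \<le> length w") auto
  finally show ?thesis .
qed

lemma nc_mult_append_mon: "nc_mult P (nc_mon v) (u @ v) = P u"
  by (simp add: nc_mult_mon_right)

lemma nc_mult_mon_left:
  "nc_mult (nc_mon [j]) Q (i # w) = (if i = j then Q w else 0)" "nc_mult (nc_mon [j]) Q [] = 0"
proof -
  have "nc_mult (nc_mon [j]) Q (i # w) = (\<Sum>m\<le>length w. if i = j \<and> take m w = [] then Q (drop m w) else 0)"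
    unfolding nc_mult_def nc_mon_def
    by (simp add: sum.atMost_Suc_shift del: sum.atMost_Suc) (intro sum.cong refl, auto)
  also have "\<dots> = (\<Sum>m\<le>length w. if m = 0 then if i = j then Q w else 0 else 0)"
    by (intro sum.cong refl) auto
  finally show "nc_mult (nc_mon [j]) Q (i # w) = (if i = j then Q w else 0)" by simp
qed (simp add: nc_mult_def nc_mon_def)

lemma sum_words_split:
  "(\<Sum>v\<in>words (l + Suc r). F v) = (\<Sum>z\<in>words l. \<Sum>k\<in>UNIV. \<Sum>y\<in>words r. F (z @ k # y))"
proof (induction l arbitrary: F)
  case (Suc l)
  have "(\<Sum>v\<in>words (Suc l + Suc r). F v) = (\<Sum>j\<in>UNIV. \<Sum>z\<in>words l. \<Sum>k\<in>UNIV. \<Sum>y\<in>words r. F (j # z @ k # y))"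
    by (simp only: add_Suc sum_words_Suc Suc.IH)
  then show ?case by (simp add: sum_words_Suc)
qed (simp add: sum_words_Suc)

lemma nc_mult_sum_left: "nc_mult (\<lambda>w. \<Sum>k\<in>I. c k * F k w) Q w = (\<Sum>k\<in>I. c k * nc_mult (F k) Q w)"
  by (simp add: nc_mult_def sum_distrib_left sum_distrib_right mult.assoc sum.swap[of _ I])

context modular
begin

abbreviation "A_transp \<equiv> (\<lambda>j k. A $ k $ j)"

lemma sigma_mon: "foldr (\<lambda>j Q. nc_mult (nc_sigma_var A (- \<i>) j) Q) v (nc_mon []) x
     = (if length x = length v then tw A_transp v x else 0)"
proof (induction v arbitrary: x)
  case Nil
  show ?case by (auto simp: nc_mon_def)
next
  case (Cons j v)
  have s: "nc_sigma_var A (- \<i>) j = (\<lambda>w. \<Sum>k\<in>UNIV. A $ j $ k * nc_mon [k] w)"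
    by (simp add: nc_sigma_var_def mat_powr_A)
  show ?case
  proof (cases x)
    case Nil
    then show ?thesis by (simp add: s nc_mult_sum_left nc_mult_mon_left)
  next
    case (Cons i y)
    have "(\<Sum>k\<in>UNIV. A $ j $ k * (if i = k then F else 0)) = A $ j $ i * F" for F
      by (simp add: if_distrib[where f = "\<lambda>x. _ * x"] cong: if_cong)
    then show ?thesis using Cons.IH by (simp add: Cons s nc_mult_sum_left nc_mult_mon_left)
  qed
qed

lemma nc_sigma_mon: "nc_sigma A (- \<i>) (nc_mon v) x = (if length x = length v then tw A_transp v x else 0)"
proof -
  have "nc_sigma A (- \<i>) (nc_mon v) x = (\<Sum>u\<in>words (length x). if u = v then (if length x = length v then tw A_transp v x else 0) else 0)"
  proof -
    have "nc_sigma A (- \<i>) (nc_mon v) x = (\<Sum>u\<in>words (length x). nc_mon v u * (if length x = length u then tw A_transp u x else 0))"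
      unfolding nc_sigma_def nc_extend_def sigma_mon by (simp add: words_def)
    also have "\<dots> = (\<Sum>u\<in>words (length x). if u = v then (if length x = length v then tw A_transp v x else 0) else 0)"
      by (intro sum.cong refl) (auto simp: nc_mon_def)
    finally show ?thesis .
  qed
  also have "\<dots> = (if length x = length v then tw A_transp v x else 0)"
    by (subst sum.delta[OF finite_words]) (auto simp: words_def)
  finally show ?thesis .
qed

lemma nc_rho_Cons: "nc_rho A V (m # u) = (\<Sum>k\<in>UNIV. A $ k $ m * V (u @ [k]))"
proof -
  have "nc_rho A V (m # u) = (\<Sum>v\<in>words (Suc (length u)). V v *
      (if v = [] then nc_mon [] else nc_mult (nc_sigma A (- \<i>) (nc_mon [last v])) (nc_mon (butlast v))) (m # u))"
    by (simp add: nc_rho_def nc_extend_def words_def)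
  also have "\<dots> = (\<Sum>w\<in>words (length u). \<Sum>k\<in>UNIV. V (w @ [k]) * nc_mult (nc_sigma A (- \<i>) (nc_mon [k])) (nc_mon w) (m # u))"
    by (simp add: sum_words_Suc')
  also have "\<dots> = (\<Sum>w\<in>words (length u). if w = u then \<Sum>k\<in>UNIV. A $ k $ m * V (w @ [k]) else 0)"
    by (intro sum.cong refl) (auto simp: words_def nc_mult_mon_right nc_sigma_mon tw_def mult.commute intro!: sum.cong)
  also have "\<dots> = (\<Sum>k\<in>UNIV. A $ k $ m * V (u @ [k]))"
    by (simp add: sum.delta') (simp add: words_def)
  finally show ?thesis .
qed

lemma tw_A_transp: "length x = length y \<Longrightarrow> tw A_transp y x = tw (\<lambda>j k. A $ j $ k) x y"
  by (induction x y rule: list_induct2) auto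

text \<open>Removing the \<open>l\<close>-th letter and rotating what follows it to the front gives the same as first
  rotating the whole potential until this letter is the last one. So all \<open>|u| + 1\<close> summands are
  equal.\<close>

lemma cyclic_diff_rho_invariant:
  assumes V: "\<And>m u. V (m # u) = (\<Sum>k\<in>UNIV. A $ k $ m * V (u @ [k]))"
  shows "cyclic_diff A j V u = of_nat (Suc (length u)) * (\<Sum>k\<in>UNIV. al j k * V (u @ [k]))"
proof -
  let ?n = "Suc (length u)"
  let ?T = "\<lambda>l v. al j (v ! l) * nc_mult (nc_sigma A (- \<i>) (nc_mon (drop (Suc l) v))) (nc_mon (take l v)) u"
  have "cyclic_diff A j V u = (\<Sum>v\<in>words ?n. V v * (\<Sum>l<length v. ?T l v))"
    by (simp add: cyclic_diff_def nc_extend_def words_def)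
  also have "\<dots> = (\<Sum>v\<in>words ?n. \<Sum>l<?n. V v * ?T l v)"
    by (intro sum.cong refl) (simp add: words_def sum_distrib_left del: sum.lessThan_Suc)
  also have "\<dots> = (\<Sum>l<?n. \<Sum>v\<in>words ?n. V v * ?T l v)" by (rule sum.swap)
  also have "\<dots> = (\<Sum>l<?n. \<Sum>k\<in>UNIV. al j k * V (u @ [k]))"
  proof (intro sum.cong refl)
    fix l assume "l \<in> {..<?n}"
    then have l: "l \<le> length u" by simp
    define r where "r = length u - l"
    define x z where "x = take r u" and "z = drop r u"
    have xz: "u = x @ z" "length x = r" "length z = l" using l by (auto simp: x_def z_def r_def)
    have n: "?n = l + Suc r" using l by (simp add: r_def)
    have T: "?T l (z' @ k # y) = (if z' = z then al j k * tw (\<lambda>j k. A $ j $ k) x y else 0)"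
      if "z' \<in> words l" "y \<in> words r" for z' k y
    proof -
      have len: "length z' = l" "length y = r" using that by (auto simp: words_def)
      have "nc_mult (nc_sigma A (- \<i>) (nc_mon y)) (nc_mon z') u = (if z' = z then tw A_transp y x else 0)"
        using len xz by (auto simp: nc_mult_mon_right nc_sigma_mon)
      then show ?thesis using len xz by (simp add: nth_append tw_A_transp)
    qed
    have "(\<Sum>v\<in>words ?n. V v * ?T l v) = (\<Sum>z'\<in>words l. \<Sum>k\<in>UNIV. \<Sum>y\<in>words r. V (z' @ k # y) * ?T l (z' @ k # y))"
      unfolding n by (rule sum_words_split)
    also have "\<dots> = (\<Sum>z'\<in>words l. if z' = z then (\<Sum>k\<in>UNIV. \<Sum>y\<in>words r. V (z @ k # y) * (al j k * tw (\<lambda>j k. A $ j $ k) x y)) else 0)"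
    proof (intro sum.cong refl)
      fix z' :: "'n list" assume z': "z' \<in> words l"
      have "(\<Sum>k\<in>UNIV. \<Sum>y\<in>words r. V (z' @ k # y) * ?T l (z' @ k # y))
          = (\<Sum>k\<in>UNIV. \<Sum>y\<in>words r. V (z' @ k # y) * (if z' = z then al j k * tw (\<lambda>j k. A $ j $ k) x y else 0))"
        by (intro sum.cong refl arg_cong2[where f = "(*)"] T z')
      then show "(\<Sum>k\<in>UNIV. \<Sum>y\<in>words r. V (z' @ k # y) * ?T l (z' @ k # y))
          = (if z' = z then (\<Sum>k\<in>UNIV. \<Sum>y\<in>words r. V (z @ k # y) * (al j k * tw (\<lambda>j k. A $ j $ k) x y)) else 0)"
        by (cases "z' = z") (simp_all only: if_True if_False mult_zero_right sum.neutral_const simp_thms)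
    qed
    also have "\<dots> = (\<Sum>k\<in>UNIV. \<Sum>y\<in>words r. V (z @ k # y) * (al j k * tw (\<lambda>j k. A $ j $ k) x y))"
      by (subst sum.delta[OF finite_words]) (use xz in \<open>auto simp: words_def\<close>)
    also have "\<dots> = (\<Sum>k\<in>UNIV. al j k * (\<Sum>y\<in>words (length x). tw (\<lambda>j k. A $ j $ k) x y * V ((z @ [k]) @ y)))"
      by (simp add: sum_distrib_left mult_ac xz)
    also have "\<dots> = (\<Sum>k\<in>UNIV. al j k * V (u @ [k]))"
      unfolding rotate_block[of V "\<lambda>j k. A $ j $ k", OF V, symmetric] xz(1) by simp
    finally show "(\<Sum>v\<in>words ?n. V v * ?T l v) = (\<Sum>k\<in>UNIV. al j k * V (u @ [k]))" .
  qed
  also have "\<dots> = of_nat ?n * (\<Sum>k\<in>UNIV. al j k * V (u @ [k]))" by simp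
  finally show ?thesis .
qed

lemma V_quad_pair: "V_quad A [m, k] = 1/2 * ((1/2) *\<^sub>R (mat 1 + A)) $ k $ m"
proof -
  define B where "B = (1/2) *\<^sub>R (mat 1 + A)"
  have "V_quad A [m, k] = 1/2 * (\<Sum>j\<in>UNIV. if k = j then (\<Sum>i\<in>UNIV. if m = i then B $ j $ i else 0) else 0)"
    unfolding V_quad_def nc_mon_def B_def[symmetric]
    by (intro arg_cong2[where f = "(*)"] refl sum.cong)
       (auto simp: if_distrib[where f = "\<lambda>x. _ * x"] cong: if_cong)
  then show ?thesis by (simp add: B_def)
qed

lemma V_quad_other: "length w \<noteq> 2 \<Longrightarrow> V_quad A w = 0"
  unfolding V_quad_def nc_mon_def by (auto intro!: sum.neutral)

lemma V_quad_rho: "V_quad A (m # u) = (\<Sum>k\<in>UNIV. A $ k $ m * V_quad A (u @ [k]))"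
proof (cases "length u = 1")
  case True
  then obtain p where u: "u = [p]" by (auto simp: length_Suc_conv)
  have "transpose A ** (mat 1 + A) = transpose A + mat 1"
    by (simp add: mat_mult_add transpose_A)
  then have "(transpose A ** (mat 1 + A)) $ m $ p = (transpose A + mat 1) $ m $ p" by simp
  then have "(\<Sum>k\<in>UNIV. A $ k $ m * (mat 1 + A) $ k $ p) = (mat 1 + A) $ p $ m"
  proof -
    have "mat 1 $ m $ p = (mat 1 :: complex^'n^'n) $ p $ m" by (simp add: mat_def)
    then show ?thesis
      using \<open>(transpose A ** (mat 1 + A)) $ m $ p = (transpose A + mat 1) $ m $ p\<close>
      by (simp only: matrix_matrix_mult_def transpose_def vec_lambda_beta vector_add_component add.commute)
  qed
  then have "(\<Sum>k\<in>UNIV. A $ k $ m * V_quad A [p, k]) = V_quad A [m, p]"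
    unfolding V_quad_pair vector_scaleR_component
    by (simp only: mult_scaleR_right scaleR_sum_right[symmetric] mult.left_commute[of _ "1/2"] sum_distrib_left[symmetric])
  then show ?thesis by (simp add: u)
qed (simp add: V_quad_other)

lemma V_quad_star: "nc_star (V_quad A) = V_quad A"
proof
  fix w
  show "nc_star (V_quad A) w = V_quad A w"
  proof (cases "length w = 2")
    case True
    then obtain m k where w: "w = [m, k]" by (auto simp: length_Suc_conv numeral_2_eq_2)
    show ?thesis by (auto simp: w nc_star_def V_quad_pair mat_def cnj_A)
  qed (simp add: nc_star_def V_quad_other)
qed

text \<open>This is where the coefficients \<open>(1 + A) / 2\<close> of the quadratic potential come from: they invert
  \<open>\<alpha>\<close>, so the cyclic gradient of the quadratic potential consists of the variables.\<close>

lemma V_quad_gradient: "of_nat (Suc (length u)) * (\<Sum>k\<in>UNIV. al j k * V_quad A (u @ [k])) = (if u = [j] then 1 else 0)"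
proof (cases "length u = 1")
  case True
  then obtain p where u: "u = [p]" by (auto simp: length_Suc_conv)
  have "of_nat (Suc (length u)) * (\<Sum>k\<in>UNIV. al j k * V_quad A (u @ [k]))
      = (\<Sum>k\<in>UNIV. al j k * ((1/2) *\<^sub>R (mat 1 + A)) $ k $ p)"
    by (simp add: u V_quad_pair sum_distrib_left)
  then show ?thesis unfolding al_inverse by (auto simp: u)
qed (auto simp: V_quad_other)

end

section \<open>Smallness of the drift\<close>

lemma finite_sum_le_nc_norm:
  assumes "finite F"
  shows "(\<Sum>w\<in>F. ennreal (cmod (P w) * R ^ length w)) \<le> nc_norm R P"
  unfolding nc_norm_def by (subst nonneg_infsum_complete) (use assms in \<open>auto intro: SUP_upper\<close>)

lemma nc_norm_proj_le: "nc_norm R (nc_proj n P) \<le> (SUP k. nc_norm R (nc_rho_pow A k (nc_proj n P)))"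
proof -
  have "nc_norm R (nc_rho_pow A 0 (nc_proj n P)) \<le> (SUP k. nc_norm R (nc_rho_pow A k (nc_proj n P)))"
    by (rule SUP_upper) simp
  then show ?thesis by (simp add: nc_rho_pow_def)
qed

lemma finite_sum_le_nc_norm_sigma:
  assumes F: "finite F"
  shows "(\<Sum>w\<in>F. ennreal (cmod (P w) * R ^ length w)) \<le> nc_norm_sigma A R P"
proof -
  define M where "M = Suc (Max (length ` F))"
  have M: "length ` F \<subseteq> {..<M}" using F by (auto simp: M_def less_Suc_eq_le)
  have "(\<Sum>w\<in>F. ennreal (cmod (P w) * R ^ length w))
      = (\<Sum>n<M. \<Sum>w | w \<in> F \<and> length w = n. ennreal (cmod (P w) * R ^ length w))"
    using F M by (intro sum.group[symmetric]) auto
  also have "\<dots> = (\<Sum>n<M. \<Sum>w | w \<in> F \<and> length w = n. ennreal (cmod (nc_proj n P w) * R ^ length w))"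
    by (intro sum.cong refl) (auto simp: nc_proj_def)
  also have "\<dots> \<le> (\<Sum>n<M. SUP k. nc_norm R (nc_rho_pow A k (nc_proj n P)))"
    using F by (intro sum_mono order.trans[OF finite_sum_le_nc_norm nc_norm_proj_le]) auto
  also have "\<dots> \<le> nc_norm_sigma A R P"
    unfolding nc_norm_sigma_def by (rule sum_le_suminf) auto
  finally show ?thesis .
qed

text \<open>The loss \<open>n + 1\<close> in a derivative is made up for by passing from the radius \<open>4\<close> to \<open>19/5\<close>: each
  of \<open>n + 1\<close> copies of \<open>(19/20)\<^bsup>n\<^esup>\<close> is at most a term of a geometric series with sum \<open>20\<close>.\<close>

lemma power_weight_le: "real (Suc n) * (19/5) ^ n \<le> 5 * 4 ^ Suc n"
proof -
  have "real (Suc n) * (19/20) ^ n = (\<Sum>i<Suc n. (19/20 :: real) ^ n)" by simp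
  also have "\<dots> \<le> (\<Sum>i<Suc n. (19/20) ^ i)" by (intro sum_mono power_decreasing) auto
  also have "\<dots> = (1 - (19/20) ^ Suc n) / (1 - 19/20)" by (subst geometric_sum) (auto simp: field_simps)
  also have "\<dots> \<le> 20" by simp
  finally have "4 ^ n * (real (Suc n) * (19/20) ^ n) \<le> 4 ^ n * 20" by (intro mult_left_mono) auto
  moreover have "4 ^ n * (19/20 :: real) ^ n = (19/5) ^ n" by (simp flip: power_mult_distrib)
  ultimately show ?thesis by (simp add: mult_ac del: of_nat_Suc)
qed

lemma small_driftI:
  fixes W :: "'n::finite ncps"
  assumes al: "\<And>j k. cmod (al j k) \<le> 1"
    and d: "\<And>j u. d j u = of_nat (Suc (length u)) * (\<Sum>k\<in>UNIV. al j k * W (u @ [k]))"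
    and W: "\<And>F. finite F \<Longrightarrow> (\<Sum>w\<in>F. cmod (W w) * 4 ^ length w) \<le> 1/100"
  shows "small_drift d"
proof -
  have fin: "(\<Sum>u\<in>F. cmod (d j u) * (19/5) ^ length u) \<le> 1/20" if F: "finite F" for F j
  proof -
    have "cmod (d j u) * (19/5) ^ length u \<le> (\<Sum>k\<in>UNIV. 5 * (cmod (W (u @ [k])) * 4 ^ length (u @ [k])))" for u
    proof -
      have "cmod (d j u) \<le> real (Suc (length u)) * (\<Sum>k\<in>UNIV. cmod (W (u @ [k])))"
        unfolding d norm_mult norm_of_nat
      proof (intro mult_left_mono order.trans[OF norm_sum] sum_mono)
        show "cmod (al j k * W (u @ [k])) \<le> cmod (W (u @ [k]))" for k
          unfolding norm_mult using mult_right_mono[OF al[of j k], of "cmod (W (u @ [k]))"] by simp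
      qed simp
      then have "cmod (d j u) * (19/5) ^ length u \<le> (real (Suc (length u)) * (\<Sum>k\<in>UNIV. cmod (W (u @ [k])))) * (19/5) ^ length u"
        by (rule mult_right_mono) simp
      also have "\<dots> = (real (Suc (length u)) * (19/5) ^ length u) * (\<Sum>k\<in>UNIV. cmod (W (u @ [k])))"
        by (simp only: mult_ac)
      also have "\<dots> \<le> (5 * 4 ^ Suc (length u)) * (\<Sum>k\<in>UNIV. cmod (W (u @ [k])))"
        by (intro mult_right_mono power_weight_le sum_nonneg) auto
      also have "\<dots> = (\<Sum>k\<in>UNIV. 5 * (cmod (W (u @ [k])) * 4 ^ length (u @ [k])))"
        by (simp add: sum_distrib_left mult_ac)
      finally show ?thesis .
    qed
    then have "(\<Sum>u\<in>F. cmod (d j u) * (19/5) ^ length u) \<le> (\<Sum>u\<in>F. \<Sum>k\<in>UNIV. 5 * (cmod (W (u @ [k])) * 4 ^ length (u @ [k])))"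
      by (rule sum_mono)
    also have "\<dots> = 5 * (\<Sum>w\<in>(\<lambda>(u, k). u @ [k]) ` (F \<times> UNIV). cmod (W w) * 4 ^ length w)"
      by (subst sum.reindex) (auto simp: inj_on_def sum.cartesian_product sum_distrib_left split_def)
    also have "\<dots> \<le> 5 * (1/100)" using F by (intro mult_left_mono W) auto
    finally show ?thesis by simp
  qed
  show ?thesis unfolding small_drift_def
  proof (intro allI conjI)
    fix j
    show s: "(\<lambda>u. cmod (d j u) * (19/5) ^ length u) summable_on UNIV"
      by (rule nonneg_bdd_above_summable_on) (auto intro!: bdd_aboveI[of _ "1/20"] fin)
    show "(\<Sum>\<^sub>\<infinity>u. cmod (d j u) * (19/5) ^ length u) \<le> 1/20"
      by (rule infsum_le_finite_sums[OF s]) (use fin in auto)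
  qed
qed

section \<open>Both sides of the equation on polynomials\<close>

lemma ssum_as_pairs:
  fixes G :: "'n::finite list \<Rightarrow> 'n \<Rightarrow> 'n list \<Rightarrow> 'b::comm_monoid_add"
  assumes S: "finite S" "\<And>a k b. v = a @ k # b \<Longrightarrow> (a, b) \<in> S"
  shows "ssum v G = (\<Sum>(a, b)\<in>S. \<Sum>k\<in>UNIV. if a @ k # b = v then G a k b else 0)"
proof -
  have "(\<Sum>(a, b)\<in>S. \<Sum>k\<in>UNIV. if a @ k # b = v then G a k b else 0)
      = (\<Sum>x\<in>S \<times> UNIV. if fst (fst x) @ snd x # snd (fst x) = v then G (fst (fst x)) (snd x) (snd (fst x)) else 0)"
    by (simp add: sum.cartesian_product split_def)
  also have "\<dots> = (\<Sum>x | x \<in> S \<times> UNIV \<and> fst (fst x) @ snd x # snd (fst x) = v. G (fst (fst x)) (snd x) (snd (fst x)))"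
    using S(1) by (subst sum.inter_filter) auto
  also have "\<dots> = (\<Sum>i<length v. G (take i v) (v ! i) (drop (Suc i) v))"
    by (rule sum.reindex_bij_witness[of _ "\<lambda>i. ((take i v, drop (Suc i) v), v ! i)" "\<lambda>x. length (fst (fst x))"])
       (auto simp: id_take_nth_drop[symmetric] intro!: S(2)[OF id_take_nth_drop])
  finally show ?thesis by (simp add: ssum_conv_sum)
qed

lemma tensor_eval_jacobian:
  fixes P :: "'n::finite \<Rightarrow> 'n ncps"
  assumes P: "\<And>i. P i \<in> nc_polys"
  shows "tensor_eval \<phi> (tensor_trace (sigma_jacobian A P))
     = (\<Sum>i\<in>UNIV. \<Sum>v | P i v \<noteq> 0. P i v * ssum v (\<lambda>a k b. alpha A k i * \<phi> (nc_mon a) * \<phi> (nc_mon b)))"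
proof -
  let ?Q = "tensor_trace (sigma_jacobian A P)"
  define supp where "supp i = {v. P i v \<noteq> 0}" for i
  have fin: "finite (supp i)" for i using P by (simp add: nc_polys_def supp_def)
  define S where "S = (\<Union>i. \<Union>v\<in>supp i. (\<lambda>m. (take m v, drop (Suc m) v)) ` {..<length v})"
  have S: "finite S" using fin by (auto simp: S_def)
  have inS: "(a, b) \<in> S" if "v \<in> supp i" "v = a @ k # b" for a b k v i
    unfolding S_def using that by (auto intro!: exI[of _ i] bexI[of _ v] image_eqI[of _ _ "length a"])
  have Q: "?Q (a, b) = (\<Sum>i\<in>UNIV. \<Sum>k\<in>UNIV. alpha A k i * P i (a @ k # b))" for a b
    by (simp add: tensor_trace_def sigma_jacobian_def sigma_diff_def free_diff_def)
  define g where "g i k x = alpha A k i * \<phi> (nc_mon (fst x)) * \<phi> (nc_mon (snd x))" for i k x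
  define glue where "glue k x = fst x @ k # snd x" for k :: 'n and x
  have "tensor_eval \<phi> ?Q = (\<Sum>x\<in>S. ?Q x * \<phi> (nc_mon (fst x)) * \<phi> (nc_mon (snd x)))"
    unfolding tensor_eval_def split_def
  proof (rule sum.mono_neutral_cong_left[OF S])
    show "{x. ?Q (fst x, snd x) \<noteq> 0} \<subseteq> S"
    proof clarify
      fix a b assume q: "?Q (fst (a, b), snd (a, b)) \<noteq> 0"
      have "\<exists>i k. P i (a @ k # b) \<noteq> 0"
      proof (rule ccontr)
        assume "\<not> (\<exists>i k. P i (a @ k # b) \<noteq> 0)"
        then have "?Q (a, b) = 0" unfolding Q by simp
        with q show False by simp
      qed
      then obtain i k where "P i (a @ k # b) \<noteq> 0" by blast
      then show "(a, b) \<in> S" by (intro inS[of "a @ k # b" i a k b]) (auto simp: supp_def)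
    qed
  qed auto
  also have "\<dots> = (\<Sum>x\<in>S. \<Sum>i\<in>UNIV. \<Sum>k\<in>UNIV. P i (glue k x) * g i k x)"
  proof (intro sum.cong refl)
    fix x
    have "?Q x = (\<Sum>i\<in>UNIV. \<Sum>k\<in>UNIV. alpha A k i * P i (glue k x))"
      using Q[of "fst x" "snd x"] by (simp add: glue_def)
    then show "?Q x * \<phi> (nc_mon (fst x)) * \<phi> (nc_mon (snd x)) = (\<Sum>i\<in>UNIV. \<Sum>k\<in>UNIV. P i (glue k x) * g i k x)"
      by (simp add: g_def sum_distrib_right sum_distrib_left mult_ac)
  qed
  also have "\<dots> = (\<Sum>x\<in>S. \<Sum>i\<in>UNIV. \<Sum>k\<in>UNIV. \<Sum>v\<in>supp i. P i v * (if glue k x = v then g i k x else 0))"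
  proof (intro sum.cong refl)
    fix x i k
    have "(\<Sum>v\<in>supp i. P i v * (if glue k x = v then g i k x else 0))
        = (\<Sum>v\<in>supp i. if glue k x = v then P i v * g i k x else 0)"
      by (intro sum.cong refl) auto
    also have "\<dots> = P i (glue k x) * g i k x"
      by (subst sum.delta'[OF fin]) (auto simp: supp_def)
    finally show "P i (glue k x) * g i k x = (\<Sum>v\<in>supp i. P i v * (if glue k x = v then g i k x else 0))" ..
  qed
  also have "\<dots> = (\<Sum>i\<in>UNIV. \<Sum>x\<in>S. \<Sum>k\<in>UNIV. \<Sum>v\<in>supp i. P i v * (if glue k x = v then g i k x else 0))"
    by (rule sum.swap)
  also have "\<dots> = (\<Sum>i\<in>UNIV. \<Sum>v\<in>supp i. \<Sum>x\<in>S. \<Sum>k\<in>UNIV. P i v * (if glue k x = v then g i k x else 0))"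
    by (intro sum.cong refl, rule trans[OF sum.cong[OF refl sum.swap] sum.swap])
  also have "\<dots> = (\<Sum>i\<in>UNIV. \<Sum>v\<in>supp i. P i v * (\<Sum>x\<in>S. \<Sum>k\<in>UNIV. if glue k x = v then g i k x else 0))"
    by (simp only: sum_distrib_left)
  also have "\<dots> = (\<Sum>i\<in>UNIV. \<Sum>v\<in>supp i. P i v * ssum v (\<lambda>a k b. alpha A k i * \<phi> (nc_mon a) * \<phi> (nc_mon b)))"
  proof (intro sum.cong refl arg_cong2[where f = "(*)"])
    fix i v assume v: "v \<in> supp i"
    have "ssum v (\<lambda>a k b. alpha A k i * \<phi> (nc_mon a) * \<phi> (nc_mon b))
        = (\<Sum>(a, b)\<in>S. \<Sum>k\<in>UNIV. if a @ k # b = v then alpha A k i * \<phi> (nc_mon a) * \<phi> (nc_mon b) else 0)"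
      by (rule ssum_as_pairs[OF S]) (rule inS[OF v])
    then show "(\<Sum>x\<in>S. \<Sum>k\<in>UNIV. if glue k x = v then g i k x else 0)
        = ssum v (\<lambda>a k b. alpha A k i * \<phi> (nc_mon a) * \<phi> (nc_mon b))"
      by (simp only: split_def glue_def g_def)
  qed
  finally show ?thesis unfolding supp_def .
qed

lemma has_sum_sum:
  fixes f :: "'i \<Rightarrow> 'a \<Rightarrow> complex"
  assumes "finite I" "\<And>i. i \<in> I \<Longrightarrow> (f i has_sum s i) S"
  shows "((\<lambda>x. \<Sum>i\<in>I. f i x) has_sum (\<Sum>i\<in>I. s i)) S"
  using assms by (induction I rule: finite_induct) (auto intro!: has_sum_add has_sum_0)

lemma has_sum_nc_mult_mon:
  fixes D :: "'n::finite ncps"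
  shows "((\<lambda>w. nc_mult D (nc_mon v) w * f w) has_sum s) UNIV \<longleftrightarrow> ((\<lambda>u. D u * f (u @ v)) has_sum s) UNIV"
proof -
  have "((\<lambda>w. nc_mult D (nc_mon v) w * f w) has_sum s) UNIV
      \<longleftrightarrow> ((\<lambda>w. nc_mult D (nc_mon v) w * f w) has_sum s) (range (\<lambda>u. u @ v))"
  proof (rule has_sum_cong_neutral)
    fix w assume "w \<in> UNIV - range (\<lambda>u. u @ v)"
    then have "drop (length w - length v) w \<noteq> v" by (metis Diff_iff append_take_drop_id rangeI)
    then show "nc_mult D (nc_mon v) w * f w = 0" by (simp add: nc_mult_mon_right)
  qed auto
  also have "\<dots> \<longleftrightarrow> ((\<lambda>u. D u * f (u @ v)) has_sum s) UNIV"
    by (subst has_sum_reindex) (auto simp: inj_def o_def nc_mult_append_mon)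
  finally show ?thesis .
qed

lemma nc_mult_expand_right:
  assumes "finite S" "\<And>v. P v \<noteq> 0 \<Longrightarrow> v \<in> S"
  shows "nc_mult D P w = (\<Sum>v\<in>S. P v * nc_mult D (nc_mon v) w)"
proof -
  have e: "P x = (\<Sum>v\<in>S. P v * nc_mon v x)" for x
  proof -
    have "(\<Sum>v\<in>S. P v * nc_mon v x) = (\<Sum>v\<in>S. if x = v then P v else 0)"
      unfolding nc_mon_def by (intro sum.cong refl) auto
    also have "\<dots> = P x" by (subst sum.delta'[OF assms(1)]) (use assms(2) in auto)
    finally show ?thesis ..
  qed
  have "nc_mult D P w = (\<Sum>m\<le>length w. D (take m w) * (\<Sum>v\<in>S. P v * nc_mon v (drop m w)))"
    unfolding nc_mult_def by (intro sum.cong refl arg_cong2[where f = "(*)"] e)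
  also have "\<dots> = (\<Sum>m\<le>length w. \<Sum>v\<in>S. P v * (D (take m w) * nc_mon v (drop m w)))"
    by (simp add: sum_distrib_left mult_ac)
  also have "\<dots> = (\<Sum>v\<in>S. P v * nc_mult D (nc_mon v) w)"
    by (subst sum.swap) (simp add: nc_mult_def sum_distrib_left)
  finally show ?thesis .
qed

lemma nc_mon_poly: "nc_mon v \<in> nc_polys" by (simp add: nc_polys_def nc_mon_def)

lemma nc_linear_expand:
  assumes lin: "nc_linear \<phi>" and P: "P \<in> nc_polys"
  shows "\<phi> P = (\<Sum>v | P v \<noteq> 0. P v * \<phi> (nc_mon v))"
proof -
  have add: "\<phi> (\<lambda>w. P w + Q w) = \<phi> P + \<phi> Q" if "P \<in> nc_polys" "Q \<in> nc_polys" for P Q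
    using lin that unfolding nc_linear_def by blast
  have "(\<lambda>w. \<Sum>v\<in>S. P v * nc_mon v w) \<in> nc_polys \<and> \<phi> (\<lambda>w. \<Sum>v\<in>S. P v * nc_mon v w) = (\<Sum>v\<in>S. P v * \<phi> (nc_mon v))"
    if "finite S" for S
    using that
  proof (induction S rule: finite_induct)
    case empty
    have "\<phi> (\<lambda>w. 0 * nc_mon [] w) = 0 * \<phi> (nc_mon [])"
      using lin nc_mon_poly unfolding nc_linear_def by blast
    then show ?case by (simp add: nc_polys_def)
  next
    case (insert x S)
    have x: "(\<lambda>w. P x * nc_mon x w) \<in> nc_polys"
      unfolding nc_polys_def nc_mon_def by (auto intro: finite_subset[of _ "{x}"])
    have "(\<lambda>w. (P x * nc_mon x w) + (\<Sum>v\<in>S. P v * nc_mon v w)) \<in> nc_polys"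
      using x insert.IH unfolding nc_polys_def
      by (auto intro: finite_subset[of _ "{w. P x * nc_mon x w \<noteq> 0} \<union> {w. (\<Sum>v\<in>S. P v * nc_mon v w) \<noteq> 0}"])
    moreover have "\<phi> (\<lambda>w. (P x * nc_mon x w) + (\<Sum>v\<in>S. P v * nc_mon v w))
        = \<phi> (\<lambda>w. P x * nc_mon x w) + \<phi> (\<lambda>w. \<Sum>v\<in>S. P v * nc_mon v w)"
      by (rule add[OF x insert.IH[THEN conjunct1]])
    moreover have "\<phi> (\<lambda>w. P x * nc_mon x w) = P x * \<phi> (nc_mon x)"
      using lin nc_mon_poly unfolding nc_linear_def by blast
    ultimately show ?case using insert by simp
  qed
  from this[of "{v. P v \<noteq> 0}"] P
  have e: "\<phi> (\<lambda>w. \<Sum>v | P v \<noteq> 0. P v * nc_mon v w) = (\<Sum>v | P v \<noteq> 0. P v * \<phi> (nc_mon v))"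
    by (simp add: nc_polys_def)
  have "(\<lambda>w. \<Sum>v | P v \<noteq> 0. P v * nc_mon v w) = P"
    using P by (auto simp: fun_eq_iff nc_polys_def nc_mon_def if_distrib[where f = "\<lambda>x. _ * x"] cong: if_cong)
  with e show ?thesis by simp
qed

text \<open>The linear functional on polynomials with given values on the words.\<close>

definition functional :: "'n ncps \<Rightarrow> 'n ncps \<Rightarrow> complex" where
  "functional f P = (\<Sum>v | P v \<noteq> 0. P v * f v)"

lemma functional_superset:
  assumes "finite S" "\<And>v. P v \<noteq> 0 \<Longrightarrow> v \<in> S"
  shows "functional f P = (\<Sum>v\<in>S. P v * f v)"
  unfolding functional_def by (rule sum.mono_neutral_left) (use assms in auto)

lemma functional_mon [simp]: "functional f (nc_mon v) = f v"
  by (subst functional_superset[of "{v}"]) (auto simp: nc_mon_def split: if_splits)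

lemma functional_linear: "nc_linear (functional f)"
  unfolding nc_linear_def
proof (intro conjI ballI allI)
  fix P Q :: "'a ncps" assume "P \<in> nc_polys" "Q \<in> nc_polys"
  then have "finite ({v. P v \<noteq> 0} \<union> {v. Q v \<noteq> 0})" by (simp add: nc_polys_def)
  then show "functional f (\<lambda>w. P w + Q w) = functional f P + functional f Q"
    by (subst (1 2 3) functional_superset[of "{v. P v \<noteq> 0} \<union> {v. Q v \<noteq> 0}"])
       (auto simp: distrib_right sum.distrib)
next
  fix c and P :: "'a ncps" assume "P \<in> nc_polys"
  then have "finite {v. P v \<noteq> 0}" by (simp add: nc_polys_def)
  then show "functional f (\<lambda>w. c * P w) = c * functional f P"
    by (subst (1 2) functional_superset[of "{v. P v \<noteq> 0}"]) (auto simp: sum_distrib_left mult.assoc)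
qed

lemma functional_star_mult:
  assumes P: "P \<in> nc_polys"
  shows "functional f (nc_mult (nc_star P) P)
     = (\<Sum>u | P u \<noteq> 0. \<Sum>v | P v \<noteq> 0. cnj (P u) * P v * f (rev u @ v))"
proof -
  let ?S = "{v. P v \<noteq> 0}"
  have S: "finite ?S" using P by (simp add: nc_polys_def)
  have pairs: "nc_mult (nc_star P) P w = (\<Sum>x | x \<in> ?S \<times> ?S \<and> rev (fst x) @ snd x = w. cnj (P (fst x)) * P (snd x))" for w
  proof -
    have "nc_mult (nc_star P) P w = (\<Sum>m | m \<le> length w \<and> P (rev (take m w)) \<noteq> 0 \<and> P (drop m w) \<noteq> 0. cnj (P (rev (take m w))) * P (drop m w))"
      unfolding nc_mult_def nc_star_def by (rule sum.mono_neutral_right) auto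
    also have "\<dots> = (\<Sum>x | x \<in> ?S \<times> ?S \<and> rev (fst x) @ snd x = w. cnj (P (fst x)) * P (snd x))"
      by (rule sum.reindex_bij_witness[of _ "\<lambda>x. length (fst x)" "\<lambda>m. (rev (take m w), drop m w)"]) auto
    finally show ?thesis .
  qed
  define T where "T = (\<lambda>x. rev (fst x) @ snd x) ` (?S \<times> ?S)"
  have T: "finite T" using S by (simp add: T_def)
  have "functional f (nc_mult (nc_star P) P) = (\<Sum>w\<in>T. nc_mult (nc_star P) P w * f w)"
  proof (rule functional_superset[OF T])
    fix w assume "nc_mult (nc_star P) P w \<noteq> 0"
    then obtain x where "x \<in> ?S \<times> ?S" "rev (fst x) @ snd x = w" unfolding pairs using sum.not_neutral_contains_not_neutral by blast
    then show "w \<in> T" unfolding T_def by blast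
  qed
  also have "\<dots> = (\<Sum>w\<in>T. \<Sum>x | x \<in> ?S \<times> ?S \<and> rev (fst x) @ snd x = w. cnj (P (fst x)) * P (snd x) * f (rev (fst x) @ snd x))"
    unfolding pairs sum_distrib_right by (intro sum.cong refl) auto
  also have "\<dots> = (\<Sum>x\<in>?S \<times> ?S. cnj (P (fst x)) * P (snd x) * f (rev (fst x) @ snd x))"
    unfolding T_def by (rule sum.image_gen[symmetric]) (use S in auto)
  finally show ?thesis by (simp add: sum.cartesian_product split_def)
qed

lemma functional_state:
  assumes "positive f" "f [] = 1"
  shows "nc_state (functional f)"
  unfolding nc_state_def
proof (intro conjI ballI functional_linear)
  fix P :: "'a ncps" assume P: "P \<in> nc_polys"
  then have "finite {v. P v \<noteq> 0}" by (simp add: nc_polys_def)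
  then show "functional f (nc_mult (nc_star P) P) \<in> \<real>\<^sub>\<ge>\<^sub>0"
    unfolding functional_star_mult[OF P] using assms(1) by (intro psd_onD) (auto simp: positive_def)
qed (use assms in simp)

section \<open>The Gibbs state\<close>

text \<open>The summand of the gradient that comes from the quadratic potential picks out a single word, so
  convergence concerns \<open>d\<close> alone.\<close>

lemma has_sum_shifted_drift:
  fixes d :: "'n ncps"
  shows "((\<lambda>u. ((if u = [j] then 1 else 0) + d u) * f (u @ w)) has_sum s) UNIV
     \<longleftrightarrow> ((\<lambda>u. d u * f (u @ w)) has_sum (s - f (j # w))) UNIV"
proof -
  have "((\<lambda>u. if u = [j] then f (u @ w) else 0) has_sum f (j # w)) {[j]}"
    by (rule has_sum_finiteI) auto
  then have 1: "((\<lambda>u. if u = [j] then f (u @ w) else 0) has_sum f (j # w)) UNIV"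
    by (rule has_sum_cong_neutral[THEN iffD1, rotated -1]) auto
  show ?thesis
  proof
    assume "((\<lambda>u. ((if u = [j] then 1 else 0) + d u) * f (u @ w)) has_sum s) UNIV"
    from has_sum_diff[OF this 1] show "((\<lambda>u. d u * f (u @ w)) has_sum (s - f (j # w))) UNIV"
      by (rule has_sum_cong[THEN iffD1, rotated]) (simp add: distrib_right)
  next
    assume "((\<lambda>u. d u * f (u @ w)) has_sum (s - f (j # w))) UNIV"
    from has_sum_add[OF this 1]
    have "((\<lambda>u. d u * f (u @ w) + (if u = [j] then f (u @ w) else 0)) has_sum s) UNIV" by simp
    then show "((\<lambda>u. ((if u = [j] then 1 else 0) + d u) * f (u @ w)) has_sum s) UNIV"
      by (rule has_sum_cong[THEN iffD1, rotated]) (simp add: distrib_right)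
  qed
qed

context modular
begin

text \<open>Both sides of the equation are linear in the test polynomials \<open>P\<close>, and for \<open>P\<close> with a single
  monomial it is the equation on words.\<close>

lemma schwinger_dyson_iff_sd_word:
  assumes D: "\<And>j u. cyclic_diff A j V u = (if u = [j] then 1 else 0) + d j u"
    and one: "\<phi> (nc_mon []) = 1"
  shows "schwinger_dyson A V \<phi> \<longleftrightarrow> sd_word al d (\<lambda>w. \<phi> (nc_mon w))"
proof
  let ?f = "\<lambda>w. \<phi> (nc_mon w)"
  have word: "((\<lambda>w. nc_mult (cyclic_grad A V j) (nc_mon v) w * ?f w) has_sum s) UNIV
      \<longleftrightarrow> ((\<lambda>u. d j u * ?f (u @ v)) has_sum (s - ?f (j # v))) UNIV" for j v s
    unfolding has_sum_nc_mult_mon cyclic_grad_def D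
    by (rule has_sum_shifted_drift[where f = ?f])
  show "sd_word al d ?f" if sd: "schwinger_dyson A V \<phi>"
    unfolding sd_word_def
  proof (intro conjI allI)
    fix j :: 'n and v :: "'n list"
    define P :: "'n \<Rightarrow> 'n ncps" where "P i = (if i = j then nc_mon v else (\<lambda>_. 0))" for i
    have P: "P i \<in> nc_polys" for i using nc_mon_poly[of v] by (auto simp: P_def nc_polys_def)
    have "nc_dot (cyclic_grad A V) P w = nc_mult (cyclic_grad A V j) (nc_mon v) w" for w
    proof -
      have "nc_dot (cyclic_grad A V) P w = (\<Sum>i\<in>UNIV. if i = j then nc_mult (cyclic_grad A V j) (nc_mon v) w else 0)"
        unfolding nc_dot_def by (intro sum.cong refl) (auto simp: P_def nc_mult_def)
      then show ?thesis by simp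
    qed
    moreover have "tensor_eval \<phi> (tensor_trace (sigma_jacobian A P)) = ssum v (\<lambda>a k b. al k j * ?f a * ?f b)"
    proof -
      have "(\<Sum>x | P i x \<noteq> 0. P i x * ssum x (\<lambda>a k b. al k i * ?f a * ?f b))
          = (if i = j then ssum v (\<lambda>a k b. al k j * ?f a * ?f b) else 0)" for i
        by (simp add: P_def nc_mon_def)
      then show ?thesis unfolding tensor_eval_jacobian[OF P] by simp
    qed
    ultimately show "((\<lambda>u. d j u * ?f (u @ v)) has_sum
        (ssum v (\<lambda>a k b. al k j * ?f a * ?f b) - ?f (j # v))) UNIV"
      using sd[unfolded schwinger_dyson_def, rule_format, of P] P word by simp
  qed (rule one)
  show "schwinger_dyson A V \<phi>" if sd: "sd_word al d ?f"
    unfolding schwinger_dyson_def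
  proof (intro allI impI)
    fix P :: "'n \<Rightarrow> 'n ncps" assume P: "\<forall>i. P i \<in> nc_polys"
    then have fin: "finite {v. P i v \<noteq> 0}" for i by (simp add: nc_polys_def)
    have 1: "((\<lambda>w. P i v * (nc_mult (cyclic_grad A V i) (nc_mon v) w * ?f w)) has_sum
        P i v * ssum v (\<lambda>a k b. al k i * ?f a * ?f b)) UNIV" for i v
      using sd unfolding sd_word_def by (intro has_sum_cmult_right word[THEN iffD2]) blast
    have "((\<lambda>w. \<Sum>i\<in>UNIV. \<Sum>v | P i v \<noteq> 0. P i v * (nc_mult (cyclic_grad A V i) (nc_mon v) w * ?f w)) has_sum
        (\<Sum>i\<in>UNIV. \<Sum>v | P i v \<noteq> 0. P i v * ssum v (\<lambda>a k b. al k i * ?f a * ?f b))) UNIV"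
      by (intro has_sum_sum finite fin 1)
    moreover have "nc_dot (cyclic_grad A V) P w * ?f w
        = (\<Sum>i\<in>UNIV. \<Sum>v | P i v \<noteq> 0. P i v * (nc_mult (cyclic_grad A V i) (nc_mon v) w * ?f w))" for w
    proof -
      have "nc_mult (cyclic_grad A V i) (P i) w = (\<Sum>v | P i v \<noteq> 0. P i v * nc_mult (cyclic_grad A V i) (nc_mon v) w)" for i
        by (rule nc_mult_expand_right[OF fin]) simp
      then show ?thesis by (simp add: nc_dot_def sum_distrib_right mult.assoc)
    qed
    ultimately show "((\<lambda>w. nc_dot (cyclic_grad A V) P w * ?f w) has_sum
        tensor_eval \<phi> (tensor_trace (sigma_jacobian A P))) UNIV"
      using P by (simp add: tensor_eval_jacobian)
  qed
qed

text \<open>As \<open>\<parallel>A\<parallel> \<ge> 1\<close>, the radius \<open>R\<close> is at least \<open>4\<close>.\<close>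

lemma weighted_sum_le:
  assumes R: "R \<ge> 4 * sqrt (mat_norm A)" and W: "nc_norm_sigma A R W < ennreal e" and F: "finite F"
  shows "(\<Sum>w\<in>F. cmod (W w) * 4 ^ length w) \<le> e"
proof -
  have "sqrt 1 \<le> sqrt (mat_norm A)" using mat_norm_A by (intro real_sqrt_le_mono)
  then have R4: "4 \<le> R" using R unfolding real_sqrt_one by linarith
  have "ennreal (\<Sum>w\<in>F. cmod (W w) * 4 ^ length w) \<le> ennreal (\<Sum>w\<in>F. cmod (W w) * R ^ length w)"
    using R4 by (intro ennreal_leI sum_mono mult_left_mono power_mono) auto
  also have "\<dots> = (\<Sum>w\<in>F. ennreal (cmod (W w) * R ^ length w))"
    using R4 by (intro sum_ennreal[symmetric]) simp
  also have "\<dots> \<le> nc_norm_sigma A R W" by (rule finite_sum_le_nc_norm_sigma[OF F])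
  also note W
  finally show ?thesis by (simp add: ennreal_less_iff sum_nonneg)
qed

text \<open>The constant \<open>1/100\<close> is \<open>1/5\<close> of the admissible size \<open>1/20\<close> of the drift; the factor \<open>5\<close> is lost in
  \<open>power_weight_le\<close>.\<close>

theorem unique_gibbs_state:
  assumes R: "R \<ge> 4 * sqrt (mat_norm A)"
    and V: "V = (\<lambda>w. V_quad A w + W w)" "V \<in> nc_space_cs A R"
    and W: "nc_norm_sigma A R W < ennreal (1/100)"
  shows "sd_solution A V \<phi> \<Longrightarrow> sd_solution A V \<psi> \<Longrightarrow> P \<in> nc_polys \<Longrightarrow> \<phi> P = \<psi> P"
    and "nc_star V = V \<Longrightarrow> \<exists>\<phi>. sd_solution A V \<phi>"
proof -
  have V_rot: "V (m # u) = (\<Sum>k\<in>UNIV. A $ k $ m * V (u @ [k]))" for m u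
    using V(2) nc_rho_Cons[of V m u] by (simp add: nc_space_cs_def)
  have W_rot: "W (m # u) = (\<Sum>k\<in>UNIV. A $ k $ m * W (u @ [k]))" for m u
    using V_rot[of m u] unfolding V(1) V_quad_rho[of m u] by (simp add: distrib_left sum.distrib)
  define d where "d j u = of_nat (Suc (length u)) * (\<Sum>k\<in>UNIV. al j k * W (u @ [k]))" for j u
  have D: "cyclic_diff A j V u = (if u = [j] then 1 else 0) + d j u" for j u
    unfolding cyclic_diff_rho_invariant[OF V_rot] V_quad_gradient[symmetric] d_def
    unfolding V(1) by (simp only: distrib_left sum.distrib)
  have small: "small_drift d"
    by (rule small_driftI[OF al_le d_def weighted_sum_le[OF R W]])
  show "\<phi> P = \<psi> P" if sol: "sd_solution A V \<phi>" "sd_solution A V \<psi>" and P: "P \<in> nc_polys"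
  proof -
    have sd: "sd_word al d (\<lambda>w. \<eta> (nc_mon w))" if "sd_solution A V \<eta>" for \<eta>
      using that schwinger_dyson_iff_sd_word[OF D, of \<eta>] by (simp add: sd_solution_def nc_state_def)
    have "(\<lambda>w. \<phi> (nc_mon w)) = (\<lambda>w. \<psi> (nc_mon w))"
      by (rule sd_word_unique[OF al_le small sd[OF sol(1)] sd[OF sol(2)]])
         (use sol in \<open>auto simp: sd_solution_def\<close>)
    then have eq: "\<phi> (nc_mon v) = \<psi> (nc_mon v)" for v by (rule fun_cong)
    have "nc_linear \<phi>" "nc_linear \<psi>" using sol by (auto simp: sd_solution_def nc_state_def)
    then show ?thesis using nc_linear_expand[of \<phi>] nc_linear_expand[of \<psi>] P eq by simp
  qed
  show "\<exists>\<phi>. sd_solution A V \<phi>" if sa: "nc_star V = V"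
  proof -
    have W_sa: "W (rev w) = cnj (W w)" for w
    proof -
      have "V (rev w) = cnj (V w)" using fun_cong[OF sa, of "rev w"] by (simp add: nc_star_def)
      moreover have "V_quad A (rev w) = cnj (V_quad A w)"
        using fun_cong[OF V_quad_star, of "rev w"] by (simp add: nc_star_def)
      ultimately show ?thesis by (simp add: V(1))
    qed
    interpret pot: kms_potential al "\<lambda>j k. A $ j $ k" W d
      by unfold_locales (fact W_rot W_sa d_def small)+
    obtain f where f: "sd_word al d f" "positive f" "\<And>w. cmod (f w) \<le> 3 ^ length w"
      using pot.gibbs_state_exists by blast
    have one: "f [] = 1" using f(1) by (simp add: sd_word_def)
    have "sd_solution A V (functional f)"
      unfolding sd_solution_def
    proof (intro conjI allI)
      show "schwinger_dyson A V (functional f)"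
        using f(1) one schwinger_dyson_iff_sd_word[OF D, of "functional f"] by simp
    qed (use f one functional_state in auto)
    then show ?thesis by blast
  qed
qed

end

theorem theorem2p12:
  fixes idx :: "'n::finite \<Rightarrow> nat" and L :: nat and lam :: "nat \<Rightarrow> real"
    and A :: "complex^'n^'n" and R :: real
  assumes "bij_betw idx UNIV {..<CARD('n)}"
    and "2 * L \<le> CARD('n)"
    and "\<And>k. k < L \<Longrightarrow> lam k > 0"
    and "A = modular_matrix idx L lam"
    and "R \<ge> 4 * sqrt (mat_norm A)"
  shows "\<exists>\<epsilon>::real. \<epsilon> > 0 \<and> (\<forall>W V. V = (\<lambda>w. V_quad A w + W w) \<longrightarrow> V \<in> nc_space_cs A R \<longrightarrow>
           nc_norm_sigma A R W < ennreal \<epsilon> \<longrightarrow>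
           (\<forall>\<phi> \<psi>. sd_solution A V \<phi> \<longrightarrow> sd_solution A V \<psi> \<longrightarrow> (\<forall>P\<in>nc_polys. \<phi> P = \<psi> P)) \<and>
           (nc_star V = V \<longrightarrow> (\<exists>\<phi>. sd_solution A V \<phi>)))"
proof -
  interpret modular idx L lam A by unfold_locales (fact assms(1-4))+
  show ?thesis
  proof (intro exI[of _ "1/100"] conjI allI impI ballI)
    fix W V \<phi> \<psi> P
    assume V: "V = (\<lambda>w. V_quad A w + W w)" "V \<in> nc_space_cs A R"
      and W: "nc_norm_sigma A R W < ennreal (1/100)"
    show "sd_solution A V \<phi> \<Longrightarrow> sd_solution A V \<psi> \<Longrightarrow> P \<in> nc_polys \<Longrightarrow> \<phi> P = \<psi> P"
      by (rule unique_gibbs_state(1)[OF assms(5) V W])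
    show "nc_star V = V \<Longrightarrow> \<exists>\<phi>. sd_solution A V \<phi>"
      by (rule unique_gibbs_state(2)[OF assms(5) V W])
  qed simp
qed

end
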